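(* Let $p=2$, let $\mathbb{S}_1=\mathbb{Z}_2^\times$, and let $(E_1)_*=\mathbb{Z}_2[u^{\pm1}]$ with $u$ in degree $-2$ and with $g\in\mathbb{Z}_2^\times$ acting by the graded $\mathbb{Z}_2$-algebra automorphism determined by $u\mapsto gu$. Then $$H^s(\mathbb{S}_1,(E_1)_t)\cong\begin{cases}\mathbb{Z}_2 & t=0,\ s=0,1\\ \mathbb{Z}/(2^{\nu_2(t')+3}) & s=1,\ t=4t'\neq 0\\ \mathbb{Z}/2 & s=1,\ t=4t'+2\\ \mathbb{Z}/2 & s\geq 2,\ t \text{ even}\\ 0 & \text{otherwise,}\end{cases}$$ where $t'$ denotes an integer.
   Context: $(E_1)_t$ denotes the degree $t$ part of $(E_1)_*$. $\nu_2$ is the $2$-adic valuation of integers. Cohomology is continuous cohomology of profinite groups: $H^s(G,M)=\mathrm{Ext}^s_{\mathbb{Z}_2[[G]]}(\mathbb{Z}_2,M)$, computed in the category of profinite modules over the completed group algebra $\mathbb{Z}_2[[G]]$. *)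

theory Defs
  imports
    "HOL-Analysis.Analysis"
    "HOL-Algebra.Algebra"
    "HOL-Algebra.Algebraic_Closure_Type"
    "HOL-Library.Poly_Mapping"
begin

section \<open>The ring of 2-adic integers\<close>

text \<open>Elements are the compatible families of residues modulo \<open>2 ^ n\<close>; the case \<open>m = n\<close> of the
  condition says that the \<open>n\<close>-th residue is reduced.\<close>

typedef z2adic = "{x :: nat \<Rightarrow> int. \<forall>m n. m \<le> n \<longrightarrow> x n mod 2 ^ m = x m}"
  morphisms residue Abs_z2adic
  by (rule exI[of _ "\<lambda>_. 0"]) auto

setup_lifting type_definition_z2adic

lemma residue_mod: "m \<le> n \<Longrightarrow> residue x n mod 2 ^ m = residue x m"
  using residue[of x] by auto

lemma residue_0 [simp]: "residue x 0 = 0"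
  using residue_mod[of 0 0 x] by simp

lemma z2adic_eqI: "(\<And>n. residue x n = residue y n) \<Longrightarrow> x = y"
  by (simp add: residue_inject[symmetric] fun_eq_iff)

lemma mod_2_power_cancel: "m \<le> n \<Longrightarrow> (a :: int) mod 2 ^ n mod 2 ^ m = a mod 2 ^ m"
  by (simp add: mod_mod_cancel le_imp_power_dvd)

instantiation z2adic :: comm_ring_1
begin

lift_definition zero_z2adic :: z2adic is "\<lambda>_. 0"
  by simp

lift_definition one_z2adic :: z2adic is "\<lambda>n. 1 mod 2 ^ n"
  by (simp add: mod_2_power_cancel)

lift_definition plus_z2adic :: "z2adic \<Rightarrow> z2adic \<Rightarrow> z2adic"
  is "\<lambda>x y n. (x n + y n) mod 2 ^ n"
  by (simp add: mod_2_power_cancel) (metis mod_add_eq)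

lift_definition times_z2adic :: "z2adic \<Rightarrow> z2adic \<Rightarrow> z2adic"
  is "\<lambda>x y n. (x n * y n) mod 2 ^ n"
  by (simp add: mod_2_power_cancel) (metis mod_mult_eq)

lift_definition uminus_z2adic :: "z2adic \<Rightarrow> z2adic" is "\<lambda>x n. (- x n) mod 2 ^ n"
  by (simp add: mod_2_power_cancel) (metis mod_minus_eq)

definition minus_z2adic :: "z2adic \<Rightarrow> z2adic \<Rightarrow> z2adic"
  where "minus_z2adic x y = x + - y"

instance
proof
  fix a b c :: z2adic
  show "a * b * c = a * (b * c)"
    by (rule z2adic_eqI) (simp add: times_z2adic.rep_eq mod_simps mult.assoc)
  show "a * b = b * a"
    by (rule z2adic_eqI) (simp add: times_z2adic.rep_eq mult.commute)
  show "1 * a = a"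
    by (rule z2adic_eqI)
      (simp add: times_z2adic.rep_eq one_z2adic.rep_eq mod_simps residue_mod)
  show "a + b + c = a + (b + c)"
    by (rule z2adic_eqI) (simp add: plus_z2adic.rep_eq mod_simps add.assoc)
  show "a + b = b + a"
    by (rule z2adic_eqI) (simp add: plus_z2adic.rep_eq add.commute)
  show "0 + a = a"
    by (rule z2adic_eqI) (simp add: plus_z2adic.rep_eq zero_z2adic.rep_eq residue_mod)
  show "- a + a = 0"
    by (rule z2adic_eqI)
      (simp add: plus_z2adic.rep_eq zero_z2adic.rep_eq uminus_z2adic.rep_eq mod_simps)
  show "a - b = a + - b"
    by (rule minus_z2adic_def)
  show "(a + b) * c = a * c + b * c"
    by (rule z2adic_eqI)
      (simp add: plus_z2adic.rep_eq times_z2adic.rep_eq mod_simps distrib_right)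
  have "residue 0 1 \<noteq> residue 1 1"
    by (simp add: zero_z2adic.rep_eq one_z2adic.rep_eq)
  then show "(0 :: z2adic) \<noteq> 1"
    by metis
qed

end

text \<open>The inverse limit topology.\<close>

instantiation z2adic :: topological_space
begin

definition open_z2adic :: "z2adic set \<Rightarrow> bool" where
  "open_z2adic U \<longleftrightarrow> (\<forall>x\<in>U. \<exists>n. \<forall>y. residue y n = residue x n \<longrightarrow> y \<in> U)"

instance
proof
  show "open (UNIV :: z2adic set)"
    by (simp add: open_z2adic_def)
  show "open (\<Union>K)" if "\<forall>S\<in>K. open S" for K :: "z2adic set set"
    using that unfolding open_z2adic_def by (meson Union_iff)
  show "open (S \<inter> T)" if S: "open S" and T: "open T" for S T :: "z2adic set"
    unfolding open_z2adic_def
  proof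
    fix x assume x: "x \<in> S \<inter> T"
    obtain m where m: "\<And>y. residue y m = residue x m \<Longrightarrow> y \<in> S"
      using S x unfolding open_z2adic_def by blast
    obtain n where n: "\<And>y. residue y n = residue x n \<Longrightarrow> y \<in> T"
      using T x unfolding open_z2adic_def by blast
    have "y \<in> S \<inter> T" if y: "residue y (max m n) = residue x (max m n)" for y
    proof
      show "y \<in> S"
        using m residue_mod[of m "max m n" y] residue_mod[of m "max m n" x] y by simp
      show "y \<in> T"
        using n residue_mod[of n "max m n" y] residue_mod[of n "max m n" x] y by simp
    qed
    then show "\<exists>n. \<forall>y. residue y n = residue x n \<longrightarrow> y \<in> S \<inter> T"
      by blast
  qed
qed

end

abbreviation Z2 :: "z2adic ring"
  where "Z2 \<equiv> ring_of_type_algebra"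


section \<open>Profinite modules over a commutative topological ring\<close>

record 'a top_ring = "'a ring" +
  ring_top :: "'a topology"

record ('a, 'b) top_module = "('a, 'b) module" +
  mod_top :: "'b topology"

definition profinite_space :: "'a topology \<Rightarrow> bool" where
  "profinite_space T \<longleftrightarrow> compact_space T \<and> Hausdorff_space T \<and>
     (\<forall>S. connectedin T S \<longrightarrow> (\<exists>a. S \<subseteq> {a}))"

definition profinite_module :: "'r top_ring \<Rightarrow> ('r, 'm) top_module \<Rightarrow> bool" where
  "profinite_module R M \<longleftrightarrow>
     module R M \<and> topspace (mod_top M) = carrier M \<and> profinite_space (mod_top M) \<and>
     continuous_map (prod_topology (mod_top M) (mod_top M)) (mod_top M)
       (\<lambda>(x, y). x \<oplus>\<^bsub>M\<^esub> y) \<and>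
     continuous_map (mod_top M) (mod_top M) (\<lambda>x. \<ominus>\<^bsub>M\<^esub> x) \<and>
     continuous_map (prod_topology (ring_top R) (mod_top M)) (mod_top M)
       (\<lambda>(r, x). r \<odot>\<^bsub>M\<^esub> x)"

text \<open>Morphisms are extensional functions, so that equality of morphisms is equality.\<close>

definition continuous_hom ::
    "'r top_ring \<Rightarrow> ('r, 'm) top_module \<Rightarrow> ('r, 'n) top_module \<Rightarrow> ('m \<Rightarrow> 'n) set" where
  "continuous_hom R M N =
     {f \<in> carrier M \<rightarrow>\<^sub>E carrier N.
        (\<forall>x\<in>carrier M. \<forall>y\<in>carrier M. f (x \<oplus>\<^bsub>M\<^esub> y) = f x \<oplus>\<^bsub>N\<^esub> f y) \<and>
        (\<forall>r\<in>carrier R. \<forall>x\<in>carrier M. f (r \<odot>\<^bsub>M\<^esub> x) = r \<odot>\<^bsub>N\<^esub> f x) \<and>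
        continuous_map (mod_top M) (mod_top N) f}"

text \<open>Epimorphisms of profinite modules are the surjective morphisms. A HOL formula cannot
  quantify over types, so the category is that of the profinite modules whose elements are taken
  from a type \<open>'m\<close>, the universe. It only has to be large enough to contain the rings and modules
  of interest.\<close>

definition projective_module :: "'r top_ring \<Rightarrow> ('r, 'm) top_module \<Rightarrow> bool" where
  "projective_module R P \<longleftrightarrow> profinite_module R P \<and>
     (\<forall>(M :: ('r, 'm) top_module) (N :: ('r, 'm) top_module) f g.
        profinite_module R M \<and> profinite_module R N \<and>
        f \<in> continuous_hom R M N \<and> f ` carrier M = carrier N \<and> g \<in> continuous_hom R P N \<longrightarrow>
        (\<exists>h\<in>continuous_hom R P M. \<forall>x\<in>carrier P. f (h x) = g x))"

definition projective_resolution ::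
    "'r top_ring \<Rightarrow> ('r, 'a) top_module \<Rightarrow> (nat \<Rightarrow> ('r, 'm) top_module) \<Rightarrow>
     (nat \<Rightarrow> 'm \<Rightarrow> 'm) \<Rightarrow> ('m \<Rightarrow> 'a) \<Rightarrow> bool" where
  "projective_resolution R A P d \<epsilon> \<longleftrightarrow>
     (\<forall>n. projective_module R (P n)) \<and>
     (\<forall>n. d n \<in> continuous_hom R (P (Suc n)) (P n)) \<and>
     \<epsilon> \<in> continuous_hom R (P 0) A \<and>
     \<epsilon> ` carrier (P 0) = carrier A \<and>
     d 0 ` carrier (P (Suc 0)) = {x \<in> carrier (P 0). \<epsilon> x = \<zero>\<^bsub>A\<^esub>} \<and>
     (\<forall>n. d (Suc n) ` carrier (P (Suc (Suc n))) =
            {x \<in> carrier (P (Suc n)). d n x = \<zero>\<^bsub>P n\<^esub>})"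


section \<open>Ext groups\<close>

definition hom_group ::
    "'r top_ring \<Rightarrow> ('r, 'm) top_module \<Rightarrow> ('r, 'n) top_module \<Rightarrow> ('m \<Rightarrow> 'n) monoid" where
  "hom_group R M N =
     \<lparr>carrier = continuous_hom R M N,
      monoid.mult = (\<lambda>f g. \<lambda>x\<in>carrier M. f x \<oplus>\<^bsub>N\<^esub> g x),
      one = (\<lambda>x\<in>carrier M. \<zero>\<^bsub>N\<^esub>)\<rparr>"

definition coboundary_map ::
    "(nat \<Rightarrow> ('r, 'm) top_module) \<Rightarrow> (nat \<Rightarrow> 'm \<Rightarrow> 'm) \<Rightarrow> nat \<Rightarrow> ('m \<Rightarrow> 'n) \<Rightarrow> ('m \<Rightarrow> 'n)" where
  "coboundary_map P d n f = compose (carrier (P (Suc n))) f (d n)"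

definition cocycles ::
    "'r top_ring \<Rightarrow> (nat \<Rightarrow> ('r, 'm) top_module) \<Rightarrow> (nat \<Rightarrow> 'm \<Rightarrow> 'm) \<Rightarrow>
     ('r, 'n) top_module \<Rightarrow> nat \<Rightarrow> ('m \<Rightarrow> 'n) set" where
  "cocycles R P d M n =
     kernel (hom_group R (P n) M) (hom_group R (P (Suc n)) M) (coboundary_map P d n)"

definition coboundaries ::
    "'r top_ring \<Rightarrow> (nat \<Rightarrow> ('r, 'm) top_module) \<Rightarrow> (nat \<Rightarrow> 'm \<Rightarrow> 'm) \<Rightarrow>
     ('r, 'n) top_module \<Rightarrow> nat \<Rightarrow> ('m \<Rightarrow> 'n) set" where
  "coboundaries R P d M n =
     (case n of 0 \<Rightarrow> {\<one>\<^bsub>hom_group R (P 0) M\<^esub>}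
      | Suc k \<Rightarrow> coboundary_map P d k ` continuous_hom R (P k) M)"

definition Hom_cohomology ::
    "'r top_ring \<Rightarrow> (nat \<Rightarrow> ('r, 'm) top_module) \<Rightarrow> (nat \<Rightarrow> 'm \<Rightarrow> 'm) \<Rightarrow>
     ('r, 'n) top_module \<Rightarrow> nat \<Rightarrow> ('m \<Rightarrow> 'n) set monoid" where
  "Hom_cohomology R P d M n =
     (hom_group R (P n) M)\<lparr>carrier := cocycles R P d M n\<rparr> Mod coboundaries R P d M n"

text \<open>As usual, a projective resolution is chosen; up to isomorphism the choice is irrelevant.\<close>

definition Ext ::
    "'u itself \<Rightarrow> 'r top_ring \<Rightarrow> ('r, 'a) top_module \<Rightarrow> ('r, 'n) top_module \<Rightarrow> nat \<Rightarrow>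
     ('u \<Rightarrow> 'n) set monoid" where
  "Ext _ R A M n =
     (let (P, d, \<epsilon>) = (SOME (P :: nat \<Rightarrow> ('r, 'u) top_module, d, \<epsilon>).
                          projective_resolution R A P d \<epsilon>)
      in Hom_cohomology R P d M n)"


section \<open>Completed group algebras\<close>

definition open_normal_subgroups :: "'g monoid \<Rightarrow> 'g topology \<Rightarrow> 'g set set" where
  "open_normal_subgroups G T = {U. U \<lhd> G \<and> openin T U}"

text \<open>The group algebra over the 2-adic integers, for a finite group.\<close>

definition group_algebra :: "'h monoid \<Rightarrow> ('h \<Rightarrow> z2adic) ring" where
  "group_algebra H =
     \<lparr>carrier = extensional (carrier H),
      monoid.mult = (\<lambda>a b. \<lambda>z\<in>carrier H. \<Sum>x\<in>carrier H. a x * b (inv\<^bsub>H\<^esub> x \<otimes>\<^bsub>H\<^esub> z)),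
      one = (\<lambda>z\<in>carrier H. if z = \<one>\<^bsub>H\<^esub> then 1 else 0),
      ring.zero = (\<lambda>z\<in>carrier H. 0),
      add = (\<lambda>a b. \<lambda>z\<in>carrier H. a z + b z)\<rparr>"

text \<open>The inverse limit of the group algebras of \<open>G Mod U\<close> over the open normal subgroups \<open>U\<close>.
  For \<open>V \<subseteq> U\<close>, the projection to \<open>G Mod U\<close> adds up the coefficients of the cosets of \<open>V\<close> that lie
  in a given coset of \<open>U\<close>. The library's modules are over commutative rings, so profinite modules
  over this algebra are meant for abelian \<open>G\<close>.\<close>

type_synonym 'g cga = "'g set \<Rightarrow> 'g set \<Rightarrow> z2adic"

definition cga_carrier :: "'g monoid \<Rightarrow> 'g topology \<Rightarrow> 'g cga set" where
  "cga_carrier G T =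
     {x \<in> Pi\<^sub>E (open_normal_subgroups G T) (\<lambda>U. carrier (group_algebra (G Mod U))).
        \<forall>U\<in>open_normal_subgroups G T. \<forall>V\<in>open_normal_subgroups G T. V \<subseteq> U \<longrightarrow>
          (\<forall>c\<in>carrier (G Mod U). x U c = (\<Sum>e | e \<in> carrier (G Mod V) \<and> e \<subseteq> c. x V e))}"

definition completed_group_algebra :: "'g monoid \<Rightarrow> 'g topology \<Rightarrow> 'g cga top_ring" where
  "completed_group_algebra G T =
     \<lparr>carrier = cga_carrier G T,
      monoid.mult =
        (\<lambda>x y. \<lambda>U\<in>open_normal_subgroups G T. x U \<otimes>\<^bsub>group_algebra (G Mod U)\<^esub> y U),
      one = (\<lambda>U\<in>open_normal_subgroups G T. \<one>\<^bsub>group_algebra (G Mod U)\<^esub>),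
      ring.zero = (\<lambda>U\<in>open_normal_subgroups G T. \<zero>\<^bsub>group_algebra (G Mod U)\<^esub>),
      add = (\<lambda>x y. \<lambda>U\<in>open_normal_subgroups G T. x U \<oplus>\<^bsub>group_algebra (G Mod U)\<^esub> y U),
      ring_top =
        subtopology
          (product_topology (\<lambda>U. product_topology (\<lambda>_. euclidean) (carrier (G Mod U)))
            (open_normal_subgroups G T))
          (cga_carrier G T)\<rparr>"

text \<open>A profinite module \<open>N\<close> over the 2-adic integers with a continuous linear action of \<open>G\<close> is a
  module over the completed group algebra: the group ring acts in the obvious way, and the action is
  extended by continuity, as the limit over \<open>U\<close> of \<open>\<Sum>\<^bsub>c\<^esub> x\<^bsub>U\<^esub>(c) g\<^bsub>c\<^esub> m\<close> with \<open>c\<close> running through the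
  cosets of \<open>U\<close> and \<open>g\<^bsub>c\<^esub> \<in> c\<close> any representative.\<close>

definition open_normal_filter :: "'g monoid \<Rightarrow> 'g topology \<Rightarrow> 'g set filter" where
  "open_normal_filter G T =
     (INF U\<in>open_normal_subgroups G T. principal {V \<in> open_normal_subgroups G T. V \<subseteq> U})"

definition cga_module ::
    "'g monoid \<Rightarrow> 'g topology \<Rightarrow> (z2adic, 'm) top_module \<Rightarrow> ('g \<Rightarrow> 'm \<Rightarrow> 'm) \<Rightarrow>
     ('g cga, 'm) top_module" where
  "cga_module G T N \<rho> =
     \<lparr>carrier = carrier N, monoid.mult = monoid.mult N, one = one N, ring.zero = ring.zero N, add = add N,
      smult =
        (\<lambda>x m. THE y. limitin (mod_top N)
           (\<lambda>U. \<Oplus>\<^bsub>N\<^esub>c\<in>carrier (G Mod U). x U c \<odot>\<^bsub>N\<^esub> \<rho> (SOME g. g \<in> c) m)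
           y (open_normal_filter G T)),
      mod_top = mod_top N\<rparr>"

definition Z2_module :: "(z2adic, z2adic) top_module" where
  "Z2_module =
     \<lparr>carrier = UNIV, monoid.mult = (*), one = 1, ring.zero = 0, add = (+), smult = (*),
      mod_top = euclidean\<rparr>"

definition continuous_cohomology ::
    "'u itself \<Rightarrow> 'g monoid \<Rightarrow> 'g topology \<Rightarrow> (z2adic, 'm) top_module \<Rightarrow>
     ('g \<Rightarrow> 'm \<Rightarrow> 'm) \<Rightarrow> nat \<Rightarrow> ('u \<Rightarrow> 'm) set monoid" where
  "continuous_cohomology _ G T N \<rho> s =
     Ext TYPE('u) (completed_group_algebra G T)
       (cga_module G T Z2_module (\<lambda>_ m. m)) (cga_module G T N \<rho>) s"


section \<open>The Morava stabilizer group and its action on the coefficients of Morava E-theory, at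
  height one and the prime 2\<close>

definition S1 :: "z2adic monoid"
  where "S1 = units_of Z2"

definition S1_top :: "z2adic topology"
  where "S1_top = subtopology euclidean (carrier S1)"

text \<open>The ring of Laurent polynomials in \<open>u\<close>; the exponent of \<open>u\<close> is the key.\<close>

type_synonym E1 = "int \<Rightarrow>\<^sub>0 z2adic"

definition E1_u :: E1
  where "E1_u = Poly_Mapping.single 1 1"

definition E1_const :: "z2adic \<Rightarrow> E1"
  where "E1_const a = Poly_Mapping.single 0 a"

text \<open>The part of degree \<open>t\<close>, where \<open>u\<close> has degree \<open>-2\<close>.\<close>

definition E1_degree_part :: "int \<Rightarrow> E1 set"
  where "E1_degree_part t = {f. \<forall>k\<in>Poly_Mapping.keys f. - 2 * k = t}"

text \<open>Its topology is that of coefficientwise convergence. The multiplication and the unit are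
  those of the whole ring and play no role in a module.\<close>

definition E1_part :: "int \<Rightarrow> (z2adic, E1) top_module" where
  "E1_part t =
     \<lparr>carrier = E1_degree_part t, monoid.mult = (*), one = 1, ring.zero = 0, add = (+),
      smult = (\<lambda>a f. E1_const a * f),
      mod_top = pullback_topology (E1_degree_part t) Poly_Mapping.lookup
        (product_topology (\<lambda>_. euclidean) UNIV)\<rparr>"

definition E1_act :: "z2adic \<Rightarrow> E1 \<Rightarrow> E1" where
  "E1_act g f =
     (\<Sum>k\<in>Poly_Mapping.keys f.
        Poly_Mapping.single k ((g [^]\<^bsub>S1\<^esub> k) * Poly_Mapping.lookup f k))"

text \<open>\<open>E1_act g\<close> is the graded algebra automorphism with \<open>u \<mapsto> g u\<close>.\<close>

lemma lookup_E1_act: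
  "Poly_Mapping.lookup (E1_act g f) k = (g [^]\<^bsub>S1\<^esub> k) * Poly_Mapping.lookup f k"
  by (cases "k \<in> Poly_Mapping.keys f")
    (auto simp: E1_act_def lookup_sum lookup_single when_def sum.delta in_keys_iff)

lemma group_S1: "group S1"
proof -
  have "monoid Z2"
    using ring_from_type_algebra[where 'a = z2adic] by (simp add: ring.is_monoid)
  then show ?thesis
    unfolding S1_def by (rule monoid.units_group)
qed

lemma mult_S1: "monoid.mult S1 = (*)" and one_S1: "\<one>\<^bsub>S1\<^esub> = 1"
  by (auto simp: S1_def units_of_def ring_of_type_algebra_def)

lemma E1_act_single: "E1_act g (Poly_Mapping.single k a) = Poly_Mapping.single k ((g [^]\<^bsub>S1\<^esub> k) * a)"
  by (rule poly_mapping_eqI) (auto simp: lookup_E1_act lookup_single when_def)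

lemma E1_act_u: "g \<in> carrier S1 \<Longrightarrow> E1_act g E1_u = E1_const g * E1_u"
  using group.int_pow_1[OF group_S1]
  by (simp add: E1_u_def E1_const_def E1_act_single mult_single)

lemma E1_act_const: "E1_act g (E1_const a) = E1_const a"
  by (simp add: E1_const_def E1_act_single one_S1)

lemma E1_act_add: "E1_act g (f + h) = E1_act g f + E1_act g h"
  by (rule poly_mapping_eqI) (simp add: lookup_E1_act lookup_add algebra_simps)

lemma E1_act_sum: "E1_act g (sum F A) = (\<Sum>x\<in>A. E1_act g (F x))"
  by (rule poly_mapping_eqI) (simp add: lookup_E1_act lookup_sum sum_distrib_left)

lemma E1_eq_sum: "f = (\<Sum>k\<in>Poly_Mapping.keys f. Poly_Mapping.single k (Poly_Mapping.lookup f k))"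
  for f :: E1
  by (rule poly_mapping_eqI)
    (auto simp: lookup_sum lookup_single when_def sum.delta in_keys_iff)

lemma E1_act_mult:
  assumes "g \<in> carrier S1"
  shows "E1_act g (f * h) = E1_act g f * E1_act g h"
proof -
  have pow: "g [^]\<^bsub>S1\<^esub> (k + l) = (g [^]\<^bsub>S1\<^esub> k) * (g [^]\<^bsub>S1\<^esub> l)" for k l :: int
    using group.int_pow_mult[OF group_S1 assms] by (simp add: mult_S1)
  have single: "E1_act g (Poly_Mapping.single k a * Poly_Mapping.single l b) =
      E1_act g (Poly_Mapping.single k a) * E1_act g (Poly_Mapping.single l b)" for k l a b
    by (simp add: E1_act_single mult_single pow mult_ac)
  let ?m = "\<lambda>f k. Poly_Mapping.single k (Poly_Mapping.lookup f k) :: E1"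
  have "E1_act g (sum (?m f) A * sum (?m h) B) =
      E1_act g (sum (?m f) A) * E1_act g (sum (?m h) B)" for A B
    by (simp add: sum_product E1_act_sum single)
  from this[of "Poly_Mapping.keys f" "Poly_Mapping.keys h"] show ?thesis
    by (simp only: E1_eq_sum[symmetric])
qed

lemma E1_act_degree: "f \<in> E1_degree_part t \<Longrightarrow> E1_act g f \<in> E1_degree_part t"
  by (auto simp: E1_degree_part_def in_keys_iff lookup_E1_act)

lemma E1_act_one: "E1_act \<one>\<^bsub>S1\<^esub> f = f"
  using group.int_pow_one[OF group_S1]
  by (intro poly_mapping_eqI) (simp add: lookup_E1_act one_S1)

lemma E1_act_act:
  assumes "g \<in> carrier S1" "h \<in> carrier S1"
  shows "E1_act (g \<otimes>\<^bsub>S1\<^esub> h) f = E1_act g (E1_act h f)"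
proof (rule poly_mapping_eqI)
  fix k :: int
  have "comm_group S1"
    by (rule group.group_comm_groupI[OF group_S1]) (simp add: mult_S1 mult.commute)
  then have "(g \<otimes>\<^bsub>S1\<^esub> h) [^]\<^bsub>S1\<^esub> k = (g [^]\<^bsub>S1\<^esub> k) * (h [^]\<^bsub>S1\<^esub> k)"
    using comm_group.int_pow_distrib[OF _ assms] group_S1
    by (simp add: mult_S1)
  then show "Poly_Mapping.lookup (E1_act (g \<otimes>\<^bsub>S1\<^esub> h) f) k =
      Poly_Mapping.lookup (E1_act g (E1_act h f)) k"
    by (simp add: lookup_E1_act mult.assoc)
qed

end

theory Submission
  imports Defs "HOL-Number_Theory.Cong"
begin

text \<open>The group \<open>S1\<close> of 2-adic units is topologically generated by \<open>-1\<close>, of order 2, and by 5, which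
  generates a copy of the 2-adic integers. Over its completed group algebra the trivial module is
  therefore resolved by the total complex of the 2-periodic resolution for the class \<open>\<sigma>\<close> of \<open>-1\<close> and of
  the Koszul complex of \<open>\<gamma> - 1\<close>, where \<open>\<gamma>\<close> is the class of 5. Three facts give its exactness: the elements
  annihilated by \<open>\<sigma> \<minusplus> 1\<close> are the multiples of \<open>\<sigma> \<plusminus> 1\<close>, \<open>\<gamma> - 1\<close> is not a zero divisor, and the
  augmentation ideal is generated by \<open>\<sigma> - 1\<close> and \<open>\<gamma> - 1\<close>. Linear equations over the algebra are solved at
  each finite level, and then by compactness. On the part of degree \<open>t = -2k\<close> a group element \<open>g\<close> acts as
  \<open>g\<^sup>k\<close>, so the cohomology is that of a complex of free 2-adic modules of rank at most two with the
  scalars \<open>(-1)\<^sup>k \<plusminus> 1\<close> and \<open>5\<^sup>k - 1\<close>, and the latter has valuation \<open>\<nu>(k) + 2\<close> for \<open>k \<noteq> 0\<close>. As the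
  resolution in the definition of \<open>Ext\<close> is an arbitrary one, it is compared with this one, transported
  into the universe.\<close>

section \<open>Profinite spaces\<close>

text \<open>At a finite level the group is finite, so the class of 5 has finite order there and
  \<open>\<gamma> - 1\<close> is a zero divisor: its injectivity exists only in the limit and is a
  divisibility argument across levels. The other two facts hold level by level. Negation permutes
  the cosets of \<open>1 + 2 ^ n Z2\<close> without fixed points once \<open>n \<ge> 2\<close>, with
  the units that are 1 modulo 4 as a fundamental domain, and 5 generates that domain topologically.
  Two features of \<open>Ext\<close> shape the rest. Its category consists of modules over one type,
  so projectivity says nothing directly about maps into modules of other types; and the resolution
  must fit into that type. It fits because an element of the algebra is a measure known from
  countably many residues, hence from a sequence of bits, hence from one 2-adic integer. In the
  answer, \<open>t = 4 t'\<close> means \<open>k = -2 t'\<close>, of valuation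
  \<open>\<nu>(t') + 1\<close>, and the 2 in \<open>\<nu>(k) + 2\<close> comes from
  \<open>5 = 1 + 4\<close>. No extension problem occurs: in each degree a class is read off from one
  of the two coordinates of a cocycle.\<close>

lemma profinite_space_injective:
  assumes "compact_space T" "continuous_map T T' f" "inj_on f (topspace T)" "profinite_space T'"
  shows "profinite_space T"
proof -
  have "\<exists>a. S \<subseteq> {a}" if "connectedin T S" for S
  proof -
    have "connectedin T' (f ` S)"
      using assms(2) that by (rule connectedin_continuous_map_image)
    then obtain a where "f ` S \<subseteq> {a}"
      using assms(4) unfolding profinite_space_def by blast
    moreover have "inj_on f S"
      using assms(3) connectedin_subset_topspace[OF that] by (rule inj_on_subset)
    ultimately have "x = y" if "x \<in> S" "y \<in> S" for x y
      using that by (auto simp: inj_on_def)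
    then show ?thesis by blast
  qed
  moreover have "Hausdorff_space T"
    using assms Hausdorff_space_injective_preimage unfolding profinite_space_def by blast
  ultimately show ?thesis
    using assms(1) by (simp add: profinite_space_def)
qed

text \<open>The preimages of one value of \<open>f\<close> and of its complement are disjoint open
  sets that separate two points, and on a connected set every such \<open>f\<close> is constant. So
  locally constant functions give both separation properties at once.\<close>

lemma profinite_spaceI:
  assumes "compact_space T"
    and "\<And>x y. x \<in> topspace T \<Longrightarrow> y \<in> topspace T \<Longrightarrow> x \<noteq> y \<Longrightarrow>
           \<exists>f :: 'a \<Rightarrow> int. continuous_map T (discrete_topology UNIV) f \<and> f x \<noteq> f y"
  shows "profinite_space T"
  unfolding profinite_space_def
proof (intro conjI allI impI)
  show "Hausdorff_space T"
    unfolding Hausdorff_space_def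
  proof (intro allI impI)
    fix x y assume xy: "x \<in> topspace T \<and> y \<in> topspace T \<and> x \<noteq> y"
    then obtain f :: "'a \<Rightarrow> int" where f: "continuous_map T (discrete_topology UNIV) f" "f x \<noteq> f y"
      using assms(2) by blast
    have op: "openin T {z \<in> topspace T. f z \<in> S}" for S
      using openin_continuous_map_preimage[OF f(1)] by simp
    show "\<exists>U V. openin T U \<and> openin T V \<and> x \<in> U \<and> y \<in> V \<and> disjnt U V"
      by (insert f(2) xy, intro exI conjI, rule op[of "{f x}"], rule op[of "- {f x}"]) (auto simp: disjnt_def)
  qed
  fix S assume S: "connectedin T S"
  show "\<exists>a. S \<subseteq> {a}"
  proof (cases "S = {}")
    case False
    then obtain x where x: "x \<in> S" by blast
    have "y = x" if y: "y \<in> S" for y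
    proof (rule ccontr)
      assume "y \<noteq> x"
      then obtain f :: "'a \<Rightarrow> int" where f: "continuous_map T (discrete_topology UNIV) f" "f y \<noteq> f x"
        using assms(2)[OF subsetD[OF connectedin_subset_topspace[OF S] y]
            subsetD[OF connectedin_subset_topspace[OF S] x]] by blast
      have "connectedin (discrete_topology UNIV) (f ` S)"
        using f(1) S by (rule connectedin_continuous_map_image)
      then show False
        using f(2) x y by (auto simp: connectedin_discrete_topology)
    qed
    then show ?thesis by blast
  qed blast
qed (fact assms(1))

lemma profinite_space_subtopology:
  assumes "profinite_space T" "closedin T S"
  shows "profinite_space (subtopology T S)"
proof (rule profinite_space_injective[where T' = T and f = id])
  have "compactin T S"
    using assms closedin_compact_space by (metis profinite_space_def)
  then show "compact_space (subtopology T S)"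
    by (rule compact_space_subtopology)
  show "continuous_map (subtopology T S) T id"
    by (rule continuous_map_from_subtopology) simp
qed (simp_all add: assms(1))

lemma profinite_space_prod_topology:
  assumes "profinite_space S" "profinite_space T"
  shows "profinite_space (prod_topology S T)"
  unfolding profinite_space_def
proof (intro conjI allI impI)
  show "compact_space (prod_topology S T)" "Hausdorff_space (prod_topology S T)"
    using assms by (auto simp: profinite_space_def compact_space_prod_topology Hausdorff_space_prod_topology)
  fix C assume C: "connectedin (prod_topology S T) C"
  obtain a where "fst ` C \<subseteq> {a}"
    using connectedin_continuous_map_image[OF continuous_map_fst C] assms(1)
    unfolding profinite_space_def by blast
  moreover obtain b where "snd ` C \<subseteq> {b}"
    using connectedin_continuous_map_image[OF continuous_map_snd C] assms(2)
    unfolding profinite_space_def by blast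
  ultimately show "\<exists>a. C \<subseteq> {a}"
    by (intro exI[of _ "(a, b)"]) fastforce
qed

lemma profinite_space_product_topology:
  assumes "\<And>i. i \<in> I \<Longrightarrow> profinite_space (T i)"
  shows "profinite_space (product_topology T I)"
  unfolding profinite_space_def
proof (intro conjI allI impI)
  show "compact_space (product_topology T I)" "Hausdorff_space (product_topology T I)"
    using assms by (auto simp: profinite_space_def compact_space_product_topology Hausdorff_space_product_topology)
  fix C assume C: "connectedin (product_topology T I) C"
  have "\<exists>a. (\<lambda>x. x i) ` C \<subseteq> {a}" if "i \<in> I" for i
    using connectedin_continuous_map_image[OF continuous_map_product_projection[OF that] C] assms[OF that]
    unfolding profinite_space_def by blast
  then obtain a where a: "\<And>i. i \<in> I \<Longrightarrow> (\<lambda>x. x i) ` C \<subseteq> {a i}"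
    by metis
  have "C \<subseteq> (\<Pi>\<^sub>E i\<in>I. topspace (T i))"
    using connectedin_subset_topspace[OF C] by simp
  then have "x = restrict a I" if "x \<in> C" for x
    using a that by (intro extensionalityI[of _ I]) (auto simp: PiE_def)
  then show "\<exists>a. C \<subseteq> {a}"
    by blast
qed

text \<open>A product of two discrete spaces is discrete, so any binary operation on it is
  continuous. This is why the ring operations need no estimates once continuity is tested on
  residues.\<close>

lemma continuous_map_discrete_op:
  assumes "continuous_map W (discrete_topology UNIV) f" "continuous_map W (discrete_topology UNIV) g"
  shows "continuous_map W (discrete_topology UNIV) (\<lambda>x. op (f x) (g x))"
proof -
  have "continuous_map W (prod_topology (discrete_topology UNIV) (discrete_topology UNIV)) (\<lambda>x. (f x, g x))"
    using assms by (rule continuous_map_pairedI)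
  then have "continuous_map W (discrete_topology UNIV) (\<lambda>x. (f x, g x))"
    by (simp flip: prod_topology_discrete_topology)
  from continuous_map_compose[OF this, of "discrete_topology UNIV" "\<lambda>(x, y). op x y"]
  show ?thesis by (simp add: o_def)
qed

lemma continuous_map_discrete_op1:
  "continuous_map W (discrete_topology UNIV) f \<Longrightarrow> continuous_map W (discrete_topology UNIV) (\<lambda>x. op (f x))"
  using continuous_map_discrete_op[of W f f "\<lambda>a _. op a"] .

section \<open>The topological ring of 2-adic integers\<close>

text \<open>The residue classes form a base of the inverse limit topology, so continuity means that
  every residue varies locally constantly. Later continuity proofs about 2-adic integers pass
  through this criterion.\<close>

lemma continuous_map_z2adic_iff:
  "continuous_map W euclidean f \<longleftrightarrow> (\<forall>n. continuous_map W (discrete_topology UNIV) (\<lambda>x. residue (f x) n))"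
proof (intro iffI allI)
  fix n assume f: "continuous_map W euclidean f"
  have "openin W {x \<in> topspace W. residue (f x) n \<in> U}" for U
  proof -
    have "open {y. residue y n \<in> U}"
      unfolding open_z2adic_def by (intro ballI exI[of _ n]) simp
    then show ?thesis
      using openin_continuous_map_preimage[OF f, of "{y. residue y n \<in> U}"] by simp
  qed
  then show "continuous_map W (discrete_topology UNIV) (\<lambda>x. residue (f x) n)"
    by (auto simp: continuous_map_def)
next
  assume f: "\<forall>n. continuous_map W (discrete_topology UNIV) (\<lambda>x. residue (f x) n)"
  show "continuous_map W euclidean f"
    unfolding continuous_map_def
  proof (intro conjI allI impI)
    fix U :: "z2adic set" assume "openin euclidean U"
    then have U: "\<forall>x\<in>U. \<exists>n. \<forall>y. residue y n = residue x n \<longrightarrow> y \<in> U"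
      by (simp add: open_z2adic_def)
    show "openin W {x \<in> topspace W. f x \<in> U}"
      unfolding openin_subopen[of W "{x \<in> topspace W. f x \<in> U}"]
    proof
      fix x assume x: "x \<in> {x \<in> topspace W. f x \<in> U}"
      then obtain n where n: "\<And>y. residue y n = residue (f x) n \<Longrightarrow> y \<in> U"
        using U by blast
      have "openin W {y \<in> topspace W. residue (f y) n \<in> {residue (f x) n}}"
        using openin_continuous_map_preimage[OF f[rule_format, of n], of "{residue (f x) n}"] by simp
      then show "\<exists>T. openin W T \<and> x \<in> T \<and> T \<subseteq> {x \<in> topspace W. f x \<in> U}"
        using n x by (intro exI[of _ "{y \<in> topspace W. residue (f y) n \<in> {residue (f x) n}}"]) auto
    qed
  qed auto
qed

lemma continuous_map_z2adic_add:
  fixes f g :: "'a \<Rightarrow> z2adic"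
  assumes "continuous_map W euclidean f" "continuous_map W euclidean g"
  shows "continuous_map W euclidean (\<lambda>x. f x + g x)"
  using assms unfolding continuous_map_z2adic_iff plus_z2adic.rep_eq
  by (auto intro: continuous_map_discrete_op)

lemma continuous_map_z2adic_mult:
  fixes f g :: "'a \<Rightarrow> z2adic"
  assumes "continuous_map W euclidean f" "continuous_map W euclidean g"
  shows "continuous_map W euclidean (\<lambda>x. f x * g x)"
  using assms unfolding continuous_map_z2adic_iff times_z2adic.rep_eq
  by (auto intro: continuous_map_discrete_op)

lemma continuous_map_z2adic_minus:
  fixes f :: "'a \<Rightarrow> z2adic"
  assumes "continuous_map W euclidean f"
  shows "continuous_map W euclidean (\<lambda>x. - f x)"
  using assms unfolding continuous_map_z2adic_iff uminus_z2adic.rep_eq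
  by (auto intro: continuous_map_discrete_op1)

lemma continuous_map_z2adic_sum:
  fixes f :: "'i \<Rightarrow> 'a \<Rightarrow> z2adic"
  assumes "\<And>i. i \<in> I \<Longrightarrow> continuous_map W euclidean (f i)"
  shows "continuous_map W euclidean (\<lambda>x. \<Sum>i\<in>I. f i x)"
  using assms by (induction I rule: infinite_finite_induct) (auto intro: continuous_map_z2adic_add)

text \<open>Binary expansions: they present the 2-adic integers as an image of the Cantor space,
  whence compactness, and they later encode a countable amount of data in one 2-adic
  integer.\<close>

lift_definition of_bits :: "(nat \<Rightarrow> bool) \<Rightarrow> z2adic" is "\<lambda>b n. \<Sum>i<n. of_bool (b i) * 2 ^ i"
proof -
  fix b :: "nat \<Rightarrow> bool" and m n :: nat assume "m \<le> n"
  define s where "s n = (\<Sum>i<n. of_bool (b i) * 2 ^ i :: int)" for n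
  \<comment> \<open>A partial sum is already reduced, which is what the base case
    \<open>n = m\<close> asks for.\<close>
  have bound: "0 \<le> s n \<and> s n < 2 ^ n" for n
    by (induction n) (auto simp: s_def)
  from \<open>m \<le> n\<close> have "s n mod 2 ^ m = s m"
  proof (induction n rule: dec_induct)
    case (step n)
    then have "(2 :: int) ^ m dvd of_bool (b n) * 2 ^ n"
      by (simp add: le_imp_power_dvd)
    then obtain k where "of_bool (b n) * 2 ^ n = (2 :: int) ^ m * k" ..
    then have "s (Suc n) mod 2 ^ m = (s n + 2 ^ m * k) mod 2 ^ m"
      unfolding s_def by simp
    then show ?case
      using step.IH by simp
  qed (simp add: bound)
  then show "(\<Sum>i<n. of_bool (b i) * 2 ^ i) mod 2 ^ m = (\<Sum>i<m. of_bool (b i) * 2 ^ i :: int)"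
    by (simp add: s_def)
qed

lemma residue_nonneg: "0 \<le> residue x n" and residue_less: "residue x n < 2 ^ n"
  using residue_mod[of n n x] by (metis order_refl pos_mod_sign pos_mod_bound zero_less_numeral zero_less_power)+

lemma inj_of_bits: "inj of_bits"
proof (rule injI, rule ext)
  fix b c i assume "of_bits b = of_bits c"
  then have "residue (of_bits b) n = residue (of_bits c) n" for n
    by simp
  from this[of "Suc i"] this[of i] show "b i = c i"
    by (auto simp: of_bits.rep_eq simp del: sum_of_bool_mult_eq)
qed

lemma surj_of_bits: "surj of_bits"
proof (rule surjI)
  fix x
  \<comment> \<open>Digit \<open>i\<close> is 1 exactly when passing from modulus
    \<open>2 ^ i\<close> to \<open>2 ^ (i + 1)\<close> changes the reduced residue.\<close>
  show "of_bits (\<lambda>i. residue x (Suc i) \<noteq> residue x i) = x"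
  proof (rule z2adic_eqI)
    fix n
    show "residue (of_bits (\<lambda>i. residue x (Suc i) \<noteq> residue x i)) n = residue x n"
    proof (induction n)
      case (Suc n)
      have m: "residue x (Suc n) mod 2 ^ n = residue x n"
        by (rule residue_mod) simp
      define q where "q = residue x (Suc n) div 2 ^ n"
      have eq: "residue x (Suc n) = 2 ^ n * q + residue x n"
        using mult_div_mod_eq[of "2 ^ n" "residue x (Suc n)"] m by (simp add: q_def)
      have "0 \<le> q"
        using residue_nonneg[of x "Suc n"] by (simp add: q_def pos_imp_zdiv_nonneg_iff)
      moreover have "q < 2"
      proof -
        have "2 ^ n * q < 2 ^ n * 2"
          using eq residue_nonneg[of x n] residue_less[of x "Suc n"] unfolding power_Suc by linarith
        then show ?thesis
          by (rule mult_left_less_imp_less) simp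
      qed
      ultimately have "q = of_bool (residue x (Suc n) \<noteq> residue x n)"
        using eq by auto
      then show ?case
        using Suc eq by (simp add: of_bits.rep_eq del: sum_of_bool_mult_eq)
    qed (simp add: of_bits.rep_eq)
  qed
qed

lemma profinite_space_z2adic: "profinite_space (euclidean :: z2adic topology)"
proof (rule profinite_spaceI)
  let ?W = "product_topology (\<lambda>_ :: nat. discrete_topology (UNIV :: bool set)) UNIV"
  have "continuous_map ?W (discrete_topology UNIV) (\<lambda>b. \<Sum>i<n. of_bool (b i) * 2 ^ i :: int)" for n
  proof (induction n)
    case (Suc n)
    then show ?case
      using continuous_map_discrete_op[OF Suc continuous_map_product_projection[of n UNIV "\<lambda>_. discrete_topology UNIV"],
          of "\<lambda>x y. x + of_bool y * 2 ^ n"] by simp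
  qed simp
  then have "continuous_map ?W euclidean of_bits"
    by (simp add: continuous_map_z2adic_iff of_bits.rep_eq)
  moreover have "compactin ?W UNIV"
    using compact_space_product_topology[of "\<lambda>_ :: nat. discrete_topology (UNIV :: bool set)" UNIV]
    by (simp add: compactin_discrete_topology compact_space_def)
  ultimately have "compactin euclidean (range of_bits)"
    using image_compactin by blast
  then show "compact_space (euclidean :: z2adic topology)"
    by (simp add: surj_of_bits compact_space_def)
next
  fix x y :: z2adic assume "x \<noteq> y"
  then obtain n where "residue x n \<noteq> residue y n"
    using z2adic_eqI by blast
  moreover have "continuous_map euclidean (discrete_topology UNIV) (\<lambda>x. residue x n)"
    using continuous_map_z2adic_iff[of euclidean "\<lambda>x. x"] by simp
  ultimately show "\<exists>f :: z2adic \<Rightarrow> int. continuous_map euclidean (discrete_topology UNIV) f \<and> f x \<noteq> f y"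
    by blast
qed

lemma residue_diff: "residue (x - y) n = (residue x n - residue y n) mod 2 ^ n"
  unfolding minus_z2adic_def plus_z2adic.rep_eq uminus_z2adic.rep_eq by (simp add: mod_simps)

lemma residue_of_nat: "residue (of_nat k) n = int k mod 2 ^ n"
  by (induction k) (simp_all add: zero_z2adic.rep_eq plus_z2adic.rep_eq one_z2adic.rep_eq mod_simps)

lemma residue_of_int: "residue (of_int k) n = k mod 2 ^ n"
  by (cases k rule: int_cases2) (simp_all add: residue_of_nat uminus_z2adic.rep_eq mod_simps)

lemma residue_numeral: "residue (numeral k) n = numeral k mod 2 ^ n"
  using residue_of_int[of "numeral k" n] by simp

lemma residue_cong_mult:
  "residue a n = residue a' n \<Longrightarrow> residue b n = residue b' n \<Longrightarrow> residue (a * b) n = residue (a' * b') n"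
  by (simp add: times_z2adic.rep_eq)

lemma residue_cong_add:
  "residue a n = residue a' n \<Longrightarrow> residue b n = residue b' n \<Longrightarrow> residue (a + b) n = residue (a' + b') n"
  by (simp add: plus_z2adic.rep_eq)

lemma residue_cong_sum:
  "(\<And>i. i \<in> I \<Longrightarrow> residue (f i) n = residue (g i) n) \<Longrightarrow> residue (sum f I) n = residue (sum g I) n"
  by (induction I rule: infinite_finite_induct) (auto intro: residue_cong_add)

lemma two_power_dvd_iff: "2 ^ n dvd x \<longleftrightarrow> residue x n = 0" for x :: z2adic
proof
  assume "2 ^ n dvd x"
  then obtain y where y: "x = of_int (2 ^ n) * y"
    by (metis dvdE of_int_numeral of_int_power)
  show "residue x n = 0"
    unfolding y times_z2adic.rep_eq residue_of_int by simp
next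
  assume x: "residue x n = 0"
  have dvd: "2 ^ n dvd residue x (m + n)" for m
    using residue_mod[of n "m + n" x] x by auto
  \<comment> \<open>Dividing by \<open>2 ^ n\<close> costs \<open>n\<close> digits, so the
    \<open>m\<close>-th residue of the quotient is taken from level \<open>m + n\<close>.\<close>
  define q where "q m = residue x (m + n) div 2 ^ n" for m
  have q: "residue x (m + n) = 2 ^ n * q m" for m
    using dvd by (simp add: q_def)
  have "q m mod 2 ^ k = q k" if "k \<le> m" for k m
  proof -
    have "(2 ^ n * q m) mod 2 ^ (k + n) = 2 ^ n * q k"
      using residue_mod[of "k + n" "m + n" x] that by (simp add: q)
    then have "2 ^ n * (q m mod 2 ^ k) = 2 ^ n * q k"
      unfolding mult_mod_right power_add[symmetric] by (simp add: add.commute)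
    then show ?thesis by simp
  qed
  then have "residue (Abs_z2adic q) m = q m" for m
    by (subst Abs_z2adic_inverse) auto
  then have "residue (of_int (2 ^ n) * Abs_z2adic q) m = residue x m" for m
    using residue_mod[of m "m + n" x] unfolding times_z2adic.rep_eq residue_of_int
    by (simp add: q mod_simps)
  then have "of_int (2 ^ n) * Abs_z2adic q = x"
    by (rule z2adic_eqI)
  then have "x = 2 ^ n * Abs_z2adic q"
    by simp
  then show "2 ^ n dvd x" by simp
qed

text \<open>Multiplication by 2 shifts the levels by one: \<open>2 * x\<close> modulo
  \<open>2 ^ (n + 1)\<close> determines \<open>x\<close> modulo \<open>2 ^ n\<close>. This is
  applied to the differentials that become 2 or -2.\<close>

lemma two_times_eq_0: "2 * x = 0 \<Longrightarrow> x = 0" for x :: z2adic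
proof (rule z2adic_eqI)
  fix n assume *: "2 * x = 0"
  have "(2 * residue x (Suc n)) mod 2 ^ Suc n = 0"
    using arg_cong[OF *, of "\<lambda>y. residue y (Suc n)"] by (simp add: times_z2adic.rep_eq residue_numeral zero_z2adic.rep_eq mod_simps)
  then have "residue x (Suc n) mod 2 ^ n = 0"
    by simp
  then show "residue x n = residue 0 n"
    using residue_mod[of n "Suc n" x] by (simp add: zero_z2adic.rep_eq)
qed

lemma two_power_times_eq_0: "2 ^ n * x = 0 \<Longrightarrow> x = 0" for x :: z2adic
  by (induction n) (auto simp: mult.assoc dest: two_times_eq_0)

lemma z2adic_eq_0: "(\<And>n. 2 ^ n dvd x) \<Longrightarrow> x = 0" for x :: z2adic
  by (rule z2adic_eqI) (simp add: two_power_dvd_iff zero_z2adic.rep_eq)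

text \<open>An odd residue is invertible modulo each \<open>2 ^ n\<close>. Inverses modulo
  \<open>2 ^ m\<close> are unique, so reduced inverses chosen separately at all levels form a
  compatible family.\<close>

lemma z2adic_unit_iff: "x dvd 1 \<longleftrightarrow> residue x 1 = 1" for x :: z2adic
proof
  assume "x dvd 1"
  then obtain y where y: "x * y = 1" by (metis dvdE)
  have "residue x 1 * residue y 1 mod 2 = 1"
    using arg_cong[OF y, of "\<lambda>z. residue z 1"] by (simp add: times_z2adic.rep_eq one_z2adic.rep_eq)
  then show "residue x 1 = 1"
    using residue_mod[of 1 1 x] residue_nonneg[of x 1] residue_less[of x 1] by (cases "residue x 1 = 0") auto
next
  assume x: "residue x 1 = 1"
  have cop: "coprime (residue x n) (2 ^ n)" for n
  proof (cases n)
    case (Suc m)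
    then have "odd (residue x n)"
      using residue_mod[of 1 n x] x by (simp add: odd_iff_mod_2_eq_one)
    then show ?thesis by simp
  qed simp
  have "\<exists>y. y mod 2 ^ n = y \<and> residue x n * y mod 2 ^ n = 1 mod 2 ^ n" for n
  proof -
    obtain y where "[residue x n * y = 1] (mod 2 ^ n)"
      using cong_solve_coprime_int[OF cop] by blast
    then show ?thesis
      by (intro exI[of _ "y mod 2 ^ n"]) (simp add: cong_def mod_simps)
  qed
  then obtain y where y: "\<And>n. y n mod 2 ^ n = y n" "\<And>n. residue x n * y n mod 2 ^ n = 1 mod 2 ^ n"
    by metis
  have "y n mod 2 ^ m = y m" if "m \<le> n" for m n
  proof -
    have "[residue x m * y n = residue x n * y n] (mod 2 ^ m)"
      unfolding residue_mod[OF that, of x, symmetric] by (simp add: cong_def mod_simps)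
    moreover have "[residue x n * y n = 1] (mod 2 ^ m)"
      using arg_cong[OF y(2)[of n], of "\<lambda>z. z mod 2 ^ m"] that by (simp add: cong_def mod_2_power_cancel)
    moreover have "[residue x m * y m = 1] (mod 2 ^ m)"
      using y(2)[of m] by (simp add: cong_def)
    ultimately have "[residue x m * y n = residue x m * y m] (mod 2 ^ m)"
      by (simp add: cong_def)
    then have "[y n = y m] (mod 2 ^ m)"
      using cong_mult_lcancel[OF cop] by blast
    then show ?thesis
      using y(1)[of m] by (simp add: cong_def)
  qed
  then have "residue (Abs_z2adic y) n = y n" for n
    by (subst Abs_z2adic_inverse) auto
  then have "x * Abs_z2adic y = 1"
    by (intro z2adic_eqI) (simp add: times_z2adic.rep_eq one_z2adic.rep_eq y)
  then show "x dvd 1"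
    by (metis dvd_triv_left)
qed

section \<open>Profinite modules\<close>

lemma profinite_module_module: "profinite_module R M \<Longrightarrow> module R M"
  and profinite_module_topspace: "profinite_module R M \<Longrightarrow> topspace (mod_top M) = carrier M"
  and profinite_module_space: "profinite_module R M \<Longrightarrow> profinite_space (mod_top M)"
  by (auto simp: profinite_module_def)

lemma profinite_module_abelian_group: "profinite_module R M \<Longrightarrow> abelian_group M"
  using profinite_module_module module.axioms(2) by blast

lemma profinite_module_continuous_add:
  assumes "profinite_module R M" "continuous_map W (mod_top M) f" "continuous_map W (mod_top M) g"
  shows "continuous_map W (mod_top M) (\<lambda>x. f x \<oplus>\<^bsub>M\<^esub> g x)"
proof -
  have "continuous_map W (prod_topology (mod_top M) (mod_top M)) (\<lambda>x. (f x, g x))"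
    using assms(2,3) by (rule continuous_map_pairedI)
  from continuous_map_compose[OF this] assms(1) show ?thesis
    by (fastforce simp: profinite_module_def o_def)
qed

lemma profinite_module_continuous_minus:
  assumes "profinite_module R M" "continuous_map W (mod_top M) f"
  shows "continuous_map W (mod_top M) (\<lambda>x. \<ominus>\<^bsub>M\<^esub> f x)"
  using continuous_map_compose[OF assms(2), of "mod_top M" "\<lambda>x. \<ominus>\<^bsub>M\<^esub> x"] assms(1)
  by (simp add: profinite_module_def o_def)

lemma profinite_module_continuous_smult:
  assumes "profinite_module R M" "continuous_map W (ring_top R) f" "continuous_map W (mod_top M) g"
  shows "continuous_map W (mod_top M) (\<lambda>x. f x \<odot>\<^bsub>M\<^esub> g x)"
proof -
  have "continuous_map W (prod_topology (ring_top R) (mod_top M)) (\<lambda>x. (f x, g x))"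
    using assms(2,3) by (rule continuous_map_pairedI)
  from continuous_map_compose[OF this] assms(1) show ?thesis
    by (fastforce simp: profinite_module_def o_def)
qed

lemma continuous_homI:
  assumes "topspace (mod_top M) = carrier M"
    and "\<And>x. x \<in> carrier M \<Longrightarrow> f x \<in> carrier N"
    and "\<And>x y. x \<in> carrier M \<Longrightarrow> y \<in> carrier M \<Longrightarrow> f (x \<oplus>\<^bsub>M\<^esub> y) = f x \<oplus>\<^bsub>N\<^esub> f y"
    and "\<And>r x. r \<in> carrier R \<Longrightarrow> x \<in> carrier M \<Longrightarrow> f (r \<odot>\<^bsub>M\<^esub> x) = r \<odot>\<^bsub>N\<^esub> f x"
    and "continuous_map (mod_top M) (mod_top N) f" and "module R M"
  shows "restrict f (carrier M) \<in> continuous_hom R M N"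
proof -
  interpret module R M by fact
  have "continuous_map (mod_top M) (mod_top N) (restrict f (carrier M))"
    using assms(5) by (rule continuous_map_eq) (simp add: assms(1))
  then show ?thesis
    using assms(2-4) by (auto simp: continuous_hom_def)
qed

lemma continuous_homD:
  assumes "f \<in> continuous_hom R M N"
  shows "f \<in> extensional (carrier M)"
    and "x \<in> carrier M \<Longrightarrow> f x \<in> carrier N"
    and "x \<in> carrier M \<Longrightarrow> y \<in> carrier M \<Longrightarrow> f (x \<oplus>\<^bsub>M\<^esub> y) = f x \<oplus>\<^bsub>N\<^esub> f y"
    and "r \<in> carrier R \<Longrightarrow> x \<in> carrier M \<Longrightarrow> f (r \<odot>\<^bsub>M\<^esub> x) = r \<odot>\<^bsub>N\<^esub> f x"
    and "continuous_map (mod_top M) (mod_top N) f"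
  using assms by (auto simp: continuous_hom_def PiE_def)

lemma continuous_hom_zero:
  assumes "f \<in> continuous_hom R M N" "abelian_group M" "abelian_group N"
  shows "f \<zero>\<^bsub>M\<^esub> = \<zero>\<^bsub>N\<^esub>"
proof -
  interpret M: abelian_group M by fact
  interpret N: abelian_group N by fact
  have "f \<zero>\<^bsub>M\<^esub> \<oplus>\<^bsub>N\<^esub> f \<zero>\<^bsub>M\<^esub> = f \<zero>\<^bsub>M\<^esub> \<oplus>\<^bsub>N\<^esub> \<zero>\<^bsub>N\<^esub>"
    using continuous_homD[OF assms(1)] by (metis M.zero_closed M.r_zero N.r_zero)
  then show ?thesis
    using continuous_homD(2)[OF assms(1)] by simp
qed

lemma continuous_hom_minus:
  assumes "f \<in> continuous_hom R M N" "abelian_group M" "abelian_group N" "x \<in> carrier M"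
  shows "f (\<ominus>\<^bsub>M\<^esub> x) = \<ominus>\<^bsub>N\<^esub> f x"
proof -
  interpret M: abelian_group M by fact
  interpret N: abelian_group N by fact
  have "f (\<ominus>\<^bsub>M\<^esub> x) \<oplus>\<^bsub>N\<^esub> f x = \<zero>\<^bsub>N\<^esub>"
    using continuous_homD(3)[OF assms(1), of "\<ominus>\<^bsub>M\<^esub> x" x] assms(4) continuous_hom_zero[OF assms(1-3)]
    by (simp add: M.l_neg)
  then show ?thesis
    using continuous_homD(2)[OF assms(1)] assms(4) by (simp add: N.minus_equality)
qed

lemma continuous_hom_compose:
  assumes "f \<in> continuous_hom R M N" "g \<in> continuous_hom R N K"
    and "profinite_module R M"
  shows "compose (carrier M) g f \<in> continuous_hom R M K"
proof -
  interpret M: module R M using assms(3) by (rule profinite_module_module)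
  show ?thesis
    unfolding compose_def
    using continuous_homD[OF assms(1)] continuous_homD[OF assms(2)]
      continuous_map_compose[of "mod_top M" "mod_top N" f "mod_top K" g]
    by (intro continuous_homI profinite_module_topspace[OF assms(3)]) (auto simp: o_def M.module_axioms)
qed

lemma continuous_hom_add:
  assumes "f \<in> continuous_hom R M N" "g \<in> continuous_hom R M N"
    and "profinite_module R M" "profinite_module R N"
  shows "(\<lambda>x\<in>carrier M. f x \<oplus>\<^bsub>N\<^esub> g x) \<in> continuous_hom R M N"
proof -
  interpret M: module R M using assms(3) by (rule profinite_module_module)
  interpret N: module R N using assms(4) by (rule profinite_module_module)
  note f = continuous_homD[OF assms(1)] and g = continuous_homD[OF assms(2)]
  show ?thesis
    using f(2-4) g(2-4) profinite_module_continuous_add[OF assms(4) f(5) g(5)]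
    by (intro continuous_homI profinite_module_topspace[OF assms(3)])
      (auto simp: M.module_axioms N.a_ac N.smult_r_distr)
qed

lemma continuous_hom_uminus:
  assumes "f \<in> continuous_hom R M N" "profinite_module R M" "profinite_module R N"
  shows "(\<lambda>x\<in>carrier M. \<ominus>\<^bsub>N\<^esub> f x) \<in> continuous_hom R M N"
proof -
  interpret M: module R M using assms(2) by (rule profinite_module_module)
  interpret N: module R N using assms(3) by (rule profinite_module_module)
  note f = continuous_homD[OF assms(1)]
  show ?thesis
    using f(2-4) profinite_module_continuous_minus[OF assms(3) f(5)]
    by (intro continuous_homI profinite_module_topspace[OF assms(2)])
      (auto simp: M.module_axioms N.minus_add N.smult_r_minus)
qed

lemma continuous_hom_const_zero:
  assumes "profinite_module R M" "profinite_module R N"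
  shows "(\<lambda>x\<in>carrier M. \<zero>\<^bsub>N\<^esub>) \<in> continuous_hom R M N"
proof -
  interpret M: module R M using assms(1) by (rule profinite_module_module)
  interpret N: module R N using assms(2) by (rule profinite_module_module)
  show ?thesis
    by (intro continuous_homI profinite_module_topspace[OF assms(1)])
      (auto simp: M.module_axioms profinite_module_topspace[OF assms(2)])
qed

lemma comm_group_hom_group:
  assumes "profinite_module R M" "profinite_module R N"
  shows "comm_group (hom_group R M N)"
proof -
  interpret N: module R N using assms(2) by (rule profinite_module_module)
  show ?thesis
  proof (rule comm_groupI)
    fix f assume f: "f \<in> carrier (hom_group R M N)"
    show "\<exists>g\<in>carrier (hom_group R M N). g \<otimes>\<^bsub>hom_group R M N\<^esub> f = \<one>\<^bsub>hom_group R M N\<^esub>"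
      using f continuous_hom_uminus[OF _ assms, of f] continuous_homD(2)[of f R M N]
      by (intro bexI[of _ "\<lambda>x\<in>carrier M. \<ominus>\<^bsub>N\<^esub> f x"]) (auto simp: hom_group_def fun_eq_iff N.l_neg)
  next
    fix f assume f: "f \<in> carrier (hom_group R M N)"
    then have "f \<in> continuous_hom R M N"
      by (simp add: hom_group_def)
    from continuous_homD(1)[OF this] continuous_homD(2)[OF this]
    show "\<one>\<^bsub>hom_group R M N\<^esub> \<otimes>\<^bsub>hom_group R M N\<^esub> f = f"
      by (auto simp: hom_group_def fun_eq_iff extensional_def)
  qed (auto simp: hom_group_def fun_eq_iff continuous_hom_add[OF _ _ assms] continuous_hom_const_zero[OF assms]
      N.a_ac continuous_homD(2))
qed

section \<open>Transport of structure and images of profinite modules\<close>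

definition transport_module :: "('b \<Rightarrow> 'c) \<Rightarrow> ('r, 'b) top_module \<Rightarrow> ('r, 'c) top_module" where
  "transport_module j M =
     (let i = inv_into (carrier M) j in
      \<lparr>carrier = j ` carrier M, monoid.mult = (\<lambda>x y. j (i x \<otimes>\<^bsub>M\<^esub> i y)), one = j \<one>\<^bsub>M\<^esub>, ring.zero = j \<zero>\<^bsub>M\<^esub>,
       add = (\<lambda>x y. j (i x \<oplus>\<^bsub>M\<^esub> i y)), smult = (\<lambda>r x. j (r \<odot>\<^bsub>M\<^esub> i x)),
       mod_top = pullback_topology (j ` carrier M) i (mod_top M)\<rparr>)"

text \<open>The structure on the image is the one that makes \<open>j\<close> an isomorphism of
  profinite modules. As \<open>j\<close> can be any injection of sets, this moves a module from one
  type of elements to another.\<close>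

lemma transport_module:
  fixes M :: "('r, 'b) top_module" and j :: "'b \<Rightarrow> 'c"
  assumes M: "profinite_module R M" and j: "inj_on j (carrier M)"
  shows profinite_transport_module: "profinite_module R (transport_module j M)"
    and transport_module_hom: "restrict j (carrier M) \<in> continuous_hom R M (transport_module j M)"
    and transport_module_hom_inv:
      "restrict (inv_into (carrier M) j) (j ` carrier M) \<in> continuous_hom R (transport_module j M) M"
proof -
  define i where "i = inv_into (carrier M) j"
  define N where "N = transport_module j M"
  interpret M: module R M using M by (rule profinite_module_module)
  have ij: "i (j x) = x" if "x \<in> carrier M" for x
    using that j by (simp add: i_def)
  note top = profinite_module_topspace[OF M]
  have N: "carrier N = j ` carrier M" "\<zero>\<^bsub>N\<^esub> = j \<zero>\<^bsub>M\<^esub>" "x \<oplus>\<^bsub>N\<^esub> y = j (i x \<oplus>\<^bsub>M\<^esub> i y)" "r \<odot>\<^bsub>N\<^esub> x = j (r \<odot>\<^bsub>M\<^esub> i x)"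
    "mod_top N = pullback_topology (j ` carrier M) i (mod_top M)" for x y r
    by (simp_all add: N_def transport_module_def i_def Let_def)
  have group: "abelian_group N"
  proof (rule abelian_groupI)
    fix x assume "x \<in> carrier N"
    then show "\<exists>y\<in>carrier N. y \<oplus>\<^bsub>N\<^esub> x = \<zero>\<^bsub>N\<^esub>"
      by (auto simp: N ij M.l_neg intro!: bexI[of _ "\<ominus>\<^bsub>M\<^esub> i x"])
  qed (auto simp: N ij M.a_ac)
  have mod: "module R N"
    by (rule moduleI[OF M.is_cring group])
      (auto simp: N ij M.smult_l_distr M.smult_r_distr M.smult_assoc1)
  interpret N: abelian_group N by fact
  have minus: "\<ominus>\<^bsub>N\<^esub> x = j (\<ominus>\<^bsub>M\<^esub> i x)" if "x \<in> carrier N" for x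
    using that by (intro N.minus_equality) (auto simp: N ij M.l_neg)
  have topN: "topspace (mod_top N) = carrier N"
    by (auto simp: N topspace_pullback_topology top ij)
  have i: "continuous_map (mod_top N) (mod_top M) i"
    using continuous_map_pullback[of "mod_top M" "mod_top M" id "j ` carrier M" i] by (simp add: N)
  have jc: "continuous_map (mod_top M) (mod_top N) j"
    unfolding N
  proof (rule continuous_map_pullback')
    show "continuous_map (mod_top M) (mod_top M) (i \<circ> j)"
      by (rule continuous_map_eq[where f = id]) (auto simp: top ij)
  qed (auto simp: top)
  have "compact_space (mod_top N)"
  proof -
    have "compactin (mod_top M) (carrier M)"
      using profinite_module_space[OF M] by (simp add: profinite_space_def compact_space_def top)
    then have "compactin (mod_top N) (carrier N)"
      unfolding N(1) using jc by (rule image_compactin)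
    then show ?thesis
      by (simp add: compact_space_def topN)
  qed
  moreover have "inj_on i (topspace (mod_top N))"
    unfolding topN by (auto simp: N ij inj_on_def)
  ultimately have space: "profinite_space (mod_top N)"
    by (rule profinite_space_injective[OF _ i _ profinite_module_space[OF M]])
  have "continuous_map (prod_topology (mod_top N) (mod_top N)) (mod_top N) (\<lambda>(x, y). x \<oplus>\<^bsub>N\<^esub> y)"
    using continuous_map_compose[OF profinite_module_continuous_add[OF M
          continuous_map_compose[OF continuous_map_fst i] continuous_map_compose[OF continuous_map_snd i]] jc]
    by (simp add: o_def N case_prod_unfold)
  moreover have "continuous_map (prod_topology (ring_top R) (mod_top N)) (mod_top N) (\<lambda>(r, x). r \<odot>\<^bsub>N\<^esub> x)"
    using continuous_map_compose[OF profinite_module_continuous_smult[OF M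
          continuous_map_fst continuous_map_compose[OF continuous_map_snd i]] jc]
    by (simp add: o_def N case_prod_unfold)
  moreover have "continuous_map (mod_top N) (mod_top N) (\<lambda>x. \<ominus>\<^bsub>N\<^esub> x)"
    using continuous_map_compose[OF profinite_module_continuous_minus[OF M i] jc]
    by (rule continuous_map_eq) (simp add: topN minus o_def)
  ultimately show PN: "profinite_module R (transport_module j M)"
    using mod topN space by (simp add: profinite_module_def flip: N_def)
  show "restrict j (carrier M) \<in> continuous_hom R M (transport_module j M)"
    unfolding N_def[symmetric] using jc by (intro continuous_homI) (auto simp: top N ij M.module_axioms)
  have "restrict i (carrier N) \<in> continuous_hom R N M"
    using i by (intro continuous_homI topN mod) (auto simp: N ij)
  then show "restrict (inv_into (carrier M) j) (j ` carrier M) \<in> continuous_hom R (transport_module j M) M"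
    unfolding N(1) unfolding i_def N_def .
qed

text \<open>The image of a compact module in a Hausdorff one is compact, hence closed, and a closed
  submodule is profinite. It replaces the target of a map by a module onto which the map is
  surjective, as the definition of projectivity demands.\<close>

lemma profinite_image_module:
  fixes M :: "('r, 'm) top_module" and N :: "('r, 'n) top_module"
  assumes M: "profinite_module R M" and N: "profinite_module R N" and f: "f \<in> continuous_hom R M N"
    and R: "topspace (ring_top R) \<subseteq> carrier R"
  shows "profinite_module R (N\<lparr>carrier := f ` carrier M, mod_top := subtopology (mod_top N) (f ` carrier M)\<rparr>)"
    (is "profinite_module R ?K")
proof -
  interpret M: module R M using M by (rule profinite_module_module)
  interpret N: module R N using N by (rule profinite_module_module)
  note fD = continuous_homD[OF f]
  note f0 = continuous_hom_zero[OF f M.abelian_group_axioms N.abelian_group_axioms]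
  note fm = continuous_hom_minus[OF f M.abelian_group_axioms N.abelian_group_axioms]
  have sub: "f ` carrier M \<subseteq> carrier N"
    using fD(2) by blast
  have group: "abelian_group ?K"
  proof (rule abelian_groupI)
    fix x assume "x \<in> carrier ?K"
    then obtain y where "y \<in> carrier M" "x = f y" by auto
    then show "\<exists>y\<in>carrier ?K. y \<oplus>\<^bsub>?K\<^esub> x = \<zero>\<^bsub>?K\<^esub>"
      using imageI[OF M.a_inv_closed, of y f] by (intro bexI[of _ "f (\<ominus>\<^bsub>M\<^esub> y)"]) (simp_all add: fD fm N.l_neg)
  next
    show "\<zero>\<^bsub>?K\<^esub> \<in> carrier ?K"
      using imageI[OF M.zero_closed, of f] f0 by simp
  qed (auto simp: fD N.a_ac M.a_ac simp flip: fD(3))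
  have mod: "module R ?K"
  proof (rule moduleI[OF M.is_cring group])
    fix a x assume "a \<in> carrier R" "x \<in> carrier ?K"
    then show "a \<odot>\<^bsub>?K\<^esub> x \<in> carrier ?K"
      by (auto simp flip: fD(4))
  qed (use sub in \<open>auto simp: N.smult_l_distr N.smult_r_distr N.smult_assoc1 subset_iff\<close>)
  interpret K: abelian_group ?K by fact
  \<comment> \<open>\<open>a_inv\<close> is a description relative to the carrier, so negatives in
    the smaller carrier must be identified with those of \<open>N\<close>.\<close>
  have minus: "\<ominus>\<^bsub>?K\<^esub> x = \<ominus>\<^bsub>N\<^esub> x" if x: "x \<in> carrier ?K" for x
  proof (rule K.minus_equality)
    obtain y where y: "y \<in> carrier M" "x = f y" using x by auto
    then show "\<ominus>\<^bsub>N\<^esub> x \<in> carrier ?K"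
      using imageI[OF M.a_inv_closed, of y f] by (simp add: fm)
    show "\<ominus>\<^bsub>N\<^esub> x \<oplus>\<^bsub>?K\<^esub> x = \<zero>\<^bsub>?K\<^esub>"
      using y by (simp add: fD N.l_neg)
  qed (fact x)
  have "compactin (mod_top M) (carrier M)"
    using profinite_module_space[OF M] profinite_module_topspace[OF M]
    by (simp add: profinite_space_def compact_space_def)
  then have "compactin (mod_top N) (f ` carrier M)"
    using image_compactin fD(5) by blast
  then have "closedin (mod_top N) (f ` carrier M)"
    using profinite_module_space[OF N] compactin_imp_closedin unfolding profinite_space_def by blast
  then have space: "profinite_space (mod_top ?K)"
    using profinite_space_subtopology[OF profinite_module_space[OF N]] by simp
  have top: "topspace (mod_top ?K) = carrier ?K"
    using sub by (auto simp: profinite_module_topspace[OF N])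
  then have top': "topspace (subtopology (mod_top N) (f ` carrier M)) = f ` carrier M"
    by simp
  have c: "continuous_map (mod_top ?K) (mod_top N) (\<lambda>x. x)"
    by (simp add: continuous_map_from_subtopology)
  have into: "continuous_map T (mod_top ?K) g"
    if "continuous_map T (mod_top N) g" "\<And>x. x \<in> topspace T \<Longrightarrow> g x \<in> carrier ?K" for T :: "'d topology" and g
    using that by (auto simp: continuous_map_in_subtopology)
  have into2: "continuous_map T (mod_top ?K) g"
    if "continuous_map T (mod_top N) g" "\<And>x. x \<in> topspace T \<Longrightarrow> g x \<in> carrier ?K"
    for T :: "('e \<times> 'n) topology" and g
    using that by (auto simp: continuous_map_in_subtopology)
  let ?T = "prod_topology (mod_top ?K) (mod_top ?K)" and ?R = "prod_topology (ring_top R) (mod_top ?K)"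
  have "continuous_map ?T (mod_top N) (\<lambda>z. fst z \<oplus>\<^bsub>N\<^esub> snd z)"
    using profinite_module_continuous_add[OF N continuous_map_compose[OF continuous_map_fst c]
        continuous_map_compose[OF continuous_map_snd c]] by (simp add: o_def)
  then have "continuous_map ?T (mod_top ?K) (\<lambda>z. fst z \<oplus>\<^bsub>N\<^esub> snd z)"
    by (rule into2) (use K.a_closed in \<open>auto simp: top' simp del: topspace_subtopology\<close>)
  then have "continuous_map ?T (mod_top ?K) (\<lambda>(x, y). x \<oplus>\<^bsub>?K\<^esub> y)"
    by (simp add: case_prod_unfold)
  moreover have "continuous_map ?R (mod_top N) (\<lambda>z. fst z \<odot>\<^bsub>N\<^esub> snd z)"
    using profinite_module_continuous_smult[OF N continuous_map_fst
        continuous_map_compose[OF continuous_map_snd c]] by (simp add: o_def)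
  then have "continuous_map ?R (mod_top ?K) (\<lambda>z. fst z \<odot>\<^bsub>N\<^esub> snd z)"
    by (rule into2) (use R module.smult_closed[OF mod] in \<open>auto simp: top' simp del: topspace_subtopology\<close>)
  then have "continuous_map ?R (mod_top ?K) (\<lambda>(r, x). r \<odot>\<^bsub>?K\<^esub> x)"
    by (simp add: case_prod_unfold)
  moreover have "continuous_map (mod_top ?K) (mod_top N) (\<lambda>x. \<ominus>\<^bsub>N\<^esub> x)"
    using profinite_module_continuous_minus[OF N c] .
  then have "continuous_map (mod_top ?K) (mod_top ?K) (\<lambda>x. \<ominus>\<^bsub>N\<^esub> x)"
  proof (rule into)
    fix x assume "x \<in> topspace (mod_top ?K)"
    then have x: "x \<in> carrier ?K" using top by blast
    show "\<ominus>\<^bsub>N\<^esub> x \<in> carrier ?K"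
      using K.a_inv_closed[OF x] minus[OF x] by argo
  qed
  then have "continuous_map (mod_top ?K) (mod_top ?K) (\<lambda>x. \<ominus>\<^bsub>?K\<^esub> x)"
    by (rule continuous_map_eq) (simp only: top minus)
  ultimately show ?thesis
    using mod top space by (simp add: profinite_module_def)
qed

text \<open>The image of \<open>f\<close> may live outside the universe; a section of \<open>f\<close> embeds it there, as required by
  the definition of projectivity.\<close>

lemma projective_lift:
  fixes P M :: "('r, 'm) top_module" and N :: "('r, 'n) top_module"
  assumes P: "projective_module R P" and M: "profinite_module R M" and N: "profinite_module R N"
    and f: "f \<in> continuous_hom R M N" and g: "g \<in> continuous_hom R P N"
    and sub: "g ` carrier P \<subseteq> f ` carrier M" and R: "topspace (ring_top R) \<subseteq> carrier R"
  obtains h where "h \<in> continuous_hom R P M" "\<And>x. x \<in> carrier P \<Longrightarrow> f (h x) = g x"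
proof -
  define K where "K = N\<lparr>carrier := f ` carrier M, mod_top := subtopology (mod_top N) (f ` carrier M)\<rparr>"
  define s where "s = inv_into (carrier M) f"
  have K: "profinite_module R K"
    unfolding K_def using profinite_image_module[OF M N f R] .
  have carK: "carrier K = f ` carrier M"
    by (simp add: K_def)
  have s: "inj_on s (carrier K)"
    by (simp add: carK s_def inj_on_inv_into)
  let ?N = "transport_module s K"
  have PP: "profinite_module R P"
    using P by (simp add: projective_module_def)
  have fK: "f \<in> continuous_hom R M K"
    using f by (auto simp: continuous_hom_def K_def continuous_map_in_subtopology profinite_module_topspace[OF M])
  have gK: "g \<in> continuous_hom R P K"
    using g sub by (auto simp: continuous_hom_def K_def continuous_map_in_subtopology image_subset_iff
        profinite_module_topspace[OF PP])
  let ?s = "restrict s (carrier K)"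
  note sh = transport_module_hom[OF K s]
  let ?f = "compose (carrier M) ?s f" and ?g = "compose (carrier P) ?s g"
  have "?f \<in> continuous_hom R M ?N" "?g \<in> continuous_hom R P ?N"
    using continuous_hom_compose[OF fK sh M] continuous_hom_compose[OF gK sh PP] .
  moreover have "?f ` carrier M = carrier ?N"
    by (auto simp: transport_module_def compose_def carK)
  ultimately obtain h where h: "h \<in> continuous_hom R P M" "\<forall>x\<in>carrier P. ?f (h x) = ?g x"
    using P M profinite_transport_module[OF K s] unfolding projective_module_def by blast
  have "f (h x) = g x" if "x \<in> carrier P" for x
  proof (rule inj_onD[OF s])
    show "s (f (h x)) = s (g x)" "f (h x) \<in> carrier K" "g x \<in> carrier K"
      using h that continuous_homD(2)[OF h(1) that] continuous_homD(2)[OF gK that]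
      by (auto simp: compose_def carK)
  qed
  with h(1) show thesis
    by (rule that)
qed

section \<open>Comparison of projective resolutions\<close>

locale resolution =
  fixes R :: "'r top_ring" and A :: "('r, 'a) top_module"
    and P :: "nat \<Rightarrow> ('r, 'm) top_module" and d :: "nat \<Rightarrow> 'm \<Rightarrow> 'm" and \<epsilon> :: "'m \<Rightarrow> 'a"
  assumes resolution: "projective_resolution R A P d \<epsilon>"
    and profinite_A: "profinite_module R A"
    and ring_topspace: "topspace (ring_top R) \<subseteq> carrier R"
begin

lemma proj: "projective_module R (P n)"
  and d_hom: "d n \<in> continuous_hom R (P (Suc n)) (P n)"
  and eps_hom: "\<epsilon> \<in> continuous_hom R (P 0) A"
  and eps_surj: "\<epsilon> ` carrier (P 0) = carrier A"
  and exact_0: "d 0 ` carrier (P (Suc 0)) = {x \<in> carrier (P 0). \<epsilon> x = \<zero>\<^bsub>A\<^esub>}"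
  and exact_Suc: "d (Suc n) ` carrier (P (Suc (Suc n))) = {x \<in> carrier (P (Suc n)). d n x = \<zero>\<^bsub>P n\<^esub>}"
  using resolution by (auto simp only: projective_resolution_def)

lemma profinite: "profinite_module R (P n)"
  using proj unfolding projective_module_def by blast

lemma ab: "abelian_group (P n)"
  using profinite by (rule profinite_module_abelian_group)

lemma d_closed: "x \<in> carrier (P (Suc n)) \<Longrightarrow> d n x \<in> carrier (P n)"
  by (rule continuous_homD(2)[OF d_hom])

lemma eps_d: "x \<in> carrier (P (Suc 0)) \<Longrightarrow> \<epsilon> (d 0 x) = \<zero>\<^bsub>A\<^esub>"
  using exact_0 by blast

lemma d_d: "x \<in> carrier (P (Suc (Suc n))) \<Longrightarrow> d n (d (Suc n) x) = \<zero>\<^bsub>P n\<^esub>"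
  using exact_Suc by blast

end

definition chain_map ::
    "'r top_ring \<Rightarrow> (nat \<Rightarrow> ('r, 'm) top_module) \<Rightarrow> (nat \<Rightarrow> 'm \<Rightarrow> 'm) \<Rightarrow> ('m \<Rightarrow> 'a) \<Rightarrow>
     (nat \<Rightarrow> ('r, 'm) top_module) \<Rightarrow> (nat \<Rightarrow> 'm \<Rightarrow> 'm) \<Rightarrow> ('m \<Rightarrow> 'a) \<Rightarrow> (nat \<Rightarrow> 'm \<Rightarrow> 'm) \<Rightarrow> bool" where
  "chain_map R P d \<epsilon> Q e \<eta> f \<longleftrightarrow>
     (\<forall>n. f n \<in> continuous_hom R (P n) (Q n)) \<and>
     (\<forall>x\<in>carrier (P 0). \<eta> (f 0 x) = \<epsilon> x) \<and>
     (\<forall>n. \<forall>x\<in>carrier (P (Suc n)). e n (f (Suc n) x) = f n (d n x))"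

locale resolution_pair = P: resolution R A P d \<epsilon> + Q: resolution R A Q e \<eta>
  for R :: "'r top_ring" and A :: "('r, 'a) top_module"
    and P :: "nat \<Rightarrow> ('r, 'm) top_module" and d \<epsilon> and Q :: "nat \<Rightarrow> ('r, 'm) top_module" and e \<eta>
begin

text \<open>The invariant of the recursion includes the containment of \<open>f (d n x)\<close> in
  the image of \<open>e n\<close>: it is the hypothesis for lifting to degree \<open>n + 1\<close>,
  and exactness of \<open>Q\<close> supplies it again after each step.\<close>

lemma chain_map_exists: "\<exists>f. chain_map R P d \<epsilon> Q e \<eta> f"
proof -
  let ?P = "\<lambda>n f. f \<in> continuous_hom R (P n) (Q n) \<and> (n = 0 \<longrightarrow> (\<forall>x\<in>carrier (P 0). \<eta> (f x) = \<epsilon> x)) \<and>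
    (\<forall>x\<in>carrier (P (Suc n)). f (d n x) \<in> e n ` carrier (Q (Suc n)))"
  have "\<exists>f. \<forall>n. ?P n (f n) \<and> (\<forall>x\<in>carrier (P (Suc n)). e n (f (Suc n) x) = f n (d n x))"
  proof (rule dependent_nat_choice)
    have "\<epsilon> ` carrier (P 0) \<subseteq> \<eta> ` carrier (Q 0)"
      using P.eps_surj Q.eps_surj by simp
    then obtain f where f: "f \<in> continuous_hom R (P 0) (Q 0)" "\<And>x. x \<in> carrier (P 0) \<Longrightarrow> \<eta> (f x) = \<epsilon> x"
      by (rule projective_lift[OF P.proj Q.profinite P.profinite_A Q.eps_hom P.eps_hom _ P.ring_topspace]) (rule that)
    have "f (d 0 x) \<in> e 0 ` carrier (Q (Suc 0))" if "x \<in> carrier (P (Suc 0))" for x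
      using that f by (simp add: Q.exact_0 P.d_closed continuous_homD(2) P.eps_d)
    then show "\<exists>f. ?P 0 f"
      using f by blast
  next
    fix f n assume f: "?P n f"
    then have fh: "f \<in> continuous_hom R (P n) (Q n)" by blast
    have "compose (carrier (P (Suc n))) f (d n) \<in> continuous_hom R (P (Suc n)) (Q n)"
      by (rule continuous_hom_compose[OF P.d_hom fh P.profinite])
    moreover have "compose (carrier (P (Suc n))) f (d n) ` carrier (P (Suc n)) \<subseteq> e n ` carrier (Q (Suc n))"
      using f by (auto simp: compose_def)
    ultimately obtain g where g: "g \<in> continuous_hom R (P (Suc n)) (Q (Suc n))"
        "\<And>x. x \<in> carrier (P (Suc n)) \<Longrightarrow> e n (g x) = compose (carrier (P (Suc n))) f (d n) x"
      by (rule projective_lift[OF P.proj Q.profinite Q.profinite Q.d_hom _ _ P.ring_topspace]) (rule that)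
    have "g (d (Suc n) x) \<in> e (Suc n) ` carrier (Q (Suc (Suc n)))" if "x \<in> carrier (P (Suc (Suc n)))" for x
      using that g continuous_hom_zero[OF fh P.ab Q.ab]
      by (simp add: Q.exact_Suc P.d_closed continuous_homD(2) compose_def P.d_d)
    then show "\<exists>g. ?P (Suc n) g \<and> (\<forall>x\<in>carrier (P (Suc n)). e n (g x) = f (d n x))"
      using g by (auto simp: compose_def)
  qed
  then obtain f where "\<forall>n. ?P n (f n) \<and> (\<forall>x\<in>carrier (P (Suc n)). e n (f (Suc n) x) = f n (d n x))"
    by blast
  then show ?thesis
    unfolding chain_map_def by (intro exI[of _ f]) simp
qed

lemma chain_map_closed: "chain_map R P d \<epsilon> Q e \<eta> f \<Longrightarrow> x \<in> carrier (P n) \<Longrightarrow> f n x \<in> carrier (Q n)"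
  using continuous_homD(2) unfolding chain_map_def by metis

text \<open>The recursion runs on the difference \<open>\<phi>\<close> of the two chain maps. Once
  \<open>s\<close> is built up to degree \<open>n\<close>, the map \<open>\<phi> (Suc n)\<close>
  minus \<open>s\<close> after \<open>d n\<close> is annihilated by \<open>e n\<close>, so by
  exactness of \<open>Q\<close> it lifts through \<open>e (Suc n)\<close>.\<close>

lemma chain_homotopy_exists:
  assumes f: "chain_map R P d \<epsilon> Q e \<eta> f" and g: "chain_map R P d \<epsilon> Q e \<eta> g"
  obtains s where "\<And>n. s n \<in> continuous_hom R (P n) (Q (Suc n))"
    and "\<And>x. x \<in> carrier (P 0) \<Longrightarrow> f 0 x = g 0 x \<oplus>\<^bsub>Q 0\<^esub> e 0 (s 0 x)"
    and "\<And>n x. x \<in> carrier (P (Suc n)) \<Longrightarrow>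
      f (Suc n) x = g (Suc n) x \<oplus>\<^bsub>Q (Suc n)\<^esub> (e (Suc n) (s (Suc n) x) \<oplus>\<^bsub>Q (Suc n)\<^esub> s n (d n x))"
proof -
  define \<phi> where "\<phi> n = (\<lambda>x\<in>carrier (P n). f n x \<oplus>\<^bsub>Q n\<^esub> (\<lambda>x\<in>carrier (P n). \<ominus>\<^bsub>Q n\<^esub> g n x) x)" for n
  have fh: "f n \<in> continuous_hom R (P n) (Q n)" and gh: "g n \<in> continuous_hom R (P n) (Q n)" for n
    using f g by (auto simp: chain_map_def)
  have \<phi>h: "\<phi> n \<in> continuous_hom R (P n) (Q n)" for n
    unfolding \<phi>_def by (intro continuous_hom_add continuous_hom_uminus fh gh P.profinite Q.profinite)
  have \<phi>: "\<phi> n x = f n x \<ominus>\<^bsub>Q n\<^esub> g n x" if "x \<in> carrier (P n)" for n x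
    using that by (simp add: \<phi>_def a_minus_def)
  have e\<phi>: "e n (\<phi> (Suc n) x) = \<phi> n (d n x)" if "x \<in> carrier (P (Suc n))" for n x
    using that f g continuous_homD[OF Q.d_hom] chain_map_closed[OF f that] chain_map_closed[OF g that]
      abelian_group.a_inv_closed[OF Q.ab]
    by (simp add: \<phi> P.d_closed a_minus_def continuous_hom_minus[OF Q.d_hom Q.ab Q.ab] chain_map_def)
  have \<eta>\<phi>: "\<eta> (\<phi> 0 x) = \<zero>\<^bsub>A\<^esub>" if "x \<in> carrier (P 0)" for x
  proof -
    interpret A: abelian_group A
      using P.profinite_A by (rule profinite_module_abelian_group)
    have "\<eta> (\<phi> 0 x) = \<epsilon> x \<oplus>\<^bsub>A\<^esub> \<ominus>\<^bsub>A\<^esub> \<epsilon> x"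
      using that f g continuous_homD(3)[OF Q.eps_hom] chain_map_closed[OF f that] chain_map_closed[OF g that]
        abelian_group.a_inv_closed[OF Q.ab]
      by (simp add: \<phi> a_minus_def continuous_hom_minus[OF Q.eps_hom Q.ab A.abelian_group_axioms] chain_map_def)
    then show ?thesis
      using continuous_homD(2)[OF P.eps_hom that] by (simp add: A.r_neg)
  qed
  \<comment> \<open>The last clause is the homotopy relation composed with \<open>d n\<close>; the
    term of lower degree vanishes there, so degree 0 and all later degrees share one form.\<close>
  let ?P = "\<lambda>n s. s \<in> continuous_hom R (P n) (Q (Suc n)) \<and>
     (n = 0 \<longrightarrow> (\<forall>x\<in>carrier (P 0). e 0 (s x) = \<phi> 0 x)) \<and>
     (\<forall>x\<in>carrier (P (Suc n)). e n (s (d n x)) = \<phi> n (d n x))"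
  have "\<exists>s. \<forall>n. ?P n (s n) \<and>
      (\<forall>x\<in>carrier (P (Suc n)). e (Suc n) (s (Suc n) x) = \<phi> (Suc n) x \<oplus>\<^bsub>Q (Suc n)\<^esub> \<ominus>\<^bsub>Q (Suc n)\<^esub> s n (d n x))"
  proof (rule dependent_nat_choice)
    have "\<phi> 0 ` carrier (P 0) \<subseteq> e 0 ` carrier (Q (Suc 0))"
      using continuous_homD(2)[OF \<phi>h] by (auto simp: Q.exact_0 \<eta>\<phi>)
    then obtain s where "s \<in> continuous_hom R (P 0) (Q (Suc 0))" "\<And>x. x \<in> carrier (P 0) \<Longrightarrow> e 0 (s x) = \<phi> 0 x"
      by (rule projective_lift[OF P.proj Q.profinite Q.profinite Q.d_hom \<phi>h _ P.ring_topspace]) (rule that)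
    then show "\<exists>s. ?P 0 s"
      using P.d_closed by blast
  next
    fix s n assume s: "?P n s"
    then have sh: "s \<in> continuous_hom R (P n) (Q (Suc n))" by blast
    let ?t = "\<lambda>x\<in>carrier (P (Suc n)). \<phi> (Suc n) x \<oplus>\<^bsub>Q (Suc n)\<^esub>
      (\<lambda>x\<in>carrier (P (Suc n)). \<ominus>\<^bsub>Q (Suc n)\<^esub> compose (carrier (P (Suc n))) s (d n) x) x"
    have th: "?t \<in> continuous_hom R (P (Suc n)) (Q (Suc n))"
      by (intro continuous_hom_add continuous_hom_uminus \<phi>h P.profinite Q.profinite
          continuous_hom_compose[OF P.d_hom sh])
    have t: "?t x = \<phi> (Suc n) x \<oplus>\<^bsub>Q (Suc n)\<^esub> \<ominus>\<^bsub>Q (Suc n)\<^esub> s (d n x)" if "x \<in> carrier (P (Suc n))" for x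
      using that by (simp add: compose_def)
    have "?t ` carrier (P (Suc n)) \<subseteq> e (Suc n) ` carrier (Q (Suc (Suc n)))"
    proof
      fix y assume "y \<in> ?t ` carrier (P (Suc n))"
      then obtain x where x: "x \<in> carrier (P (Suc n))" "y = ?t x" by blast
      interpret Qn: abelian_group "Q n" by (rule Q.ab)
      interpret QS: abelian_group "Q (Suc n)" by (rule Q.ab)
      have "s (d n x) \<in> carrier (Q (Suc n))"
        using continuous_homD(2)[OF sh P.d_closed[OF x(1)]] .
      moreover have "\<phi> (Suc n) x \<in> carrier (Q (Suc n))"
        using continuous_homD(2)[OF \<phi>h x(1)] .
      ultimately have "e n (?t x) = \<phi> n (d n x) \<oplus>\<^bsub>Q n\<^esub> \<ominus>\<^bsub>Q n\<^esub> \<phi> n (d n x)"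
        unfolding t[OF x(1)]
        using s x(1) by (simp add: continuous_homD(3)[OF Q.d_hom] continuous_hom_minus[OF Q.d_hom Q.ab Q.ab] e\<phi>)
      also have "\<dots> = \<zero>\<^bsub>Q n\<^esub>"
        using continuous_homD(2)[OF \<phi>h P.d_closed[OF x(1)]] by (simp add: Qn.r_neg)
      finally show "y \<in> e (Suc n) ` carrier (Q (Suc (Suc n)))"
        unfolding x(2) Q.exact_Suc using continuous_homD(2)[OF th x(1)] by blast
    qed
    then obtain s' where s': "s' \<in> continuous_hom R (P (Suc n)) (Q (Suc (Suc n)))"
        "\<And>x. x \<in> carrier (P (Suc n)) \<Longrightarrow> e (Suc n) (s' x) = ?t x"
      by (rule projective_lift[OF P.proj Q.profinite Q.profinite Q.d_hom th _ P.ring_topspace]) (rule that)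
    interpret QS: abelian_group "Q (Suc n)" by (rule Q.ab)
    have "e (Suc n) (s' (d (Suc n) x)) = \<phi> (Suc n) (d (Suc n) x)" if x: "x \<in> carrier (P (Suc (Suc n)))" for x
      unfolding s'(2)[OF P.d_closed[OF x]] t[OF P.d_closed[OF x]] P.d_d[OF x]
      using continuous_hom_zero[OF sh P.ab Q.ab] continuous_homD(2)[OF \<phi>h P.d_closed[OF x]] by simp
    moreover have "\<forall>x\<in>carrier (P (Suc n)). e (Suc n) (s' x) =
        \<phi> (Suc n) x \<oplus>\<^bsub>Q (Suc n)\<^esub> \<ominus>\<^bsub>Q (Suc n)\<^esub> s (d n x)"
      using s'(2) t by simp
    ultimately show "\<exists>s'. ?P (Suc n) s' \<and> (\<forall>x\<in>carrier (P (Suc n)). e (Suc n) (s' x) =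
        \<phi> (Suc n) x \<oplus>\<^bsub>Q (Suc n)\<^esub> \<ominus>\<^bsub>Q (Suc n)\<^esub> s (d n x))"
      using s'(1) by blast
  qed
  then obtain s where s: "\<And>n. ?P n (s n)"
      "\<And>n x. x \<in> carrier (P (Suc n)) \<Longrightarrow> e (Suc n) (s (Suc n) x) =
        \<phi> (Suc n) x \<oplus>\<^bsub>Q (Suc n)\<^esub> \<ominus>\<^bsub>Q (Suc n)\<^esub> s n (d n x)"
    by blast
  have sh: "s n \<in> continuous_hom R (P n) (Q (Suc n))" for n
    using s(1) by blast
  show thesis
  proof
    show "s n \<in> continuous_hom R (P n) (Q (Suc n))" for n by (rule sh)
    show "f 0 x = g 0 x \<oplus>\<^bsub>Q 0\<^esub> e 0 (s 0 x)" if x: "x \<in> carrier (P 0)" for x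
    proof -
      interpret Q0: abelian_group "Q 0" by (rule Q.ab)
      have "e 0 (s 0 x) = f 0 x \<ominus>\<^bsub>Q 0\<^esub> g 0 x"
        using s(1)[of 0] x \<phi>[OF x] by simp
      then show ?thesis
        using chain_map_closed[OF f x] chain_map_closed[OF g x]
        by (simp add: a_minus_def Q0.a_lcomm Q0.r_neg)
    qed
    show "f (Suc n) x = g (Suc n) x \<oplus>\<^bsub>Q (Suc n)\<^esub> (e (Suc n) (s (Suc n) x) \<oplus>\<^bsub>Q (Suc n)\<^esub> s n (d n x))"
      if x: "x \<in> carrier (P (Suc n))" for n x
    proof -
      interpret QS: abelian_group "Q (Suc n)" by (rule Q.ab)
      have c: "s n (d n x) \<in> carrier (Q (Suc n))" "f (Suc n) x \<in> carrier (Q (Suc n))" "g (Suc n) x \<in> carrier (Q (Suc n))"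
        using continuous_homD(2)[OF sh P.d_closed[OF x]] chain_map_closed[OF f x] chain_map_closed[OF g x] .
      show ?thesis
        unfolding s(2)[OF x] \<phi>[OF x] a_minus_def using c
        by (simp add: QS.a_assoc QS.l_neg QS.a_lcomm QS.r_neg)
    qed
  qed
qed

end

section \<open>Cocycles, coboundaries and their pullback along chain maps\<close>

lemma cocycles_iff:
  "z \<in> cocycles R P d N n \<longleftrightarrow>
     z \<in> continuous_hom R (P n) N \<and> (\<forall>x\<in>carrier (P (Suc n)). z (d n x) = \<zero>\<^bsub>N\<^esub>)"
  by (auto simp: cocycles_def kernel_def hom_group_def coboundary_map_def compose_def fun_eq_iff restrict_def)

lemma coboundaries_0_iff: "z \<in> coboundaries R P d N 0 \<longleftrightarrow> z = (\<lambda>x\<in>carrier (P 0). \<zero>\<^bsub>N\<^esub>)"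
  by (simp add: coboundaries_def hom_group_def)

lemma coboundaries_Suc_iff:
  "z \<in> coboundaries R P d N (Suc n) \<longleftrightarrow>
     z \<in> extensional (carrier (P (Suc n))) \<and>
     (\<exists>w\<in>continuous_hom R (P n) N. \<forall>x\<in>carrier (P (Suc n)). z x = w (d n x))"
  by (auto simp: coboundaries_def coboundary_map_def compose_def image_iff extensional_def fun_eq_iff restrict_def)

context resolution_pair
begin

text \<open>Under a cocycle the part \<open>e s\<close> of the homotopy vanishes, and the part
  \<open>s d\<close> becomes the coboundary of \<open>z\<close> composed with \<open>s\<close>. In
  degree 0 only the first part is present.\<close>

lemma cochain_homotopy:
  assumes f: "chain_map R P d \<epsilon> Q e \<eta> f" and g: "chain_map R P d \<epsilon> Q e \<eta> g"
    and N: "profinite_module R N" and z: "z \<in> cocycles R Q e N n"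
  shows "\<exists>b\<in>coboundaries R P d N n. \<forall>x\<in>carrier (P n). z (f n x) = z (g n x) \<oplus>\<^bsub>N\<^esub> b x"
proof -
  obtain s where s: "\<And>n. s n \<in> continuous_hom R (P n) (Q (Suc n))"
    and s0: "\<And>x. x \<in> carrier (P 0) \<Longrightarrow> f 0 x = g 0 x \<oplus>\<^bsub>Q 0\<^esub> e 0 (s 0 x)"
    and sS: "\<And>n x. x \<in> carrier (P (Suc n)) \<Longrightarrow>
      f (Suc n) x = g (Suc n) x \<oplus>\<^bsub>Q (Suc n)\<^esub> (e (Suc n) (s (Suc n) x) \<oplus>\<^bsub>Q (Suc n)\<^esub> s n (d n x))"
    using chain_homotopy_exists[OF f g] by metis
  interpret N: abelian_group N using N by (rule profinite_module_abelian_group)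
  have zh: "z \<in> continuous_hom R (Q n) N" and ze: "\<And>x. x \<in> carrier (Q (Suc n)) \<Longrightarrow> z (e n x) = \<zero>\<^bsub>N\<^esub>"
    using z by (auto simp: cocycles_iff)
  show ?thesis
  proof (cases n)
    case 0
    have "z (f 0 x) = z (g 0 x) \<oplus>\<^bsub>N\<^esub> \<zero>\<^bsub>N\<^esub>" if x: "x \<in> carrier (P 0)" for x
      using continuous_homD(3)[OF zh] chain_map_closed[OF g x] continuous_homD(2)[OF s x]
        Q.d_closed ze by (simp add: s0[OF x] 0)
    then show ?thesis
      unfolding 0 by (intro bexI[of _ "\<lambda>x\<in>carrier (P 0). \<zero>\<^bsub>N\<^esub>"]) (auto simp: coboundaries_0_iff)
  next
    case (Suc k)
    let ?w = "compose (carrier (P k)) z (s k)"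
    let ?b = "compose (carrier (P (Suc k))) ?w (d k)"
    have "z (f (Suc k) x) = z (g (Suc k) x) \<oplus>\<^bsub>N\<^esub> ?b x" if x: "x \<in> carrier (P (Suc k))" for x
    proof -
      interpret QS: abelian_group "Q (Suc k)" by (rule Q.ab)
      have c: "s k (d k x) \<in> carrier (Q (Suc k))" "s (Suc k) x \<in> carrier (Q (Suc (Suc k)))" "g (Suc k) x \<in> carrier (Q (Suc k))"
        using continuous_homD(2)[OF s P.d_closed[OF x]] continuous_homD(2)[OF s x] chain_map_closed[OF g x] .
      have "z (f (Suc k) x) = z (g (Suc k) x) \<oplus>\<^bsub>N\<^esub> (z (e (Suc k) (s (Suc k) x)) \<oplus>\<^bsub>N\<^esub> z (s k (d k x)))"
        using c Q.d_closed[OF c(2)] by (simp add: sS[OF x] continuous_homD(3)[OF zh[unfolded Suc]])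
      then show ?thesis
        using c x ze[unfolded Suc] continuous_homD(2)[OF zh[unfolded Suc]] by (simp add: compose_def P.d_closed)
    qed
    moreover have "?w \<in> continuous_hom R (P k) N"
      using zh by (intro continuous_hom_compose[OF s _ P.profinite]) (simp add: Suc)
    then have "?b \<in> coboundaries R P d N (Suc k)"
      unfolding coboundaries_Suc_iff by (auto simp: compose_def intro!: bexI[of _ ?w])
    ultimately show ?thesis
      unfolding Suc by blast
  qed
qed

lemma pullback_cocycle:
  assumes f: "chain_map R P d \<epsilon> Q e \<eta> f" and N: "profinite_module R N" and z: "z \<in> cocycles R Q e N n"
  shows "compose (carrier (P n)) z (f n) \<in> cocycles R P d N n"
  unfolding cocycles_iff
proof
  show "compose (carrier (P n)) z (f n) \<in> continuous_hom R (P n) N"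
    using f z by (intro continuous_hom_compose[OF _ _ P.profinite, of _ _ "Q n"]) (auto simp: chain_map_def cocycles_iff)
  show "\<forall>x\<in>carrier (P (Suc n)). compose (carrier (P n)) z (f n) (d n x) = \<zero>\<^bsub>N\<^esub>"
  proof
    fix x assume x: "x \<in> carrier (P (Suc n))"
    have "f n (d n x) = e n (f (Suc n) x)"
      using f x by (simp add: chain_map_def)
    then show "compose (carrier (P n)) z (f n) (d n x) = \<zero>\<^bsub>N\<^esub>"
      using z chain_map_closed[OF f x] by (simp add: compose_def P.d_closed[OF x] cocycles_iff)
  qed
qed

lemma pullback_coboundary:
  assumes f: "chain_map R P d \<epsilon> Q e \<eta> f" and N: "profinite_module R N" and z: "z \<in> coboundaries R Q e N n"
  shows "compose (carrier (P n)) z (f n) \<in> coboundaries R P d N n"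
proof (cases n)
  case 0
  then show ?thesis
    using z chain_map_closed[OF f] by (auto simp: coboundaries_0_iff compose_def fun_eq_iff)
next
  case (Suc k)
  then obtain w where w: "w \<in> continuous_hom R (Q k) N" "\<And>x. x \<in> carrier (Q (Suc k)) \<Longrightarrow> z x = w (e k x)"
    using z by (auto simp: coboundaries_Suc_iff)
  have "compose (carrier (P k)) w (f k) \<in> continuous_hom R (P k) N"
    using f w by (intro continuous_hom_compose[OF _ _ P.profinite, of _ _ "Q k"]) (auto simp: chain_map_def)
  moreover have "compose (carrier (P (Suc k))) z (f (Suc k)) x = compose (carrier (P k)) w (f k) (d k x)"
    if "x \<in> carrier (P (Suc k))" for x
    using f w(2) that chain_map_closed[OF f that] by (simp add: compose_def P.d_closed chain_map_def)
  ultimately show ?thesis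
    unfolding Suc coboundaries_Suc_iff by (auto simp: compose_def intro!: bexI[of _ "compose (carrier (P k)) w (f k)"])
qed

end

context resolution
begin

lemma chain_map_id: "chain_map R P d \<epsilon> P d \<epsilon> (\<lambda>n. \<lambda>x\<in>carrier (P n). x)"
proof -
  have "(\<lambda>x\<in>carrier (P n). x) \<in> continuous_hom R (P n) (P n)" for n
    using profinite_module_topspace[OF profinite] profinite_module_module[OF profinite]
    by (intro continuous_homI) auto
  then show ?thesis
    by (simp add: chain_map_def d_closed)
qed

lemma coboundary_map_hom:
  assumes "profinite_module R N"
  shows "coboundary_map P d n \<in> hom (hom_group R (P n) N) (hom_group R (P (Suc n)) N)"
proof (rule homI)
  fix f assume "f \<in> carrier (hom_group R (P n) N)"
  then show "coboundary_map P d n f \<in> carrier (hom_group R (P (Suc n)) N)"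
    by (simp add: hom_group_def coboundary_map_def continuous_hom_compose[OF d_hom _ profinite])
qed (auto simp: hom_group_def coboundary_map_def compose_def fun_eq_iff d_closed)

lemma subgroup_cocycles:
  assumes "profinite_module R N"
  shows "subgroup (cocycles R P d N n) (hom_group R (P n) N)"
proof -
  interpret group_hom "hom_group R (P n) N" "hom_group R (P (Suc n)) N" "coboundary_map P d n"
    using coboundary_map_hom[OF assms] comm_group_hom_group[OF profinite assms]
    by (simp add: group_hom_def group_hom_axioms_def comm_group_def)
  show ?thesis
    unfolding cocycles_def by (rule subgroup_kernel)
qed

lemma coboundaries_subset:
  assumes "profinite_module R N"
  shows "coboundaries R P d N n \<subseteq> cocycles R P d N n"
proof
  fix z assume z: "z \<in> coboundaries R P d N n"
  show "z \<in> cocycles R P d N n"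
  proof (cases n)
    case 0
    then show ?thesis
      using z continuous_hom_const_zero[OF profinite assms] by (auto simp: coboundaries_0_iff cocycles_iff d_closed)
  next
    case (Suc k)
    then obtain w where w: "w \<in> continuous_hom R (P k) N" "z = compose (carrier (P (Suc k))) w (d k)"
      using z by (auto simp: coboundaries_def coboundary_map_def)
    then show ?thesis
      using continuous_hom_compose[OF d_hom w(1) profinite] d_d
        continuous_hom_zero[OF w(1) ab profinite_module_abelian_group[OF assms]]
      by (simp add: Suc cocycles_iff compose_def d_closed)
  qed
qed

end

context resolution_pair
begin

lemma chain_map_compose:
  assumes f: "chain_map R P d \<epsilon> Q e \<eta> f" and g: "chain_map R Q e \<eta> P d \<epsilon> g"
  shows "chain_map R P d \<epsilon> P d \<epsilon> (\<lambda>n. compose (carrier (P n)) (g n) (f n))"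
proof -
  have "compose (carrier (P n)) (g n) (f n) \<in> continuous_hom R (P n) (P n)" for n
    using f g by (intro continuous_hom_compose[OF _ _ P.profinite, of _ _ "Q n"]) (auto simp: chain_map_def)
  then show ?thesis
    using f g chain_map_closed[OF f] by (simp add: chain_map_def P.d_closed) (simp add: compose_def P.d_closed)
qed

text \<open>Cocycles of \<open>P\<close> are pulled back to \<open>Q\<close> along a comparison map
  \<open>g\<close> and then sent through \<open>\<psi>\<close>. Both composites of the comparison
  maps are homotopic to the identity, so surjectivity and kernel carry over. The hypotheses on
  \<open>\<psi>\<close> describe the cohomology of \<open>Q\<close> without forming its quotient
  group.\<close>

theorem Hom_cohomology_iso:
  fixes T :: "('t, 'z) monoid_scheme"
  assumes N: "profinite_module R N" and T: "group T"
    and \<psi>: "\<psi> \<in> hom ((hom_group R (Q n) N)\<lparr>carrier := cocycles R Q e N n\<rparr>) T"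
    and surj: "\<And>t. t \<in> carrier T \<Longrightarrow> \<exists>z\<in>cocycles R Q e N n. \<psi> z = t"
    and ker: "\<And>z. z \<in> cocycles R Q e N n \<Longrightarrow> \<psi> z = \<one>\<^bsub>T\<^esub> \<longleftrightarrow> z \<in> coboundaries R Q e N n"
  shows "Hom_cohomology R P d N n \<cong> T" and "group (Hom_cohomology R P d N n)"
proof -
  interpret T: group T by fact
  interpret QP: resolution_pair R A Q e \<eta> P d \<epsilon> ..
  interpret PP: resolution_pair R A P d \<epsilon> P d \<epsilon> ..
  interpret QQ: resolution_pair R A Q e \<eta> Q e \<eta> ..
  interpret N: abelian_group N using N by (rule profinite_module_abelian_group)
  obtain f where f: "chain_map R P d \<epsilon> Q e \<eta> f" using chain_map_exists by blast
  obtain g where g: "chain_map R Q e \<eta> P d \<epsilon> g" using QP.chain_map_exists by blast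
  let ?G = "(hom_group R (P n) N)\<lparr>carrier := cocycles R P d N n\<rparr>"
  define \<Phi> where "\<Phi> z = \<psi> (compose (carrier (Q n)) z (g n))" for z
  have G: "group ?G"
    using P.subgroup_cocycles[OF N] comm_group_hom_group[OF P.profinite N]
    by (intro subgroup.subgroup_is_group) (auto simp: comm_group_def)
  have ext: "z \<in> extensional (carrier (P n))" if "z \<in> cocycles R P d N n" for z
    using that continuous_homD(1) by (auto simp: cocycles_iff)
  have extQ: "z \<in> extensional (carrier (Q n))" if "z \<in> cocycles R Q e N n" for z
    using that continuous_homD(1) by (auto simp: cocycles_iff)
  \<comment> \<open>\<open>\<psi>\<close> is constant on cohomology classes, so cocycles related by
    a homotopy have the same value.\<close>
  have \<psi>_shift: "\<psi> z = \<psi> z'" if "z \<in> cocycles R Q e N n" "z' \<in> cocycles R Q e N n" "b \<in> coboundaries R Q e N n"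
    "\<And>x. x \<in> carrier (Q n) \<Longrightarrow> z x = z' x \<oplus>\<^bsub>N\<^esub> b x" for z z' b
  proof -
    have b: "b \<in> cocycles R Q e N n"
      using that(3) Q.coboundaries_subset[OF N] by blast
    have "z = (\<lambda>x\<in>carrier (Q n). z' x \<oplus>\<^bsub>N\<^esub> b x)"
      using that(4) by (intro extensionalityI[OF extQ[OF that(1)]]) auto
    then have "\<psi> z = \<psi> z' \<otimes>\<^bsub>T\<^esub> \<psi> b"
      using hom_mult[OF \<psi>, of z' b] that(2) b by (simp add: hom_group_def)
    moreover have "\<psi> z' \<in> carrier T"
      using hom_in_carrier[OF \<psi>, of z'] that(2) by simp
    ultimately show ?thesis
      using ker[OF b] that(3) by simp
  qed
  have hom: "\<Phi> \<in> hom ?G T"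
  proof (rule homI)
    fix z assume "z \<in> carrier ?G"
    then show "\<Phi> z \<in> carrier T"
      using hom_in_carrier[OF \<psi>] QP.pullback_cocycle[OF g N] by (simp add: \<Phi>_def)
  next
    fix z z' assume z: "z \<in> carrier ?G" "z' \<in> carrier ?G"
    have "compose (carrier (Q n)) (z \<otimes>\<^bsub>?G\<^esub> z') (g n) =
        compose (carrier (Q n)) z (g n) \<otimes>\<^bsub>hom_group R (Q n) N\<^esub> compose (carrier (Q n)) z' (g n)"
      using QP.chain_map_closed[OF g] by (auto simp: hom_group_def compose_def fun_eq_iff)
    then show "\<Phi> (z \<otimes>\<^bsub>?G\<^esub> z') = \<Phi> z \<otimes>\<^bsub>T\<^esub> \<Phi> z'"
      using hom_mult[OF \<psi>, of "compose (carrier (Q n)) z (g n)" "compose (carrier (Q n)) z' (g n)"]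
        z QP.pullback_cocycle[OF g N] by (simp add: \<Phi>_def)
  qed
  have img: "\<Phi> ` carrier ?G = carrier T"
  proof (intro equalityI subsetI)
    fix t assume "t \<in> carrier T"
    then obtain z where z: "z \<in> cocycles R Q e N n" "\<psi> z = t" using surj by blast
    let ?z = "compose (carrier (P n)) z (f n)"
    have z1: "?z \<in> cocycles R P d N n" by (rule pullback_cocycle[OF f N z(1)])
    have z2: "compose (carrier (Q n)) ?z (g n) \<in> cocycles R Q e N n" by (rule QP.pullback_cocycle[OF g N z1])
    \<comment> \<open>On \<open>Q\<close> the composite of \<open>g\<close> and \<open>f\<close> is
      homotopic to the identity, so pulling \<open>z\<close> to \<open>P\<close> and back changes it
      by a coboundary.\<close>
    obtain b where b: "b \<in> coboundaries R Q e N n"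
      "\<And>x. x \<in> carrier (Q n) \<Longrightarrow> z (compose (carrier (Q n)) (f n) (g n) x) = z ((\<lambda>x\<in>carrier (Q n). x) x) \<oplus>\<^bsub>N\<^esub> b x"
      using QQ.cochain_homotopy[OF QP.chain_map_compose[OF g f] Q.chain_map_id N z(1)] by blast
    have "\<psi> (compose (carrier (Q n)) ?z (g n)) = \<psi> z"
      using b(2) by (intro \<psi>_shift[OF z2 z(1) b(1)]) (simp add: compose_def QP.chain_map_closed[OF g])
    then show "t \<in> \<Phi> ` carrier ?G"
      using z1 z(2) by (auto simp: \<Phi>_def intro!: image_eqI[of _ _ ?z])
  qed (use hom_in_carrier[OF hom] in auto)
  have kernel: "kernel ?G T \<Phi> = coboundaries R P d N n"
  proof (intro equalityI subsetI)
    fix z assume "z \<in> coboundaries R P d N n"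
    moreover have "z \<in> cocycles R P d N n"
      using calculation P.coboundaries_subset[OF N] by blast
    ultimately show "z \<in> kernel ?G T \<Phi>"
      using ker[OF QP.pullback_cocycle[OF g N]] QP.pullback_coboundary[OF g N] by (simp add: kernel_def \<Phi>_def)
  next
    fix z assume "z \<in> kernel ?G T \<Phi>"
    then have z: "z \<in> cocycles R P d N n" "\<psi> (compose (carrier (Q n)) z (g n)) = \<one>\<^bsub>T\<^esub>"
      by (auto simp: kernel_def \<Phi>_def)
    let ?z = "compose (carrier (P n)) (compose (carrier (Q n)) z (g n)) (f n)"
    have "compose (carrier (Q n)) z (g n) \<in> coboundaries R Q e N n"
      using z ker[OF QP.pullback_cocycle[OF g N z(1)]] by simp
    then have z1: "?z \<in> coboundaries R P d N n"
      by (rule pullback_coboundary[OF f N])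
    \<comment> \<open>On \<open>P\<close> the homotopy writes \<open>z\<close> as the twice pulled
      back \<open>?z\<close> plus a coboundary, and \<open>?z\<close> is a coboundary by the
      hypothesis on the kernel.\<close>
    obtain b where b: "b \<in> coboundaries R P d N n"
      "\<And>x. x \<in> carrier (P n) \<Longrightarrow> z ((\<lambda>x\<in>carrier (P n). x) x) = z (compose (carrier (P n)) (g n) (f n) x) \<oplus>\<^bsub>N\<^esub> b x"
      using PP.cochain_homotopy[OF P.chain_map_id chain_map_compose[OF f g] N z(1)] by blast
    then have eq: "z x = ?z x \<oplus>\<^bsub>N\<^esub> b x" if "x \<in> carrier (P n)" for x
      using that by (simp add: compose_def chain_map_closed[OF f])
    show "z \<in> coboundaries R P d N n"
    proof (cases n)
      case 0
      then show ?thesis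
        using eq z1 b(1) ext[OF z(1)] unfolding 0 coboundaries_0_iff
        by (intro extensionalityI[OF ext[OF z(1), unfolded 0]]) auto
    next
      case (Suc k)
      obtain w w' where w: "w \<in> continuous_hom R (P k) N" "\<forall>x\<in>carrier (P (Suc k)). ?z x = w (d k x)"
        "w' \<in> continuous_hom R (P k) N" "\<forall>x\<in>carrier (P (Suc k)). b x = w' (d k x)"
        using z1 b(1) unfolding Suc coboundaries_Suc_iff by blast
      have "(\<lambda>x\<in>carrier (P k). w x \<oplus>\<^bsub>N\<^esub> w' x) \<in> continuous_hom R (P k) N"
        using w by (intro continuous_hom_add P.profinite N)
      then show ?thesis
        unfolding Suc coboundaries_Suc_iff using w eq[unfolded Suc] ext[OF z(1), unfolded Suc]
        by (auto simp: P.d_closed Suc intro!: bexI[of _ "\<lambda>x\<in>carrier (P k). w x \<oplus>\<^bsub>N\<^esub> w' x"])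
    qed
  qed
  interpret \<Phi>: group_hom ?G T \<Phi>
    using G T hom by (simp add: group_hom_def group_hom_axioms_def)
  show "Hom_cohomology R P d N n \<cong> T"
    using \<Phi>.FactGroup_iso_set[OF img] unfolding Hom_cohomology_def kernel is_iso_def by blast
  show "group (Hom_cohomology R P d N n)"
    using normal.factorgroup_is_group[OF \<Phi>.normal_kernel] unfolding Hom_cohomology_def kernel .
qed

end

section \<open>Group algebras\<close>

lemma group_algebra_simps [simp]:
  "carrier (group_algebra H) = extensional (carrier H)"
  "a \<oplus>\<^bsub>group_algebra H\<^esub> b = (\<lambda>z\<in>carrier H. a z + b z)"
  "\<zero>\<^bsub>group_algebra H\<^esub> = (\<lambda>z\<in>carrier H. 0)"
  "\<one>\<^bsub>group_algebra H\<^esub> = (\<lambda>z\<in>carrier H. if z = \<one>\<^bsub>H\<^esub> then 1 else 0)"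
  "a \<otimes>\<^bsub>group_algebra H\<^esub> b = (\<lambda>z\<in>carrier H. \<Sum>x\<in>carrier H. a x * b (inv\<^bsub>H\<^esub> x \<otimes>\<^bsub>H\<^esub> z))"
  by (simp_all add: group_algebra_def)

lemma (in group) sum_inv_mult:
  fixes f :: "'a \<Rightarrow> 'c :: comm_monoid_add"
  assumes "x \<in> carrier G"
  shows "(\<Sum>z\<in>carrier G. f (inv x \<otimes> z)) = (\<Sum>y\<in>carrier G. f y)"
  using assms
  by (intro sum.reindex_bij_witness[of _ "\<lambda>y. x \<otimes> y" "\<lambda>z. inv x \<otimes> z"]) (auto simp flip: m_assoc)

text \<open>Elements of the group algebra act as measures: integrating \<open>F\<close> against a
  convolution is integrating \<open>F (x \<otimes> y)\<close> against both factors. Identities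
  between products can then be tested on functions.\<close>

lemma group_algebra_integral_mult:
  fixes G :: "'a monoid" (structure)
  assumes "group G"
  shows "(\<Sum>z\<in>carrier G. (a \<otimes>\<^bsub>group_algebra G\<^esub> b) z * F z) =
     (\<Sum>x\<in>carrier G. \<Sum>y\<in>carrier G. a x * b y * F (x \<otimes> y))"
proof -
  interpret group G by fact
  have "(\<Sum>z\<in>carrier G. (a \<otimes>\<^bsub>group_algebra G\<^esub> b) z * F z) =
      (\<Sum>z\<in>carrier G. \<Sum>x\<in>carrier G. a x * b (inv x \<otimes> z) * F z)"
    by (simp add: sum_distrib_right)
  also have "\<dots> = (\<Sum>x\<in>carrier G. \<Sum>z\<in>carrier G. a x * b (inv x \<otimes> z) * F z)"
    by (rule sum.swap)
  also have "\<dots> = (\<Sum>x\<in>carrier G. \<Sum>z\<in>carrier G. a x * b (inv x \<otimes> z) * F (x \<otimes> (inv x \<otimes> z)))"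
    by (intro sum.cong refl) (simp flip: m_assoc)
  also have "\<dots> = (\<Sum>x\<in>carrier G. \<Sum>y\<in>carrier G. a x * b y * F (x \<otimes> y))"
    by (intro sum.cong refl sum_inv_mult[where f = "\<lambda>y. a _ * b y * F (_ \<otimes> y)"])
  finally show ?thesis .
qed

lemma cring_group_algebra:
  fixes G :: "'a monoid" (structure)
  assumes "comm_group G" and fin: "finite (carrier G)"
  shows "cring (group_algebra G)"
proof (rule cringI)
  interpret comm_group G by fact
  let ?A = "group_algebra G"
  \<comment> \<open>A coefficient is the integral of an indicator function; in this form
    commutativity and associativity come from those of the group under an iterated sum.\<close>
  have coeff: "a c = (\<Sum>z\<in>carrier G. a z * (if z = c then 1 else 0))" if "c \<in> carrier G" for a :: "'a \<Rightarrow> z2adic" and c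
    using that fin by (simp only: if_distrib[of "(*) _"] mult.right_neutral mult_zero_right sum.delta if_True)
  have mult: "(a \<otimes>\<^bsub>?A\<^esub> b) c = (\<Sum>x\<in>carrier G. \<Sum>y\<in>carrier G. a x * b y * (if x \<otimes> y = c then 1 else 0))"
    if "c \<in> carrier G" for a b c
    using group_algebra_integral_mult[OF group_axioms, of a b "\<lambda>z. if z = c then 1 else 0"]
    by (subst coeff[OF that]) simp
  have ext: "a \<otimes>\<^bsub>?A\<^esub> b \<in> extensional (carrier G)" for a b
    by simp
  have comm: "a \<otimes>\<^bsub>?A\<^esub> b = b \<otimes>\<^bsub>?A\<^esub> a" for a b
  proof (rule extensionalityI[OF ext ext])
    fix c assume c: "c \<in> carrier G"
    show "(a \<otimes>\<^bsub>?A\<^esub> b) c = (b \<otimes>\<^bsub>?A\<^esub> a) c"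
      unfolding mult[OF c] by (subst sum.swap) (intro sum.cong refl, simp add: m_comm mult.commute)
  qed
  have assoc: "(a \<otimes>\<^bsub>?A\<^esub> b) \<otimes>\<^bsub>?A\<^esub> d = a \<otimes>\<^bsub>?A\<^esub> (b \<otimes>\<^bsub>?A\<^esub> d)" for a b d
  proof (rule extensionalityI[OF ext ext])
    fix c assume c: "c \<in> carrier G"
    let ?I = "\<lambda>z. if z = c then 1 else 0 :: z2adic"
    have "((a \<otimes>\<^bsub>?A\<^esub> b) \<otimes>\<^bsub>?A\<^esub> d) c =
        (\<Sum>u\<in>carrier G. (a \<otimes>\<^bsub>?A\<^esub> b) u * (\<Sum>z\<in>carrier G. d z * ?I (u \<otimes> z)))"
      unfolding mult[OF c, of "a \<otimes>\<^bsub>?A\<^esub> b"] by (simp only: sum_distrib_left mult.assoc)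
    also have "\<dots> = (\<Sum>x\<in>carrier G. \<Sum>y\<in>carrier G. a x * b y * (\<Sum>z\<in>carrier G. d z * ?I (x \<otimes> y \<otimes> z)))"
      by (rule group_algebra_integral_mult[OF group_axioms])
    also have "\<dots> = (\<Sum>x\<in>carrier G. a x * (\<Sum>y\<in>carrier G. \<Sum>z\<in>carrier G. b y * d z * ?I (x \<otimes> (y \<otimes> z))))"
      by (intro sum.cong refl) (simp add: sum_distrib_left mult.assoc m_assoc)
    also have "\<dots> = (\<Sum>x\<in>carrier G. a x * (\<Sum>v\<in>carrier G. (b \<otimes>\<^bsub>?A\<^esub> d) v * ?I (x \<otimes> v)))"
      by (intro sum.cong refl arg_cong2[where f = "(*)"] group_algebra_integral_mult[OF group_axioms, symmetric])
    also have "\<dots> = (a \<otimes>\<^bsub>?A\<^esub> (b \<otimes>\<^bsub>?A\<^esub> d)) c"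
      unfolding mult[OF c, of a "b \<otimes>\<^bsub>?A\<^esub> d"] by (simp only: sum_distrib_left mult.assoc)
    finally show "((a \<otimes>\<^bsub>?A\<^esub> b) \<otimes>\<^bsub>?A\<^esub> d) c = (a \<otimes>\<^bsub>?A\<^esub> (b \<otimes>\<^bsub>?A\<^esub> d)) c" .
  qed
  show "abelian_group ?A"
  proof (rule abelian_groupI)
    fix a assume "a \<in> carrier ?A"
    then show "\<exists>b\<in>carrier ?A. b \<oplus>\<^bsub>?A\<^esub> a = \<zero>\<^bsub>?A\<^esub>"
      by (intro bexI[of _ "\<lambda>z\<in>carrier G. - a z"]) auto
  qed (auto intro!: restrict_ext simp: algebra_simps extensional_def fun_eq_iff)
  show "comm_monoid ?A"
  proof (rule comm_monoidI)
    fix a assume a: "a \<in> carrier ?A"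
    show "\<one>\<^bsub>?A\<^esub> \<otimes>\<^bsub>?A\<^esub> a = a"
    proof (rule extensionalityI[OF ext])
      fix c assume c: "c \<in> carrier G"
      have "(\<one>\<^bsub>?A\<^esub> \<otimes>\<^bsub>?A\<^esub> a) c = (\<Sum>x\<in>carrier G. if x = \<one> then a c else 0)"
        using c by (auto simp: intro!: sum.cong)
      then show "(\<one>\<^bsub>?A\<^esub> \<otimes>\<^bsub>?A\<^esub> a) c = a c"
        using fin by simp
    qed (use a in simp)
  qed (use assoc comm in auto)
  show "(a \<oplus>\<^bsub>?A\<^esub> b) \<otimes>\<^bsub>?A\<^esub> d = a \<otimes>\<^bsub>?A\<^esub> d \<oplus>\<^bsub>?A\<^esub> b \<otimes>\<^bsub>?A\<^esub> d" for a b d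
    by (auto simp: sum.distrib distrib_right intro!: restrict_ext)
qed

text \<open>Change of variables for the push-forward of \<open>a\<close> along
  \<open>p\<close>.\<close>

lemma sum_fibres:
  fixes a :: "'a \<Rightarrow> z2adic"
  assumes "finite S" "finite T" "p ` S \<subseteq> T"
  shows "(\<Sum>u\<in>T. (\<Sum>x | x \<in> S \<and> p x = u. a x) * F u) = (\<Sum>x\<in>S. a x * F (p x))"
proof -
  have "(\<Sum>x | x \<in> S \<and> p x = u. a x) * F u = (\<Sum>x | x \<in> S \<and> p x = u. a x * F (p x))" for u
    by (simp add: sum_distrib_right)
  then show ?thesis
    using sum.group[OF assms, of "\<lambda>x. a x * F (p x)"] by simp
qed

text \<open>Push-forward of measures along a homomorphism is multiplicative: after the change of
  variables both sides integrate the indicator of \<open>c\<close> at a product. With the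
  projections between quotients as \<open>p\<close>, products of compatible families are
  compatible.\<close>

lemma group_algebra_mult_fibres:
  assumes K: "group K" "finite (carrier K)" and L: "group L" "finite (carrier L)" and p: "p \<in> hom K L"
    and c: "c \<in> carrier L"
    and a': "\<And>u. u \<in> carrier L \<Longrightarrow> a' u = (\<Sum>x | x \<in> carrier K \<and> p x = u. a x)"
    and b': "\<And>u. u \<in> carrier L \<Longrightarrow> b' u = (\<Sum>x | x \<in> carrier K \<and> p x = u. b x)"
  shows "(\<Sum>z | z \<in> carrier K \<and> p z = c. (a \<otimes>\<^bsub>group_algebra K\<^esub> b) z) = (a' \<otimes>\<^bsub>group_algebra L\<^esub> b') c"
proof -
  let ?I = "\<lambda>z. if z = c then 1 else 0 :: z2adic"
  have sub: "p ` carrier K \<subseteq> carrier L"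
    using hom_in_carrier[OF p] by blast
  have int: "(\<Sum>u\<in>carrier L. a' u * F u) = (\<Sum>x\<in>carrier K. a x * F (p x))"
    "(\<Sum>u\<in>carrier L. b' u * F u) = (\<Sum>x\<in>carrier K. b x * F (p x))" for F
    using sum_fibres[OF K(2) L(2) sub, of a F] sum_fibres[OF K(2) L(2) sub, of b F]
    by (simp_all add: a' b')
  have "(\<Sum>z | z \<in> carrier K \<and> p z = c. (a \<otimes>\<^bsub>group_algebra K\<^esub> b) z) =
      (\<Sum>z\<in>carrier K. (a \<otimes>\<^bsub>group_algebra K\<^esub> b) z * ?I (p z))"
    using K(2) by (simp only: if_distrib[of "(*) _"] mult.right_neutral mult_zero_right sum.inter_filter)
  also have "\<dots> = (\<Sum>x\<in>carrier K. a x * (\<Sum>y\<in>carrier K. b y * ?I (p x \<otimes>\<^bsub>L\<^esub> p y)))"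
    unfolding group_algebra_integral_mult[OF K(1), of a b "\<lambda>z. ?I (p z)"]
    by (simp add: sum_distrib_left mult.assoc hom_mult[OF p])
  also have "\<dots> = (\<Sum>u\<in>carrier L. a' u * (\<Sum>v\<in>carrier L. b' v * ?I (u \<otimes>\<^bsub>L\<^esub> v)))"
    unfolding int ..
  also have "\<dots> = (\<Sum>u\<in>carrier L. \<Sum>v\<in>carrier L. a' u * b' v * ?I (u \<otimes>\<^bsub>L\<^esub> v))"
    by (simp only: sum_distrib_left mult.assoc)
  also have "\<dots> = (\<Sum>z\<in>carrier L. (a' \<otimes>\<^bsub>group_algebra L\<^esub> b') z * ?I z)"
    by (rule group_algebra_integral_mult[OF L(1), symmetric])
  also have "\<dots> = (a' \<otimes>\<^bsub>group_algebra L\<^esub> b') c"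
    using L(2) c by (simp only: if_distrib[of "(*) _"] mult.right_neutral mult_zero_right sum.delta if_True)
  finally show ?thesis .
qed

section \<open>Completed group algebras of abelian groups\<close>

locale completed_abelian_group_algebra = comm_group G for G :: "'g monoid" (structure) +
  fixes T :: "'g topology"
  assumes topspace: "topspace T = carrier G"
    and finite_index: "U \<in> open_normal_subgroups G T \<Longrightarrow> finite (carrier (G Mod U))"
begin

abbreviation "\<U> \<equiv> open_normal_subgroups G T"
abbreviation "\<Lambda> \<equiv> completed_group_algebra G T"

text \<open>The same choice of representative as in \<open>cga_module\<close>, which lets its finite
  sums be recognised as values of \<open>integral\<close>.\<close>

definition rep :: "'g set \<Rightarrow> 'g" where "rep c = (SOME g. g \<in> c)"

lemma normal: "U \<in> \<U> \<Longrightarrow> U \<lhd> G"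
  by (simp add: open_normal_subgroups_def)

lemma open_subgroups_subgroup: "U \<in> \<U> \<Longrightarrow> subgroup U G"
  by (simp add: normal normal_imp_subgroup)

lemma carrier_Mod: "carrier (G Mod U) = (\<lambda>g. U #> g) ` carrier G"
  by (auto simp: FactGroup_def RCOSETS_def)

lemma coset_in_Mod: "g \<in> carrier G \<Longrightarrow> U #> g \<in> carrier (G Mod U)"
  by (simp add: carrier_Mod)

lemma one_Mod: "\<one>\<^bsub>G Mod U\<^esub> = U"
  by (simp add: FactGroup_def)

lemma comm_group_Mod: "U \<in> \<U> \<Longrightarrow> comm_group (G Mod U)"
  by (simp add: abelian_FactGroup open_subgroups_subgroup)

lemma coset_one: "U \<in> \<U> \<Longrightarrow> U #> \<one> = U"
  using coset_mult_one open_subgroups_subgroup subgroup.subset by blast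

lemma mult_coset: "U \<in> \<U> \<Longrightarrow> g \<in> carrier G \<Longrightarrow> h \<in> carrier G \<Longrightarrow> (U #> g) \<otimes>\<^bsub>G Mod U\<^esub> (U #> h) = U #> (g \<otimes> h)"
  by (simp add: FactGroup_def normal.rcos_sum normal)

lemma coset_hom: "U \<in> \<U> \<Longrightarrow> (\<lambda>g. U #> g) \<in> hom G (G Mod U)"
  by (auto intro!: homI simp: coset_in_Mod normal.rcos_sum normal)

lemma inv_coset:
  assumes "U \<in> \<U>" "g \<in> carrier G"
  shows "inv\<^bsub>G Mod U\<^esub> (U #> g) = U #> (inv g)"
proof -
  interpret group_hom G "G Mod U" "\<lambda>g. U #> g"
    using coset_hom[OF assms(1)] comm_group_Mod[OF assms(1)]
    by (simp add: group_hom_def group_hom_axioms_def comm_group_def group_axioms)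
  show ?thesis using assms by simp
qed

lemma coset_eq_iff:
  assumes "U \<in> \<U>" "g \<in> carrier G" "h \<in> carrier G"
  shows "U #> g = U #> h \<longleftrightarrow> g \<in> U #> h"
  using assms open_subgroups_subgroup repr_independence rcos_self by metis

lemma rep:
  assumes "U \<in> \<U>" "c \<in> carrier (G Mod U)"
  shows "rep c \<in> carrier G" "rep c \<in> c" "U #> rep c = c"
proof -
  obtain g where g: "g \<in> carrier G" "c = U #> g"
    using assms(2) by (auto simp: carrier_Mod)
  then have "g \<in> c"
    using rcos_self open_subgroups_subgroup[OF assms(1)] by blast
  then show "rep c \<in> c"
    unfolding rep_def by (rule someI)
  moreover have "c \<subseteq> carrier G"
    using g r_coset_subset_G open_subgroups_subgroup[OF assms(1)] subgroup.subset by blast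
  ultimately show "rep c \<in> carrier G" by blast
  then show "U #> rep c = c"
    using coset_eq_iff[OF assms(1), of "rep c" g] g \<open>rep c \<in> c\<close> by simp
qed

lemma coset_mono: "V \<subseteq> U \<Longrightarrow> V #> g \<subseteq> U #> g"
  by (auto simp: r_coset_def)

text \<open>Turns the inclusions of cosets in the definition of the algebra into fibres of the
  projection from \<open>G Mod V\<close> to \<open>G Mod U\<close>, the form needed for
  push-forwards.\<close>

lemma coset_subset_iff:
  assumes "U \<in> \<U>" "V \<in> \<U>" "V \<subseteq> U" "e \<in> carrier (G Mod V)" "c \<in> carrier (G Mod U)"
  shows "e \<subseteq> c \<longleftrightarrow> U #> rep e = c"
proof
  assume "e \<subseteq> c"
  then show "U #> rep e = c"
    using rep[OF assms(2,4)] rep[OF assms(1,5)] coset_eq_iff[OF assms(1), of "rep e" "rep c"] by auto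
next
  assume "U #> rep e = c"
  then show "e \<subseteq> c"
    using coset_mono[OF assms(3), of "rep e"] rep[OF assms(2,4)] by simp
qed

lemma open_subgroups_Int: "U \<in> \<U> \<Longrightarrow> V \<in> \<U> \<Longrightarrow> U \<inter> V \<in> \<U>"
  by (simp add: open_normal_subgroups_def openin_Int normal_subgroup_intersect)

lemma carrier_open: "carrier G \<in> \<U>"
  using openin_topspace[of T] by (simp add: open_normal_subgroups_def topspace normal_self)

lemma proj_hom:
  assumes "U \<in> \<U>" "V \<in> \<U>" "V \<subseteq> U"
  shows "(\<lambda>e. U #> rep e) \<in> hom (G Mod V) (G Mod U)"
proof -
  have proj: "U #> rep (V #> g) = U #> g" if "g \<in> carrier G" for g
    using coset_subset_iff[OF assms, of "V #> g" "U #> g"] coset_mono[OF assms(3)] that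
    by (simp add: coset_in_Mod)
  show ?thesis
    by (rule homI) (auto simp: carrier_Mod normal.rcos_sum normal assms proj)
qed

lemma in_carrier_iff:
  "x \<in> carrier \<Lambda> \<longleftrightarrow> x \<in> extensional \<U> \<and> (\<forall>U\<in>\<U>. x U \<in> extensional (carrier (G Mod U))) \<and>
     (\<forall>U\<in>\<U>. \<forall>V\<in>\<U>. V \<subseteq> U \<longrightarrow> (\<forall>c\<in>carrier (G Mod U).
        x U c = (\<Sum>e | e \<in> carrier (G Mod V) \<and> U #> rep e = c. x V e)))"
proof -
  have "{e \<in> carrier (G Mod V). e \<subseteq> c} = {e \<in> carrier (G Mod V). U #> rep e = c}"
    if "U \<in> \<U>" "V \<in> \<U>" "V \<subseteq> U" "c \<in> carrier (G Mod U)" for U V c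
    using coset_subset_iff[OF that(1-3) _ that(4)] by blast
  then show ?thesis
    by (auto simp: completed_group_algebra_def cga_carrier_def PiE_def Pi_def)
qed

lemma in_carrierI:
  assumes "x \<in> extensional \<U>" "\<And>U. U \<in> \<U> \<Longrightarrow> x U \<in> extensional (carrier (G Mod U))"
    and "\<And>U V c. U \<in> \<U> \<Longrightarrow> V \<in> \<U> \<Longrightarrow> V \<subseteq> U \<Longrightarrow> c \<in> carrier (G Mod U) \<Longrightarrow>
      x U c = (\<Sum>e | e \<in> carrier (G Mod V) \<and> U #> rep e = c. x V e)"
  shows "x \<in> carrier \<Lambda>"
  unfolding in_carrier_iff using assms by blast

lemma \<Lambda>_simps:
  "x \<oplus>\<^bsub>\<Lambda>\<^esub> y = (\<lambda>U\<in>\<U>. x U \<oplus>\<^bsub>group_algebra (G Mod U)\<^esub> y U)"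
  "x \<otimes>\<^bsub>\<Lambda>\<^esub> y = (\<lambda>U\<in>\<U>. x U \<otimes>\<^bsub>group_algebra (G Mod U)\<^esub> y U)"
  "\<zero>\<^bsub>\<Lambda>\<^esub> = (\<lambda>U\<in>\<U>. \<zero>\<^bsub>group_algebra (G Mod U)\<^esub>)"
  "\<one>\<^bsub>\<Lambda>\<^esub> = (\<lambda>U\<in>\<U>. \<one>\<^bsub>group_algebra (G Mod U)\<^esub>)"
  by (simp_all add: completed_group_algebra_def)

lemma component_closed: "x \<in> carrier \<Lambda> \<Longrightarrow> U \<in> \<U> \<Longrightarrow> x U \<in> extensional (carrier (G Mod U))"
  by (simp add: in_carrier_iff)

lemma compatible:
  "x \<in> carrier \<Lambda> \<Longrightarrow> U \<in> \<U> \<Longrightarrow> V \<in> \<U> \<Longrightarrow> V \<subseteq> U \<Longrightarrow> c \<in> carrier (G Mod U) \<Longrightarrow>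
     x U c = (\<Sum>e | e \<in> carrier (G Mod V) \<and> U #> rep e = c. x V e)"
  unfolding in_carrier_iff by blast

lemma \<Lambda>_eqI:
  assumes "x \<in> carrier \<Lambda>" "y \<in> carrier \<Lambda>" "\<And>U. U \<in> \<U> \<Longrightarrow> x U = y U"
  shows "x = y"
  using assms by (auto simp: in_carrier_iff intro: extensionalityI)

text \<open>The point mass \<open>a\<close> at \<open>g\<close>, that is, the group element
  \<open>g\<close> with coefficient \<open>a\<close>.\<close>

definition single :: "'g \<Rightarrow> z2adic \<Rightarrow> 'g cga" where
  "single g a = (\<lambda>U\<in>\<U>. \<lambda>c\<in>carrier (G Mod U). if c = U #> g then a else 0)"

lemma single_closed:
  assumes "g \<in> carrier G"
  shows "single g a \<in> carrier \<Lambda>"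
proof (rule in_carrierI)
  fix U V c assume UV: "U \<in> \<U>" "V \<in> \<U>" "V \<subseteq> U" and c: "c \<in> carrier (G Mod U)"
  have g: "U #> rep (V #> g) = U #> g"
    using coset_subset_iff[OF UV, of "V #> g" "U #> g"] coset_mono[OF UV(3)] assms
    by (simp add: coset_in_Mod)
  have "(\<Sum>e | e \<in> carrier (G Mod V) \<and> U #> rep e = c. single g a V e) =
      (\<Sum>e | e \<in> carrier (G Mod V) \<and> U #> rep e = c. if e = V #> g then a else 0)"
    using UV by (intro sum.cong) (auto simp: single_def)
  also have "\<dots> = (if U #> g = c then a else 0)"
    using finite_index[OF UV(2)] g assms by (simp add: sum.delta coset_in_Mod)
  finally show "single g a U c = (\<Sum>e | e \<in> carrier (G Mod V) \<and> U #> rep e = c. single g a V e)"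
    using UV c by (auto simp: single_def)
qed (auto simp: single_def)

lemma one_eq_single: "\<one>\<^bsub>\<Lambda>\<^esub> = single \<one> 1"
  by (auto simp: \<Lambda>_simps single_def one_Mod coset_one intro!: restrict_ext)

lemma zero_eq_single: "\<zero>\<^bsub>\<Lambda>\<^esub> = single \<one> 0"
  by (auto simp: \<Lambda>_simps single_def intro!: restrict_ext)

lemma add_closed: "x \<in> carrier \<Lambda> \<Longrightarrow> y \<in> carrier \<Lambda> \<Longrightarrow> x \<oplus>\<^bsub>\<Lambda>\<^esub> y \<in> carrier \<Lambda>"
proof (rule in_carrierI)
  fix U V c assume UV: "U \<in> \<U>" "V \<in> \<U>" "V \<subseteq> U" and c: "c \<in> carrier (G Mod U)"
  assume "x \<in> carrier \<Lambda>" "y \<in> carrier \<Lambda>"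
  then show "(x \<oplus>\<^bsub>\<Lambda>\<^esub> y) U c = (\<Sum>e | e \<in> carrier (G Mod V) \<and> U #> rep e = c. (x \<oplus>\<^bsub>\<Lambda>\<^esub> y) V e)"
    using UV c by (simp add: \<Lambda>_simps sum.distrib compatible[OF _ UV c])
qed (auto simp: \<Lambda>_simps)

lemma uminus_closed:
  assumes "x \<in> carrier \<Lambda>"
  shows "(\<lambda>U\<in>\<U>. \<lambda>c\<in>carrier (G Mod U). - x U c) \<in> carrier \<Lambda>"
proof (rule in_carrierI)
  fix U V c assume UV: "U \<in> \<U>" "V \<in> \<U>" "V \<subseteq> U" and c: "c \<in> carrier (G Mod U)"
  then show "(\<lambda>U\<in>\<U>. \<lambda>c\<in>carrier (G Mod U). - x U c) U c =
      (\<Sum>e | e \<in> carrier (G Mod V) \<and> U #> rep e = c. (\<lambda>U\<in>\<U>. \<lambda>c\<in>carrier (G Mod U). - x U c) V e)"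
    by (simp add: sum_negf compatible[OF assms UV c])
qed auto

lemma mult_closed:
  assumes "x \<in> carrier \<Lambda>" "y \<in> carrier \<Lambda>"
  shows "x \<otimes>\<^bsub>\<Lambda>\<^esub> y \<in> carrier \<Lambda>"
proof (rule in_carrierI)
  fix U V c assume UV: "U \<in> \<U>" "V \<in> \<U>" "V \<subseteq> U" and c: "c \<in> carrier (G Mod U)"
  have "(\<Sum>e | e \<in> carrier (G Mod V) \<and> U #> rep e = c. (x V \<otimes>\<^bsub>group_algebra (G Mod V)\<^esub> y V) e) =
      (x U \<otimes>\<^bsub>group_algebra (G Mod U)\<^esub> y U) c"
    using comm_group_Mod UV finite_index proj_hom[OF UV] c
    by (intro group_algebra_mult_fibres compatible[OF assms(1) UV] compatible[OF assms(2) UV])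
      (auto simp: comm_group_def)
  then show "(x \<otimes>\<^bsub>\<Lambda>\<^esub> y) U c = (\<Sum>e | e \<in> carrier (G Mod V) \<and> U #> rep e = c. (x \<otimes>\<^bsub>\<Lambda>\<^esub> y) V e)"
    using UV by (simp add: \<Lambda>_simps(2))
qed (auto simp: \<Lambda>_simps)

lemma cring_group_algebra_Mod: "U \<in> \<U> \<Longrightarrow> cring (group_algebra (G Mod U))"
  by (rule cring_group_algebra[OF comm_group_Mod finite_index])

lemma cring_\<Lambda>: "cring \<Lambda>"
proof (rule cringI)
  note component = component_closed[folded group_algebra_simps(1)]
  show "abelian_group \<Lambda>"
  proof (rule abelian_groupI)
    fix x assume x: "x \<in> carrier \<Lambda>"
    from uminus_closed[OF x] show "\<exists>y\<in>carrier \<Lambda>. y \<oplus>\<^bsub>\<Lambda>\<^esub> x = \<zero>\<^bsub>\<Lambda>\<^esub>"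
      by (rule bexI[rotated]) (auto simp: \<Lambda>_simps fun_eq_iff)
  next
    fix x assume x: "x \<in> carrier \<Lambda>"
    show "\<zero>\<^bsub>\<Lambda>\<^esub> \<oplus>\<^bsub>\<Lambda>\<^esub> x = x"
    proof (rule \<Lambda>_eqI)
      fix U assume "U \<in> \<U>"
      then show "(\<zero>\<^bsub>\<Lambda>\<^esub> \<oplus>\<^bsub>\<Lambda>\<^esub> x) U = x U"
        using component_closed[OF x] by (auto simp: \<Lambda>_simps extensional_def fun_eq_iff)
    qed (simp_all only: x add_closed zero_eq_single single_closed one_closed)
  next
    show "\<zero>\<^bsub>\<Lambda>\<^esub> \<in> carrier \<Lambda>"
      by (simp add: zero_eq_single single_closed)
  next
    fix x y assume "x \<in> carrier \<Lambda>" "y \<in> carrier \<Lambda>"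
    then show "x \<oplus>\<^bsub>\<Lambda>\<^esub> y \<in> carrier \<Lambda>" by (rule add_closed)
  qed (auto simp: \<Lambda>_simps algebra_simps intro!: restrict_ext)
  show "comm_monoid \<Lambda>"
  proof (rule comm_monoidI)
    show "\<one>\<^bsub>\<Lambda>\<^esub> \<in> carrier \<Lambda>"
      by (simp add: one_eq_single single_closed)
    then show "\<one>\<^bsub>\<Lambda>\<^esub> \<otimes>\<^bsub>\<Lambda>\<^esub> x = x" if x: "x \<in> carrier \<Lambda>" for x
    proof (intro \<Lambda>_eqI mult_closed x)
      fix U assume U: "U \<in> \<U>"
      interpret A: cring "group_algebra (G Mod U)" by (rule cring_group_algebra_Mod[OF U])
      show "(\<one>\<^bsub>\<Lambda>\<^esub> \<otimes>\<^bsub>\<Lambda>\<^esub> x) U = x U"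
        using U A.l_one[OF component[OF x U]] by (simp only: \<Lambda>_simps restrict_apply' if_True)
    qed
  next
    fix x y z assume x: "x \<in> carrier \<Lambda>" and y: "y \<in> carrier \<Lambda>" and z: "z \<in> carrier \<Lambda>"
    show "x \<otimes>\<^bsub>\<Lambda>\<^esub> y \<otimes>\<^bsub>\<Lambda>\<^esub> z = x \<otimes>\<^bsub>\<Lambda>\<^esub> (y \<otimes>\<^bsub>\<Lambda>\<^esub> z)"
    proof (intro \<Lambda>_eqI mult_closed x y z)
      fix U assume U: "U \<in> \<U>"
      interpret A: cring "group_algebra (G Mod U)" by (rule cring_group_algebra_Mod[OF U])
      show "(x \<otimes>\<^bsub>\<Lambda>\<^esub> y \<otimes>\<^bsub>\<Lambda>\<^esub> z) U = (x \<otimes>\<^bsub>\<Lambda>\<^esub> (y \<otimes>\<^bsub>\<Lambda>\<^esub> z)) U"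
        using U A.m_assoc[OF component[OF x U] component[OF y U] component[OF z U]]
        by (simp only: \<Lambda>_simps restrict_apply' if_True)
    qed
  next
    fix x y assume x: "x \<in> carrier \<Lambda>" and y: "y \<in> carrier \<Lambda>"
    show "x \<otimes>\<^bsub>\<Lambda>\<^esub> y = y \<otimes>\<^bsub>\<Lambda>\<^esub> x"
    proof (intro \<Lambda>_eqI mult_closed x y)
      fix U assume U: "U \<in> \<U>"
      interpret A: cring "group_algebra (G Mod U)" by (rule cring_group_algebra_Mod[OF U])
      show "(x \<otimes>\<^bsub>\<Lambda>\<^esub> y) U = (y \<otimes>\<^bsub>\<Lambda>\<^esub> x) U"
        using U A.m_comm[OF component[OF x U] component[OF y U]]
        by (simp only: \<Lambda>_simps restrict_apply' if_True)
    qed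
  qed (rule mult_closed)
  fix x y z assume x: "x \<in> carrier \<Lambda>" and y: "y \<in> carrier \<Lambda>" and z: "z \<in> carrier \<Lambda>"
  show "(x \<oplus>\<^bsub>\<Lambda>\<^esub> y) \<otimes>\<^bsub>\<Lambda>\<^esub> z = x \<otimes>\<^bsub>\<Lambda>\<^esub> z \<oplus>\<^bsub>\<Lambda>\<^esub> y \<otimes>\<^bsub>\<Lambda>\<^esub> z"
  proof (intro \<Lambda>_eqI mult_closed add_closed x y z)
    fix U assume U: "U \<in> \<U>"
    interpret A: cring "group_algebra (G Mod U)" by (rule cring_group_algebra_Mod[OF U])
    show "((x \<oplus>\<^bsub>\<Lambda>\<^esub> y) \<otimes>\<^bsub>\<Lambda>\<^esub> z) U = (x \<otimes>\<^bsub>\<Lambda>\<^esub> z \<oplus>\<^bsub>\<Lambda>\<^esub> y \<otimes>\<^bsub>\<Lambda>\<^esub> z) U"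
      using U A.l_distr[OF component[OF x U] component[OF y U] component[OF z U]]
      by (simp only: \<Lambda>_simps restrict_apply' if_True)
  qed
qed

sublocale R: cring \<Lambda> by (rule cring_\<Lambda>)

lemma ring_top: "ring_top \<Lambda> = subtopology
    (product_topology (\<lambda>U. product_topology (\<lambda>_. euclidean) (carrier (G Mod U))) \<U>) (carrier \<Lambda>)"
  by (simp add: completed_group_algebra_def)

lemma topspace_ring_top: "topspace (ring_top \<Lambda>) = carrier \<Lambda>"
proof -
  have "carrier \<Lambda> \<subseteq> topspace (product_topology (\<lambda>U. product_topology (\<lambda>_. euclidean) (carrier (G Mod U))) \<U>)"
    by (auto simp: in_carrier_iff PiE_def Pi_def)
  then show ?thesis
    by (auto simp: ring_top)
qed

lemma continuous_map_into_\<Lambda>: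
  assumes "\<And>w. w \<in> topspace W \<Longrightarrow> f w \<in> carrier \<Lambda>"
    and "\<And>U c. U \<in> \<U> \<Longrightarrow> c \<in> carrier (G Mod U) \<Longrightarrow> continuous_map W euclidean (\<lambda>w. f w U c)"
  shows "continuous_map W (ring_top \<Lambda>) f"
  unfolding ring_top
proof (rule continuous_map_into_subtopology)
  show "continuous_map W (product_topology (\<lambda>U. product_topology (\<lambda>_. euclidean) (carrier (G Mod U))) \<U>) f"
    using assms by (auto simp: continuous_map_componentwise component_closed in_carrier_iff)
qed (use assms(1) in blast)

lemma continuous_map_component:
  assumes "continuous_map W (ring_top \<Lambda>) f" "U \<in> \<U>" "c \<in> carrier (G Mod U)"
  shows "continuous_map W euclidean (\<lambda>w. f w U c)"
proof -
  have "continuous_map W (product_topology (\<lambda>U. product_topology (\<lambda>_. euclidean) (carrier (G Mod U))) \<U>) f"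
    using assms(1) by (simp add: ring_top continuous_map_in_subtopology)
  then have "continuous_map W (product_topology (\<lambda>_. euclidean) (carrier (G Mod U))) (\<lambda>w. f w U)"
    using assms(2) by (simp add: continuous_map_componentwise)
  then show ?thesis
    using assms(3) by (simp add: continuous_map_componentwise)
qed

text \<open>Compatibility is a closed condition on a product of copies of the 2-adic integers, and
  such a product is profinite.\<close>

lemma profinite_space_\<Lambda>: "profinite_space (ring_top \<Lambda>)"
proof -
  let ?X = "product_topology (\<lambda>U. product_topology (\<lambda>_. euclidean :: z2adic topology) (carrier (G Mod U))) \<U>"
  let ?C = "\<lambda>U V c. {x \<in> topspace ?X. V \<subseteq> U \<longrightarrow> x U c = (\<Sum>e | e \<in> carrier (G Mod V) \<and> U #> rep e = c. x V e)}"
  have comp: "continuous_map ?X euclidean (\<lambda>x. x U c)" if "U \<in> \<U>" "c \<in> carrier (G Mod U)" for U c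
    using continuous_map_compose[OF continuous_map_product_projection[OF that(1),
          of "\<lambda>U. product_topology (\<lambda>_. euclidean :: z2adic topology) (carrier (G Mod U))"]
        continuous_map_product_projection[OF that(2)]] by (simp add: o_def)
  have "closedin ?X (?C U V c)" if "U \<in> \<U>" "V \<in> \<U>" "c \<in> carrier (G Mod U)" for U V c
  proof (cases "V \<subseteq> U")
    case True
    have "closedin ?X {x \<in> topspace ?X. x U c = (\<Sum>e | e \<in> carrier (G Mod V) \<and> U #> rep e = c. x V e)}"
      using profinite_space_z2adic that comp unfolding profinite_space_def
      by (intro closedin_continuous_maps_eq[where Y = euclidean] continuous_map_z2adic_sum) auto
    with True show ?thesis by simp
  qed (use closedin_topspace[of ?X] in simp)
  \<comment> \<open>The whole space is inserted so that the family intersected is visibly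
    nonempty.\<close>
  then have "closedin ?X (\<Inter>(insert (topspace ?X) {?C U V c | U V c. U \<in> \<U> \<and> V \<in> \<U> \<and> c \<in> carrier (G Mod U)}))"
    by (intro closedin_Inter) (auto simp del: topspace_product_topology)
  moreover have "carrier \<Lambda> = \<Inter>(insert (topspace ?X) {?C U V c | U V c. U \<in> \<U> \<and> V \<in> \<U> \<and> c \<in> carrier (G Mod U)})"
    (is "_ = ?I")
  proof (intro equalityI subsetI)
    fix x assume x: "x \<in> carrier \<Lambda>"
    then have "x \<in> topspace ?X"
      using topspace_ring_top by (auto simp: ring_top)
    then show "x \<in> ?I"
      using compatible[OF x] by blast
  next
    fix x assume x: "x \<in> ?I"
    show "x \<in> carrier \<Lambda>"
    proof (rule in_carrierI)
      have top: "x \<in> topspace ?X" using x by blast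
      then show "x \<in> extensional \<U>" by (auto simp: PiE_def)
      show "x U \<in> extensional (carrier (G Mod U))" if "U \<in> \<U>" for U
        using top that by (auto simp: PiE_def Pi_def)
    qed (use x in blast)
  qed
  ultimately have "closedin ?X (carrier \<Lambda>)"
    by (rule back_subst[of "closedin ?X", OF _ sym])
  then show ?thesis
    unfolding ring_top
    by (intro profinite_space_subtopology profinite_space_product_topology profinite_space_z2adic)
qed

lemma continuous_map_\<Lambda>_add:
  assumes "continuous_map W (ring_top \<Lambda>) f" "continuous_map W (ring_top \<Lambda>) g"
  shows "continuous_map W (ring_top \<Lambda>) (\<lambda>w. f w \<oplus>\<^bsub>\<Lambda>\<^esub> g w)"
proof (rule continuous_map_into_\<Lambda>)
  show "f w \<oplus>\<^bsub>\<Lambda>\<^esub> g w \<in> carrier \<Lambda>" if "w \<in> topspace W" for w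
    using that assms continuous_map_funspace topspace_ring_top by blast
next
  fix U c assume "U \<in> \<U>" "c \<in> carrier (G Mod U)"
  then show "continuous_map W euclidean (\<lambda>w. (f w \<oplus>\<^bsub>\<Lambda>\<^esub> g w) U c)"
    using continuous_map_component[OF assms(1)] continuous_map_component[OF assms(2)]
    by (simp add: \<Lambda>_simps continuous_map_z2adic_add)
qed

lemma continuous_map_\<Lambda>_mult:
  assumes "continuous_map W (ring_top \<Lambda>) f" "continuous_map W (ring_top \<Lambda>) g"
  shows "continuous_map W (ring_top \<Lambda>) (\<lambda>w. f w \<otimes>\<^bsub>\<Lambda>\<^esub> g w)"
proof (rule continuous_map_into_\<Lambda>)
  show "f w \<otimes>\<^bsub>\<Lambda>\<^esub> g w \<in> carrier \<Lambda>" if "w \<in> topspace W" for w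
    using that assms continuous_map_funspace topspace_ring_top by blast
next
  fix U c assume U: "U \<in> \<U>" "c \<in> carrier (G Mod U)"
  interpret K: comm_group "G Mod U" using comm_group_Mod[OF U(1)] .
  show "continuous_map W euclidean (\<lambda>w. (f w \<otimes>\<^bsub>\<Lambda>\<^esub> g w) U c)"
    using U by (simp add: \<Lambda>_simps del: mult_FactGroup)
      (intro continuous_map_z2adic_sum continuous_map_z2adic_mult continuous_map_component[OF assms(1)]
        continuous_map_component[OF assms(2)], auto simp del: mult_FactGroup)
qed

lemma continuous_map_\<Lambda>_minus:
  assumes "continuous_map W (ring_top \<Lambda>) f"
  shows "continuous_map W (ring_top \<Lambda>) (\<lambda>w. \<ominus>\<^bsub>\<Lambda>\<^esub> f w)"
proof -
  have f: "f w \<in> carrier \<Lambda>" if "w \<in> topspace W" for w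
    using that assms continuous_map_funspace topspace_ring_top by blast
  have "continuous_map W (ring_top \<Lambda>) (\<lambda>w. (\<ominus>\<^bsub>\<Lambda>\<^esub> \<one>\<^bsub>\<Lambda>\<^esub>) \<otimes>\<^bsub>\<Lambda>\<^esub> f w)"
    using assms by (intro continuous_map_\<Lambda>_mult) (simp_all add: topspace_ring_top)
  then show ?thesis
    by (rule continuous_map_eq) (simp add: f R.l_minus)
qed

end

section \<open>Characters and the modules they define\<close>

text \<open>\<open>profinite_module\<close> expects a scalar ring with a topology; with this one the
  coefficient modules can be studied before the group acts on them.\<close>

definition Z2_top_ring :: "z2adic top_ring" where
  "Z2_top_ring = \<lparr>carrier = UNIV, monoid.mult = (*), one = 1, ring.zero = 0, add = (+), ring_top = euclidean\<rparr>"

lemma Z2_top_ring_simps [simp]: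
  "carrier Z2_top_ring = UNIV" "a \<otimes>\<^bsub>Z2_top_ring\<^esub> b = a * b" "\<one>\<^bsub>Z2_top_ring\<^esub> = 1"
  "\<zero>\<^bsub>Z2_top_ring\<^esub> = 0" "a \<oplus>\<^bsub>Z2_top_ring\<^esub> b = a + b" "ring_top Z2_top_ring = euclidean"
  by (simp_all add: Z2_top_ring_def)

lemma cring_Z2_top_ring: "cring Z2_top_ring"
proof (rule cringI)
  show "abelian_group Z2_top_ring"
  proof (rule abelian_groupI)
    show "\<exists>y\<in>carrier Z2_top_ring. y \<oplus>\<^bsub>Z2_top_ring\<^esub> x = \<zero>\<^bsub>Z2_top_ring\<^esub>" for x
      by (rule bexI[of _ "- x"]) auto
  qed (auto simp: algebra_simps)
  show "comm_monoid Z2_top_ring"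
    by (rule comm_monoidI) (auto simp: algebra_simps)
qed (auto simp: algebra_simps)

context completed_abelian_group_algebra
begin

text \<open>The Riemann sum of \<open>F\<close> for the measure \<open>x\<close> at level
  \<open>U\<close>.\<close>

definition integral :: "'g set \<Rightarrow> 'g cga \<Rightarrow> ('g \<Rightarrow> z2adic) \<Rightarrow> z2adic" where
  "integral U x F = (\<Sum>c\<in>carrier (G Mod U). x U c * F (rep c))"

lemma eventually_open_normal_filter:
  "eventually P (open_normal_filter G T) \<longleftrightarrow> (\<exists>U\<in>\<U>. \<forall>V\<in>\<U>. V \<subseteq> U \<longrightarrow> P V)"
  unfolding open_normal_filter_def
proof (subst eventually_INF_base)
  show "\<U> \<noteq> {}" using carrier_open by blast
  fix U V assume "U \<in> \<U>" "V \<in> \<U>"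
  then show "\<exists>W\<in>\<U>. principal {V \<in> \<U>. V \<subseteq> W} \<le>
      inf (principal {V \<in> \<U>. V \<subseteq> U}) (principal {W \<in> \<U>. W \<subseteq> V})"
    by (intro bexI[of _ "U \<inter> V"] open_subgroups_Int) auto
qed (auto simp: eventually_principal)

lemma open_normal_filter_nontrivial: "\<not> trivial_limit (open_normal_filter G T)"
  unfolding trivial_limit_def eventually_open_normal_filter by blast

end

text \<open>\<open>character_cont\<close> is uniform continuity: modulo \<open>2 ^ n\<close> the
  character is constant on the cosets of one open subgroup. This is what makes Riemann sums
  stabilise modulo \<open>2 ^ n\<close>.\<close>

locale continuous_character = completed_abelian_group_algebra +
  fixes \<phi> :: "'a \<Rightarrow> z2adic"
  assumes character_mult: "g \<in> carrier G \<Longrightarrow> h \<in> carrier G \<Longrightarrow> \<phi> (g \<otimes> h) = \<phi> g * \<phi> h"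
    and character_one: "\<phi> \<one> = 1"
    and character_cont: "\<exists>U\<in>\<U>. \<forall>g\<in>carrier G. \<forall>h\<in>U #> g. residue (\<phi> h) n = residue (\<phi> g) n"
begin

definition level :: "nat \<Rightarrow> 'a set" where
  "level n = (SOME U. U \<in> \<U> \<and> (\<forall>g\<in>carrier G. \<forall>h\<in>U #> g. residue (\<phi> h) n = residue (\<phi> g) n))"

lemma level: "level n \<in> \<U>"
  and residue_level: "g \<in> carrier G \<Longrightarrow> h \<in> level n #> g \<Longrightarrow> residue (\<phi> h) n = residue (\<phi> g) n"
proof -
  have "\<exists>U. U \<in> \<U> \<and> (\<forall>g\<in>carrier G. \<forall>h\<in>U #> g. residue (\<phi> h) n = residue (\<phi> g) n)"
    using character_cont by blast
  from someI_ex[OF this, folded level_def] show "level n \<in> \<U>"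
    and "g \<in> carrier G \<Longrightarrow> h \<in> level n #> g \<Longrightarrow> residue (\<phi> h) n = residue (\<phi> g) n"
    by blast+
qed

text \<open>Refining the cosets only replaces representatives by others in the same coset of
  \<open>level n\<close>, where \<open>\<phi>\<close> does not change modulo
  \<open>2 ^ n\<close>.\<close>

lemma residue_integral_mono:
  assumes x: "x \<in> carrier \<Lambda>" and V: "V \<in> \<U>" "V \<subseteq> level n"
  shows "residue (integral V x \<phi>) n = residue (integral (level n) x \<phi>) n"
proof -
  let ?p = "\<lambda>e. level n #> rep e"
  note UV = level[of n] V
  have "integral (level n) x \<phi> =
      (\<Sum>u\<in>carrier (G Mod level n). (\<Sum>e | e \<in> carrier (G Mod V) \<and> ?p e = u. x V e) * \<phi> (rep u))"
    unfolding integral_def by (intro sum.cong refl arg_cong2[where f = "(*)"] compatible[OF x UV])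
  also have "\<dots> = (\<Sum>e\<in>carrier (G Mod V). x V e * \<phi> (rep (?p e)))"
    using finite_index UV by (intro sum_fibres) (auto simp: coset_in_Mod rep)
  finally show ?thesis
    unfolding integral_def
  proof (simp only:, intro residue_cong_sum residue_cong_mult refl)
    fix e assume e: "e \<in> carrier (G Mod V)"
    show "residue (\<phi> (rep e)) n = residue (\<phi> (rep (?p e))) n"
      using residue_level[of "rep e" "rep (?p e)" n] rep[OF V(1) e] rep(2)[OF level coset_in_Mod] by simp
  qed
qed

text \<open>The integral of \<open>\<phi>\<close> against \<open>x\<close> as a limit of Riemann
  sums, whose residues modulo \<open>2 ^ n\<close> are constant from \<open>level n\<close> on. It
  extends the character to a continuous ring homomorphism from the algebra to the 2-adic
  integers.\<close>

definition eval :: "'a cga \<Rightarrow> z2adic" where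
  "eval x = Abs_z2adic (\<lambda>n. residue (integral (level n) x \<phi>) n)"

lemma residue_eval:
  assumes x: "x \<in> carrier \<Lambda>" and V: "V \<in> \<U>" "V \<subseteq> level n"
  shows "residue (eval x) n = residue (integral V x \<phi>) n"
proof -
  have "residue (integral (level n) x \<phi>) n mod 2 ^ m = residue (integral (level m) x \<phi>) m" if "m \<le> n" for m n
  proof -
    \<comment> \<open>The chosen levels need not be nested, so two of them are compared on their
      intersection.\<close>
    have V: "level m \<inter> level n \<in> \<U>" by (intro open_subgroups_Int level)
    have "residue (integral (level n) x \<phi>) n mod 2 ^ m = residue (integral (level m \<inter> level n) x \<phi>) n mod 2 ^ m"
      by (simp only: residue_integral_mono[OF x V Int_lower2])
    also have "\<dots> = residue (integral (level m) x \<phi>) m"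
      by (simp only: residue_mod[OF that] residue_integral_mono[OF x V Int_lower1])
    finally show ?thesis .
  qed
  then have "residue (eval x) n = residue (integral (level n) x \<phi>) n"
    unfolding eval_def by (subst Abs_z2adic_inverse) auto
  then show ?thesis
    using residue_integral_mono[OF assms] by simp
qed

lemma eval_eqI:
  assumes "x \<in> carrier \<Lambda>" "\<And>n. residue (integral (level n) x \<phi>) n = residue a n"
  shows "eval x = a"
  by (rule z2adic_eqI) (simp add: residue_eval[OF assms(1) level order_refl] assms(2))

lemma eval_add:
  assumes "x \<in> carrier \<Lambda>" "y \<in> carrier \<Lambda>"
  shows "eval (x \<oplus>\<^bsub>\<Lambda>\<^esub> y) = eval x + eval y"
proof (rule eval_eqI[OF add_closed[OF assms]])
  fix n
  have "integral (level n) (x \<oplus>\<^bsub>\<Lambda>\<^esub> y) \<phi> = integral (level n) x \<phi> + integral (level n) y \<phi>"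
    by (simp add: integral_def \<Lambda>_simps level sum.distrib distrib_right)
  then show "residue (integral (level n) (x \<oplus>\<^bsub>\<Lambda>\<^esub> y) \<phi>) n = residue (eval x + eval y) n"
    by (simp add: plus_z2adic.rep_eq residue_eval[OF _ level order_refl] assms)
qed

text \<open>A representative of a product of cosets need not be the product of the representatives,
  but the two have the same character value modulo \<open>2 ^ n\<close>. So multiplicativity holds
  modulo each \<open>2 ^ n\<close>, and hence exactly.\<close>

lemma eval_mult:
  assumes "x \<in> carrier \<Lambda>" "y \<in> carrier \<Lambda>"
  shows "eval (x \<otimes>\<^bsub>\<Lambda>\<^esub> y) = eval x * eval y"
proof (rule eval_eqI[OF mult_closed[OF assms]])
  fix n
  let ?K = "G Mod level n"
  interpret K: comm_group ?K by (rule comm_group_Mod[OF level])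
  have "integral (level n) (x \<otimes>\<^bsub>\<Lambda>\<^esub> y) \<phi> =
      (\<Sum>z\<in>carrier ?K. (x (level n) \<otimes>\<^bsub>group_algebra ?K\<^esub> y (level n)) z * \<phi> (rep z))"
    by (simp only: integral_def \<Lambda>_simps level restrict_apply' if_True)
  also have "\<dots> = (\<Sum>a\<in>carrier ?K. \<Sum>b\<in>carrier ?K. x (level n) a * y (level n) b * \<phi> (rep (a \<otimes>\<^bsub>?K\<^esub> b)))"
    by (rule group_algebra_integral_mult) (rule K.is_group)
  finally have "residue (integral (level n) (x \<otimes>\<^bsub>\<Lambda>\<^esub> y) \<phi>) n =
      residue (\<Sum>a\<in>carrier ?K. \<Sum>b\<in>carrier ?K. x (level n) a * y (level n) b * (\<phi> (rep a) * \<phi> (rep b))) n"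
  proof (simp only:, intro residue_cong_sum residue_cong_mult[OF refl])
    fix a b assume ab: "a \<in> carrier ?K" "b \<in> carrier ?K"
    note a = rep[OF level ab(1)] and b = rep[OF level ab(2)]
    have "a \<otimes>\<^bsub>?K\<^esub> b = level n #> (rep a \<otimes> rep b)"
      using mult_coset[OF level a(1) b(1), of n] a(3) b(3) by simp
    moreover have "rep (a \<otimes>\<^bsub>?K\<^esub> b) \<in> a \<otimes>\<^bsub>?K\<^esub> b"
      using rep(2)[OF level K.m_closed[OF ab]] .
    ultimately show "residue (\<phi> (rep (a \<otimes>\<^bsub>?K\<^esub> b))) n = residue (\<phi> (rep a) * \<phi> (rep b)) n"
      using residue_level[of "rep a \<otimes> rep b" _ n] a(1) b(1) by (simp add: character_mult del: mult_FactGroup)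
  qed
  also have "(\<Sum>a\<in>carrier ?K. \<Sum>b\<in>carrier ?K. x (level n) a * y (level n) b * (\<phi> (rep a) * \<phi> (rep b))) =
      integral (level n) x \<phi> * integral (level n) y \<phi>"
    by (simp add: integral_def sum_product mult_ac)
  finally show "residue (integral (level n) (x \<otimes>\<^bsub>\<Lambda>\<^esub> y) \<phi>) n = residue (eval x * eval y) n"
    by (simp only: times_z2adic.rep_eq residue_eval[OF assms(1) level order_refl] residue_eval[OF assms(2) level order_refl])
qed

lemma eval_single:
  assumes "g \<in> carrier G"
  shows "eval (single g a) = a * \<phi> g"
proof (rule eval_eqI[OF single_closed[OF assms]])
  fix n
  have "integral (level n) (single g a) \<phi> =
      (\<Sum>c\<in>carrier (G Mod level n). if c = level n #> g then a * \<phi> (rep c) else 0)"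
    unfolding integral_def by (intro sum.cong) (auto simp: single_def level)
  also have "\<dots> = a * \<phi> (rep (level n #> g))"
    using finite_index[OF level] assms by (simp add: coset_in_Mod)
  finally have "integral (level n) (single g a) \<phi> = a * \<phi> (rep (level n #> g))" .
  moreover have "rep (level n #> g) \<in> level n #> g"
    using rep(2)[OF level coset_in_Mod[OF assms]] .
  ultimately show "residue (integral (level n) (single g a) \<phi>) n = residue (a * \<phi> g) n"
    using residue_level[OF assms] by (simp only:) (intro residue_cong_mult refl)
qed

lemma eval_one: "eval \<one>\<^bsub>\<Lambda>\<^esub> = 1"
  by (simp add: one_eq_single eval_single character_one)

lemma continuous_map_eval: "continuous_map (ring_top \<Lambda>) euclidean eval"
  unfolding continuous_map_z2adic_iff
proof
  fix n
  have "continuous_map (ring_top \<Lambda>) euclidean (\<lambda>x. x (level n) c)" if "c \<in> carrier (G Mod level n)" for c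
    by (rule continuous_map_component[OF _ level that]) simp
  then have "continuous_map (ring_top \<Lambda>) euclidean (\<lambda>x. integral (level n) x \<phi>)"
    unfolding integral_def by (intro continuous_map_z2adic_sum continuous_map_z2adic_mult) auto
  then have "continuous_map (ring_top \<Lambda>) (discrete_topology UNIV) (\<lambda>x. residue (integral (level n) x \<phi>) n)"
    by (simp add: continuous_map_z2adic_iff)
  then show "continuous_map (ring_top \<Lambda>) (discrete_topology UNIV) (\<lambda>x. residue (eval x) n)"
    by (rule continuous_map_eq) (simp add: topspace_ring_top residue_eval[OF _ level order_refl])
qed

lemma limitin_integral:
  assumes "x \<in> carrier \<Lambda>"
  shows "limitin euclidean (\<lambda>U. integral U x \<phi>) (eval x) (open_normal_filter G T)"
  unfolding limitin_def eventually_open_normal_filter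
proof (intro conjI allI impI)
  fix S assume "openin euclidean S \<and> eval x \<in> S"
  then obtain n where "\<And>y. residue y n = residue (eval x) n \<Longrightarrow> y \<in> S"
    unfolding open_openin[symmetric] open_z2adic_def by blast
  then show "\<exists>U\<in>\<U>. \<forall>V\<in>\<U>. V \<subseteq> U \<longrightarrow> integral V x \<phi> \<in> S"
    using residue_eval[OF assms] level by (intro bexI[of _ "level n"]) auto
qed simp

text \<open>Each finite sum in the definition of the action is a Riemann sum applied to
  \<open>m\<close>. By continuity of scalar multiplication these converge to \<open>eval x\<close>
  applied to \<open>m\<close>, and the limit is unique because the module is Hausdorff and the
  filter is proper.\<close>

lemma smult_cga_module:
  assumes M: "profinite_module Z2_top_ring M"
    and \<rho>: "\<And>g m. g \<in> carrier G \<Longrightarrow> m \<in> carrier M \<Longrightarrow> \<rho> g m = \<phi> g \<odot>\<^bsub>M\<^esub> m"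
    and x: "x \<in> carrier \<Lambda>" and m: "m \<in> carrier M"
  shows "x \<odot>\<^bsub>cga_module G T M \<rho>\<^esub> m = eval x \<odot>\<^bsub>M\<^esub> m"
proof -
  interpret M: module Z2_top_ring M using M by (rule profinite_module_module)
  have fs: "(\<Oplus>\<^bsub>M\<^esub>i\<in>I. a i \<odot>\<^bsub>M\<^esub> m) = sum a I \<odot>\<^bsub>M\<^esub> m" if "finite I" for I :: "'a set set" and a
    using that m by (induction I) (simp_all add: M.smult_l_null[simplified] M.smult_l_distr[simplified, symmetric] Pi_def)
  have eq: "(\<Oplus>\<^bsub>M\<^esub>c\<in>carrier (G Mod U). x U c \<odot>\<^bsub>M\<^esub> \<rho> (SOME g. g \<in> c) m) = integral U x \<phi> \<odot>\<^bsub>M\<^esub> m"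
    if U: "U \<in> \<U>" for U
  proof -
    have "x U c \<odot>\<^bsub>M\<^esub> \<rho> (SOME g. g \<in> c) m = (x U c * \<phi> (rep c)) \<odot>\<^bsub>M\<^esub> m" if "c \<in> carrier (G Mod U)" for c
      using M.smult_assoc1[of "x U c" "\<phi> (rep c)" m] m rep(1)[OF U that] by (simp add: \<rho> flip: rep_def)
    then have "(\<Oplus>\<^bsub>M\<^esub>c\<in>carrier (G Mod U). x U c \<odot>\<^bsub>M\<^esub> \<rho> (SOME g. g \<in> c) m) =
        (\<Oplus>\<^bsub>M\<^esub>c\<in>carrier (G Mod U). (x U c * \<phi> (rep c)) \<odot>\<^bsub>M\<^esub> m)"
      using m by (intro M.finsum_cong') auto
    then show ?thesis
      by (simp add: fs[OF finite_index[OF U]] integral_def)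
  qed
  have "continuous_map euclidean (mod_top M) (\<lambda>a. a \<odot>\<^bsub>M\<^esub> m)"
    using profinite_module_continuous_smult[OF M, of euclidean "\<lambda>a. a" "\<lambda>_. m"] m
    by (simp add: profinite_module_topspace[OF M])
  from continuous_map_limit[OF this limitin_integral[OF x]]
  have "limitin (mod_top M) (\<lambda>U. integral U x \<phi> \<odot>\<^bsub>M\<^esub> m) (eval x \<odot>\<^bsub>M\<^esub> m) (open_normal_filter G T)"
    by (simp add: o_def)
  moreover have "eventually (\<lambda>U. integral U x \<phi> \<odot>\<^bsub>M\<^esub> m =
      (\<Oplus>\<^bsub>M\<^esub>c\<in>carrier (G Mod U). x U c \<odot>\<^bsub>M\<^esub> \<rho> (SOME g. g \<in> c) m)) (open_normal_filter G T)"
    unfolding eventually_open_normal_filter using carrier_open eq by auto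
  ultimately have lim: "limitin (mod_top M) (\<lambda>U. \<Oplus>\<^bsub>M\<^esub>c\<in>carrier (G Mod U). x U c \<odot>\<^bsub>M\<^esub> \<rho> (SOME g. g \<in> c) m)
      (eval x \<odot>\<^bsub>M\<^esub> m) (open_normal_filter G T)"
    by (rule limitin_transform_eventually[rotated])
  moreover have "Hausdorff_space (mod_top M)"
    using profinite_module_space[OF M] by (simp add: profinite_space_def)
  ultimately have "(THE y. limitin (mod_top M)
      (\<lambda>U. \<Oplus>\<^bsub>M\<^esub>c\<in>carrier (G Mod U). x U c \<odot>\<^bsub>M\<^esub> \<rho> (SOME g. g \<in> c) m) y (open_normal_filter G T)) = eval x \<odot>\<^bsub>M\<^esub> m"
    by (intro the_equality limitin_Hausdorff_unique[OF _ lim open_normal_filter_nontrivial])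
  then show ?thesis
    by (simp add: cga_module_def)
qed

text \<open>By \<open>smult_cga_module\<close> this is restriction of scalars along the continuous
  ring homomorphism \<open>eval\<close>.\<close>

lemma profinite_cga_module:
  assumes M: "profinite_module Z2_top_ring M"
    and \<rho>: "\<And>g m. g \<in> carrier G \<Longrightarrow> m \<in> carrier M \<Longrightarrow> \<rho> g m = \<phi> g \<odot>\<^bsub>M\<^esub> m"
  shows "profinite_module \<Lambda> (cga_module G T M \<rho>)"
proof -
  let ?M = "cga_module G T M \<rho>"
  interpret M: module Z2_top_ring M using M by (rule profinite_module_module)
  have [simp]: "carrier ?M = carrier M" "add ?M = add M" "\<zero>\<^bsub>?M\<^esub> = \<zero>\<^bsub>M\<^esub>" "mod_top ?M = mod_top M"
    by (simp_all add: cga_module_def)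
  have minus: "a_inv ?M = a_inv M"
    by (simp add: a_inv_def m_inv_def fun_eq_iff)
  note smult = smult_cga_module[OF M \<rho>]
  have "abelian_group ?M"
  proof (rule abelian_groupI)
    show "\<exists>y\<in>carrier ?M. y \<oplus>\<^bsub>?M\<^esub> x = \<zero>\<^bsub>?M\<^esub>" if "x \<in> carrier ?M" for x
      using that by (intro bexI[of _ "\<ominus>\<^bsub>M\<^esub> x"]) (auto simp: M.l_neg)
  qed (auto simp: M.a_ac)
  then have "module \<Lambda> ?M"
    by (rule moduleI[OF cring_\<Lambda>])
      (auto simp: smult eval_add eval_mult eval_one add_closed mult_closed M.smult_l_distr[simplified]
        M.smult_r_distr M.smult_assoc1[simplified] M.smult_one[simplified])
  moreover have "continuous_map (prod_topology (ring_top \<Lambda>) (mod_top M)) euclidean (\<lambda>z. eval (fst z))"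
    using continuous_map_compose[OF continuous_map_fst continuous_map_eval] by (simp add: o_def)
  then have "continuous_map (prod_topology (ring_top \<Lambda>) (mod_top M)) (mod_top M) (\<lambda>z. eval (fst z) \<odot>\<^bsub>M\<^esub> snd z)"
    by (intro profinite_module_continuous_smult[OF M] continuous_map_snd) simp
  then have "continuous_map (prod_topology (ring_top \<Lambda>) (mod_top M)) (mod_top M) (\<lambda>(r, x). r \<odot>\<^bsub>?M\<^esub> x)"
    by (rule continuous_map_eq) (auto simp: smult topspace_ring_top profinite_module_topspace[OF M])
  ultimately show ?thesis
    using M by (auto simp: profinite_module_def minus)
qed

end

section \<open>Point masses and equations solved at finite levels\<close>

context completed_abelian_group_algebra
begin

lemma single_add: "single g (a + b) = single g a \<oplus>\<^bsub>\<Lambda>\<^esub> single g b"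
  by (auto simp: single_def \<Lambda>_simps intro!: restrict_ext)

lemma single_mult_component:
  assumes g: "g \<in> carrier G" and h: "h \<in> carrier G" and U: "U \<in> \<U>"
  shows "(single g a \<otimes>\<^bsub>\<Lambda>\<^esub> x) U (U #> h) = a * x U (U #> (inv g \<otimes> h))"
proof -
  interpret K: comm_group "G Mod U" by (rule comm_group_Mod[OF U])
  have "(single g a \<otimes>\<^bsub>\<Lambda>\<^esub> x) U (U #> h) =
      (\<Sum>c\<in>carrier (G Mod U). single g a U c * x U (inv\<^bsub>G Mod U\<^esub> c \<otimes>\<^bsub>G Mod U\<^esub> (U #> h)))"
    using U h by (simp add: \<Lambda>_simps coset_in_Mod del: mult_FactGroup)
  also have "\<dots> = (\<Sum>c\<in>carrier (G Mod U). if c = U #> g then a * x U (U #> (inv g \<otimes> h)) else 0)"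
    using U g h mult_coset[OF U, of "inv g" h]
    by (intro sum.cong) (auto simp: single_def inv_coset simp del: mult_FactGroup)
  finally show ?thesis
    using finite_index[OF U] coset_in_Mod[OF g] by simp
qed

lemma single_mult:
  assumes "g \<in> carrier G" "h \<in> carrier G"
  shows "single g a \<otimes>\<^bsub>\<Lambda>\<^esub> single h b = single (g \<otimes> h) (a * b)"
proof (rule \<Lambda>_eqI)
  fix U assume U: "U \<in> \<U>"
  have "(single g a \<otimes>\<^bsub>\<Lambda>\<^esub> single h b) U c = single (g \<otimes> h) (a * b) U c" if c: "c \<in> carrier (G Mod U)" for c
  proof -
    obtain k where k: "k \<in> carrier G" "c = U #> k"
      using c by (auto simp: carrier_Mod)
    interpret K: comm_group "G Mod U" by (rule comm_group_Mod[OF U])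
    have "U #> (inv g \<otimes> k) = U #> h \<longleftrightarrow> U #> k = U #> (g \<otimes> h)"
      using assms k mult_coset[OF U, of "inv g" k] mult_coset[OF U, of g h] inv_coset[OF U, of g]
        K.inv_solve_left[of "U #> g" "U #> h" "U #> k"] coset_in_Mod[of _ U] K.m_closed
      by (metis K.inv_solve_left' inv_closed)
    then show ?thesis
      using U k assms by (simp add: single_mult_component) (simp add: single_def coset_in_Mod)
  qed
  then show "(single g a \<otimes>\<^bsub>\<Lambda>\<^esub> single h b) U = single (g \<otimes> h) (a * b) U"
    using assms U by (intro extensionalityI[of _ "carrier (G Mod U)"] component_closed[OF mult_closed] component_closed
        single_closed) auto
qed (simp_all add: assms mult_closed single_closed)

lemma component_mono:
  assumes "x \<in> carrier \<Lambda>" "y \<in> carrier \<Lambda>" "U \<in> \<U>" "V \<in> \<U>" "V \<subseteq> U" "x V = y V"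
  shows "x U = y U"
proof (rule extensionalityI[of _ "carrier (G Mod U)"])
  fix c assume "c \<in> carrier (G Mod U)"
  then show "x U c = y U c"
    using compatible[OF assms(1,3,4,5)] compatible[OF assms(2,3,4,5)] assms(6) by simp
qed (use component_closed assms in auto)

text \<open>The solutions at level \<open>V n\<close> form nonempty closed sets, decreasing in
  \<open>n\<close> because a component determines all coarser ones. A point of the intersection
  solves the equation, as the \<open>V n\<close> are cofinal. Solutions found at different levels
  may be unrelated to each other.\<close>

lemma solve_by_compactness:
  assumes W: "compact_space W" and f: "continuous_map W (ring_top \<Lambda>) f" and x: "x \<in> carrier \<Lambda>"
    and V: "\<And>n. V n \<in> \<U>" "\<And>n. V (Suc n) \<subseteq> V n" "\<And>U. U \<in> \<U> \<Longrightarrow> \<exists>n. V n \<subseteq> U"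
    and approx: "\<And>n. \<exists>w\<in>topspace W. f w (V n) = x (V n)"
  shows "\<exists>w\<in>topspace W. f w = x"
proof -
  define C where "C n = {w \<in> topspace W. f w (V n) = x (V n)}" for n
  have fw: "f w \<in> carrier \<Lambda>" if "w \<in> topspace W" for w
    using that f continuous_map_funspace topspace_ring_top by blast
  have "closedin W (C n)" for n
  proof -
    have "closedin W {w \<in> topspace W. f w (V n) c = x (V n) c}" if "c \<in> carrier (G Mod V n)" for c
      using profinite_space_z2adic that unfolding profinite_space_def
      by (intro closedin_continuous_maps_eq[where Y = euclidean] continuous_map_component[OF f V(1)]) auto
    then have "closedin W (\<Inter>c\<in>carrier (G Mod V n). {w \<in> topspace W. f w (V n) c = x (V n) c})"
      using coset_in_Mod[OF one_closed, of "V n"] by (intro closedin_INT) auto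
    moreover have "(\<Inter>c\<in>carrier (G Mod V n). {w \<in> topspace W. f w (V n) c = x (V n) c}) = C n"
    proof (intro equalityI subsetI)
      fix w assume w: "w \<in> (\<Inter>c\<in>carrier (G Mod V n). {w \<in> topspace W. f w (V n) c = x (V n) c})"
      then have "w \<in> topspace W" using coset_in_Mod[OF one_closed, of "V n"] by blast
      moreover from this have "f w (V n) = x (V n)"
        using w by (intro extensionalityI[of _ "carrier (G Mod V n)"] component_closed fw x V(1)) auto
      ultimately show "w \<in> C n" by (simp add: C_def)
    qed (auto simp: C_def)
    ultimately show ?thesis by simp
  qed
  moreover have "C n \<noteq> {}" for n
    using approx by (auto simp: C_def)
  moreover have "decseq C"
  proof (rule decseq_SucI, rule subsetI)
    fix n w assume "w \<in> C (Suc n)"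
    then show "w \<in> C n"
      using component_mono[OF fw x V(1) V(1) V(2)] by (auto simp: C_def)
  qed
  ultimately have "(\<Inter>n. C n) \<noteq> {}"
    by (rule compact_space_imp_nest[OF W])
  then obtain w where w: "\<And>n. w \<in> C n" by blast
  then have wW: "w \<in> topspace W" by (auto simp: C_def)
  have "f w = x"
  proof (rule \<Lambda>_eqI[OF fw[OF wW] x])
    fix U assume U: "U \<in> \<U>"
    then obtain n where "V n \<subseteq> U" using V(3) by blast
    then show "f w U = x U"
      using component_mono[OF fw[OF wW] x U V(1)] w[of n] by (simp add: C_def)
  qed
  with wW show ?thesis by blast
qed

text \<open>The point masses at the chosen representatives are 1 modulo \<open>I\<close>, so placing
  mass \<open>F c\<close> at the representative of each coset \<open>c\<close> gives an element
  congruent to its total mass. For total mass 0 it lies in \<open>I\<close>, which is how the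
  augmentation ideal is reached.\<close>

lemma approximate_modulo_ideal:
  assumes U: "U \<in> \<U>" and I: "I \<subseteq> carrier \<Lambda>" "\<zero>\<^bsub>\<Lambda>\<^esub> \<in> I"
    and I_add: "\<And>x y. x \<in> I \<Longrightarrow> y \<in> I \<Longrightarrow> x \<oplus>\<^bsub>\<Lambda>\<^esub> y \<in> I"
    and I_mult: "\<And>r x. r \<in> carrier \<Lambda> \<Longrightarrow> x \<in> I \<Longrightarrow> r \<otimes>\<^bsub>\<Lambda>\<^esub> x \<in> I"
    and reps: "\<And>c. c \<in> carrier (G Mod U) \<Longrightarrow> \<exists>g\<in>carrier G. U #> g = c \<and> single g 1 \<ominus>\<^bsub>\<Lambda>\<^esub> \<one>\<^bsub>\<Lambda>\<^esub> \<in> I"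
  shows "\<exists>y\<in>carrier \<Lambda>. (\<forall>c\<in>carrier (G Mod U). y U c = F c) \<and>
    y \<ominus>\<^bsub>\<Lambda>\<^esub> single \<one> (sum F (carrier (G Mod U))) \<in> I"
proof -
  have "\<exists>y\<in>carrier \<Lambda>. (\<forall>c\<in>carrier (G Mod U). y U c = (if c \<in> A then F c else 0)) \<and>
      y \<ominus>\<^bsub>\<Lambda>\<^esub> single \<one> (sum F A) \<in> I" if "finite A" "A \<subseteq> carrier (G Mod U)" for A
    using that
  proof (induction A)
    case empty
    have "\<zero>\<^bsub>\<Lambda>\<^esub> \<ominus>\<^bsub>\<Lambda>\<^esub> single \<one> 0 \<in> I"
      using I(2) by (simp add: R.minus_eq flip: zero_eq_single)
    moreover have "\<zero>\<^bsub>\<Lambda>\<^esub> U c = 0" if "c \<in> carrier (G Mod U)" for c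
      using U that by (simp add: \<Lambda>_simps(3))
    ultimately show ?case
      by (intro bexI[OF _ R.zero_closed]) simp
  next
    case (insert c A)
    then obtain y where y: "y \<in> carrier \<Lambda>" "\<And>c. c \<in> carrier (G Mod U) \<Longrightarrow> y U c = (if c \<in> A then F c else 0)"
        "y \<ominus>\<^bsub>\<Lambda>\<^esub> single \<one> (sum F A) \<in> I" by auto
    obtain g where g: "g \<in> carrier G" "U #> g = c" "single g 1 \<ominus>\<^bsub>\<Lambda>\<^esub> \<one>\<^bsub>\<Lambda>\<^esub> \<in> I"
      using reps insert.prems by blast
    have s: "single g 1 \<in> carrier \<Lambda>" "single \<one> (F c) \<in> carrier \<Lambda>" "single \<one> (sum F A) \<in> carrier \<Lambda>"
      using g by (simp_all add: single_closed)
    have eq: "single g (F c) = single \<one> (F c) \<otimes>\<^bsub>\<Lambda>\<^esub> single g 1"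
      using g by (simp add: single_mult)
    have "single \<one> (sum F (insert c A)) = single \<one> (F c) \<oplus>\<^bsub>\<Lambda>\<^esub> single \<one> (sum F A)"
      using insert.hyps by (simp add: single_add)
    then have "y \<oplus>\<^bsub>\<Lambda>\<^esub> single g (F c) \<ominus>\<^bsub>\<Lambda>\<^esub> single \<one> (sum F (insert c A)) =
        (y \<ominus>\<^bsub>\<Lambda>\<^esub> single \<one> (sum F A)) \<oplus>\<^bsub>\<Lambda>\<^esub> single \<one> (F c) \<otimes>\<^bsub>\<Lambda>\<^esub> (single g 1 \<ominus>\<^bsub>\<Lambda>\<^esub> \<one>\<^bsub>\<Lambda>\<^esub>)"
      unfolding eq using y(1) s
      by (simp add: R.minus_eq R.r_distr R.r_minus R.minus_add R.a_ac)
    also have "\<dots> \<in> I"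
      using y(3) g(3) s by (intro I_add I_mult)
    finally have "y \<oplus>\<^bsub>\<Lambda>\<^esub> single g (F c) \<ominus>\<^bsub>\<Lambda>\<^esub> single \<one> (sum F (insert c A)) \<in> I" .
    moreover have "(y \<oplus>\<^bsub>\<Lambda>\<^esub> single g (F c)) U c' = (if c' \<in> insert c A then F c' else 0)"
      if "c' \<in> carrier (G Mod U)" for c'
      using that U y(2) g(2) insert.hyps by (auto simp: \<Lambda>_simps single_def)
    ultimately show ?case
      using y(1) g(1) by (intro bexI[of _ "y \<oplus>\<^bsub>\<Lambda>\<^esub> single g (F c)"]) (auto simp: single_closed)
  qed
  from this[OF finite_index[OF U] order_refl] show ?thesis by simp
qed

lemma component_surj:
  assumes "U \<in> \<U>"
  obtains y where "y \<in> carrier \<Lambda>" "\<And>c. c \<in> carrier (G Mod U) \<Longrightarrow> y U c = F c"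
proof -
  \<comment> \<open>With the whole algebra as \<open>I\<close> the congruences are empty and only
    the prescribed coefficients remain.\<close>
  have "\<exists>y\<in>carrier \<Lambda>. (\<forall>c\<in>carrier (G Mod U). y U c = F c) \<and>
      y \<ominus>\<^bsub>\<Lambda>\<^esub> single \<one> (sum F (carrier (G Mod U))) \<in> carrier \<Lambda>"
    by (rule approximate_modulo_ideal[OF assms]) (auto simp: carrier_Mod single_closed)
  with that show thesis by blast
qed

end

section \<open>The group of 2-adic units\<close>

lemma carrier_S1: "carrier S1 = {x. residue x 1 = 1}"
proof -
  have "x \<in> carrier S1 \<longleftrightarrow> x dvd 1" for x
  proof -
    have "x \<in> carrier S1 \<longleftrightarrow> (\<exists>y. y * x = 1 \<and> x * y = 1)"
      by (simp add: S1_def units_of_def Units_def ring_of_type_algebra_def)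
    also have "\<dots> \<longleftrightarrow> (\<exists>y. 1 = x * y)"
      by (simp add: mult.commute[of _ x])
    finally show ?thesis
      by (simp add: dvd_def)
  qed
  then show ?thesis
    by (auto simp: z2adic_unit_iff)
qed

lemma comm_group_S1: "comm_group S1"
  by (rule group.group_comm_groupI[OF group_S1]) (simp add: mult_S1 mult.commute)

declare mult_S1 [simp] one_S1 [simp]

interpretation S1: comm_group S1
  by (rule comm_group_S1)

lemmas S1_m_closed = S1.m_closed[unfolded mult_S1]
  and S1_r_inv = S1.r_inv[unfolded mult_S1 one_S1]
  and S1_l_inv = S1.l_inv[unfolded mult_S1 one_S1]
  and S1_one_closed [simp] = S1.one_closed[unfolded one_S1]
  and S1_inv_one [simp] = S1.inv_one[unfolded one_S1]
  and S1_inv_equality = S1.inv_equality[unfolded mult_S1 one_S1]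

lemma int_pow_S1_cong:
  assumes "g \<in> carrier S1" "h \<in> carrier S1" "residue g n = residue h n"
  shows "residue (g [^]\<^bsub>S1\<^esub> (k :: int)) n = residue (h [^]\<^bsub>S1\<^esub> k) n"
proof -
  have nat: "residue (x [^]\<^bsub>S1\<^esub> m) n = residue (y [^]\<^bsub>S1\<^esub> m) n"
    if "residue x n = residue y n" for x y and m :: nat
    using that by (induction m) (auto intro: residue_cong_mult)
  have inv: "residue (inv\<^bsub>S1\<^esub> g) n = residue (inv\<^bsub>S1\<^esub> h) n"
  proof -
    \<comment> \<open>Trading \<open>h\<close> for the congruent \<open>g\<close> inside this
      product turns one inverse into the other.\<close>
    have "inv\<^bsub>S1\<^esub> g = inv\<^bsub>S1\<^esub> g * (h * inv\<^bsub>S1\<^esub> h)"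
      using assms by (simp add: S1_r_inv)
    moreover have "residue (inv\<^bsub>S1\<^esub> g * (h * inv\<^bsub>S1\<^esub> h)) n = residue (inv\<^bsub>S1\<^esub> g * (g * inv\<^bsub>S1\<^esub> h)) n"
      using assms(3) by (intro residue_cong_mult refl) simp
    moreover have "inv\<^bsub>S1\<^esub> g * (g * inv\<^bsub>S1\<^esub> h) = inv\<^bsub>S1\<^esub> h"
      using assms S1_l_inv[of g] by (simp flip: mult.assoc)
    ultimately show ?thesis by simp
  qed
  show ?thesis
  proof (cases "k < 0")
    case True
    then have "x [^]\<^bsub>S1\<^esub> k = inv\<^bsub>S1\<^esub> x [^]\<^bsub>S1\<^esub> nat (- k)" if "x \<in> carrier S1" for x
      unfolding S1.nat_pow_inv[OF that] by (simp only: int_pow_def2 if_True)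
    then show ?thesis
      using nat[OF inv] assms(1,2) by simp
  next
    case False
    then show ?thesis
      using nat[OF assms(3), of "nat k"] by (simp only: int_pow_def2 if_False)
  qed
qed

text \<open>The subgroup \<open>1 + 2 ^ n Z2\<close>, or all units when
  \<open>n \<le> 1\<close>.\<close>

definition U1 :: "nat \<Rightarrow> z2adic set" where
  "U1 n = {g \<in> carrier S1. residue g n = residue 1 n}"

lemma subgroup_U1: "subgroup (U1 n) S1"
proof (rule S1.subgroupI)
  show "a \<otimes>\<^bsub>S1\<^esub> b \<in> U1 n" if "a \<in> U1 n" "b \<in> U1 n" for a b
    using that residue_cong_mult[of a n 1 b 1] S1_m_closed by (auto simp: U1_def mult_S1)
  show "inv\<^bsub>S1\<^esub> a \<in> U1 n" if "a \<in> U1 n" for a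
    using that int_pow_S1_cong[of a 1 n "-1"] by (auto simp: U1_def S1.int_pow_neg)
qed (auto simp: U1_def)

lemma coset_U1:
  assumes "g \<in> carrier S1"
  shows "U1 n #>\<^bsub>S1\<^esub> g = {h \<in> carrier S1. residue h n = residue g n}"
proof (intro equalityI subsetI)
  fix h assume "h \<in> U1 n #>\<^bsub>S1\<^esub> g"
  then obtain u where u: "u \<in> U1 n" "h = u * g"
    by (auto simp: r_coset_def mult_S1)
  then show "h \<in> {h \<in> carrier S1. residue h n = residue g n}"
    using residue_cong_mult[of u n 1 g g] S1_m_closed[of u g] assms by (auto simp: U1_def)
next
  fix h assume h: "h \<in> {h \<in> carrier S1. residue h n = residue g n}"
  then have "residue (h * inv\<^bsub>S1\<^esub> g) n = residue (g * inv\<^bsub>S1\<^esub> g) n"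
    by (intro residue_cong_mult) auto
  then have "h * inv\<^bsub>S1\<^esub> g \<in> U1 n"
    using h assms S1_m_closed by (auto simp: U1_def S1_r_inv)
  moreover have "h = h * inv\<^bsub>S1\<^esub> g * g"
    using h assms by (simp add: mult.assoc S1_l_inv)
  ultimately show "h \<in> U1 n #>\<^bsub>S1\<^esub> g"
    by (auto simp: r_coset_def mult_S1)
qed

lemma coset_U1_eq_iff:
  assumes "g \<in> carrier S1" "h \<in> carrier S1"
  shows "U1 n #>\<^bsub>S1\<^esub> g = U1 n #>\<^bsub>S1\<^esub> h \<longleftrightarrow> residue g n = residue h n"
proof
  assume "U1 n #>\<^bsub>S1\<^esub> g = U1 n #>\<^bsub>S1\<^esub> h"
  moreover have "g \<in> U1 n #>\<^bsub>S1\<^esub> g" using assms by (simp add: coset_U1)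
  ultimately show "residue g n = residue h n" using assms(2) by (simp add: coset_U1)
qed (simp add: coset_U1 assms)

lemma U1_open_normal: "U1 n \<in> open_normal_subgroups S1 S1_top"
proof -
  have "open (U1 n \<union> - carrier S1)"
    unfolding open_z2adic_def
  proof
    fix x assume "x \<in> U1 n \<union> - carrier S1"
    \<comment> \<open>Level 1 decides whether an element is a unit, hence \<open>max n 1\<close>:
      for \<open>n = 0\<close> the residue alone does not.\<close>
    then show "\<exists>k. \<forall>y. residue y k = residue x k \<longrightarrow> y \<in> U1 n \<union> - carrier S1"
      using residue_mod[of n "max n 1"] residue_mod[of 1 "max n 1"]
      by (intro exI[of _ "max n 1"]) (metis (mono_tags, lifting) Compl_iff UnCI UnE U1_def carrier_S1 max.cobounded1 max.cobounded2 mem_Collect_eq)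
  qed
  then have "openin S1_top (U1 n)"
    by (auto simp: S1_top_def openin_subtopology U1_def)
  then show ?thesis
    using subgroup_U1 S1.subgroup_imp_normal by (simp add: open_normal_subgroups_def)
qed

lemma U1_cofinal:
  assumes "V \<in> open_normal_subgroups S1 S1_top"
  shows "\<exists>n. U1 n \<subseteq> V"
proof -
  have V: "subgroup V S1" "openin S1_top V"
    using assms by (auto simp: open_normal_subgroups_def normal_imp_subgroup)
  then obtain W where W: "open W" "V = W \<inter> carrier S1"
    by (auto simp: S1_top_def openin_subtopology)
  have "1 \<in> V"
    using subgroup.one_closed[OF V(1)] by (simp add: one_S1)
  then obtain n where "\<And>y. residue y n = residue 1 n \<Longrightarrow> y \<in> W"
    using W unfolding open_z2adic_def by blast
  then show ?thesis
    using W by (intro exI[of _ n]) (auto simp: U1_def)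
qed

lemma U1_mono: "m \<le> n \<Longrightarrow> U1 n \<subseteq> U1 m"
  using residue_mod[of m n] by (auto simp: U1_def) (metis residue_mod)

interpretation S1: completed_abelian_group_algebra S1 S1_top
proof (intro completed_abelian_group_algebra.intro completed_abelian_group_algebra_axioms.intro comm_group_S1)
    show "topspace S1_top = carrier S1"
      by (simp add: S1_top_def)
    fix V assume V: "V \<in> open_normal_subgroups S1 S1_top"
    then have sub: "subgroup V S1"
      by (auto simp: open_normal_subgroups_def normal_imp_subgroup)
    obtain n where n: "U1 n \<subseteq> V"
      using U1_cofinal[OF V] by blast
    \<comment> \<open>Cosets of \<open>V\<close> are told apart by the residue of a representative
      modulo \<open>2 ^ n\<close>, because \<open>U1 n\<close> lies in \<open>V\<close>; so there
      are finitely many.\<close>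
    define r where "r c = residue (SOME g. g \<in> c) n" for c
    have "inj_on r (carrier (S1 Mod V))"
    proof (rule inj_onI)
      fix c c' assume c: "c \<in> carrier (S1 Mod V)" "c' \<in> carrier (S1 Mod V)" "r c = r c'"
      then obtain g g' where g: "g \<in> carrier S1" "c = V #>\<^bsub>S1\<^esub> g" "g' \<in> carrier S1" "c' = V #>\<^bsub>S1\<^esub> g'"
        by (auto simp: FactGroup_def RCOSETS_def)
      define h h' where "h = (SOME g. g \<in> c)" and "h' = (SOME g. g \<in> c')"
      have h: "h \<in> c" "h' \<in> c'"
        using S1.rcos_self[OF g(1) sub] S1.rcos_self[OF g(3) sub] g someI[of "\<lambda>g. g \<in> c"] someI[of "\<lambda>g. g \<in> c'"]
        by (auto simp: h_def h'_def)
      have hc: "h \<in> carrier S1" "h' \<in> carrier S1"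
        using h g S1.r_coset_subset_G[OF subgroup.subset[OF sub]] by blast+
      have "h \<in> U1 n #>\<^bsub>S1\<^esub> h'"
        using c(3) hc by (simp add: coset_U1 r_def h_def h'_def)
      then have "h \<in> V #>\<^bsub>S1\<^esub> h'"
        using n by (auto simp: r_coset_def)
      then have "V #>\<^bsub>S1\<^esub> h = V #>\<^bsub>S1\<^esub> h'"
        using S1.repr_independence[OF _ hc(2) sub] by simp
      moreover have "c = V #>\<^bsub>S1\<^esub> h"
        by (simp only: g(2) S1.repr_independence[OF h(1)[unfolded g(2)] g(1) sub])
      moreover have "c' = V #>\<^bsub>S1\<^esub> h'"
        by (simp only: g(4) S1.repr_independence[OF h(2)[unfolded g(4)] g(3) sub])
      ultimately show "c = c'" by simp
    qed
    moreover have "r ` carrier (S1 Mod V) \<subseteq> {0..<2 ^ n}"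
      by (auto simp: r_def residue_nonneg residue_less)
    ultimately show "finite (carrier (S1 Mod V))"
      by (meson finite_atLeastLessThan_int finite_imageD finite_subset)
qed

lemmas S1_single_mult = S1.single_mult[unfolded mult_S1]
  and S1_single_mult_component = S1.single_mult_component[unfolded mult_S1]
  and S1_zero_eq_single = S1.zero_eq_single[unfolded one_S1]
  and S1_one_eq_single = S1.one_eq_single[unfolded one_S1]

abbreviation "\<Lambda>1 \<equiv> completed_group_algebra S1 S1_top"

lemma five_S1: "5 \<in> carrier S1" and minus_one_S1: "-1 \<in> carrier S1"
  by (simp_all add: carrier_S1 residue_numeral uminus_z2adic.rep_eq one_z2adic.rep_eq)

lemma inv_minus_one_S1: "inv\<^bsub>S1\<^esub> (-1) = -1"
  using minus_one_S1 by (intro S1_inv_equality) auto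

lemma power_S1: "g \<in> carrier S1 \<Longrightarrow> g ^ n \<in> carrier S1"
  by (induction n) (auto intro: S1_m_closed)

lemma character_int_pow: "continuous_character S1 S1_top (\<lambda>g. g [^]\<^bsub>S1\<^esub> (k :: int))"
proof (intro continuous_character.intro continuous_character_axioms.intro)
  show "completed_abelian_group_algebra S1 S1_top"
    by (rule S1.completed_abelian_group_algebra_axioms)
  show "\<exists>U\<in>open_normal_subgroups S1 S1_top. \<forall>g\<in>carrier S1. \<forall>h\<in>U #>\<^bsub>S1\<^esub> g.
      residue (h [^]\<^bsub>S1\<^esub> k) n = residue (g [^]\<^bsub>S1\<^esub> k) n" for n
    by (intro bexI[OF _ U1_open_normal[of n]] ballI int_pow_S1_cong) (simp_all add: coset_U1)
qed (use S1.int_pow_distrib S1.int_pow_one in simp_all)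

section \<open>Powers of five\<close>

text \<open>Squaring \<open>1 + 2 ^ (m + 2) * w\<close> gives
  \<open>1 + 2 ^ (m + 3) * (w + 2 ^ (m + 1) * w ^ 2)\<close>, and the cofactor stays odd. The odd
  cofactor is what counts: it makes the powers of 5 dense in the units that are 1 modulo 4, and it
  gives the exact valuation of \<open>5 ^ n - 1\<close>.\<close>

lemma five_power_two_power: "\<exists>q :: int. 5 ^ (2 ^ m) = 1 + 2 ^ (m + 2) * (2 * q + 1)"
proof (induction m)
  case (Suc m)
  then obtain q :: int where q: "5 ^ (2 ^ m) = 1 + 2 ^ (m + 2) * (2 * q + 1)" by blast
  have "(5 :: int) ^ (2 ^ Suc m) = (5 ^ (2 ^ m))\<^sup>2"
    by (simp add: power_mult[symmetric] mult.commute)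
  also have "\<dots> = 1 + 2 ^ (Suc m + 2) * (2 * (q + 2 ^ m * (2 * q + 1)\<^sup>2) + 1)"
    unfolding q by (simp add: power2_eq_square algebra_simps)
  finally show ?case by blast
qed (simp add: exI[of _ 0])

text \<open>Digit by digit: multiplying \<open>5 ^ j\<close> by \<open>5 ^ (2 ^ n)\<close> changes
  the digit at \<open>2 ^ (n + 2)\<close> and nothing below it.\<close>

lemma cong_five_power:
  assumes "(a :: int) mod 4 = 1"
  shows "\<exists>j. 2 ^ (n + 2) dvd a - 5 ^ j"
proof (induction n)
  case 0
  show ?case using assms mod_eq_dvd_iff[of a 4 1] by (intro exI[of _ 0]) simp
next
  case (Suc n)
  then obtain j s where s: "a - 5 ^ j = 2 ^ (n + 2) * s" by blast
  obtain q :: int where q: "5 ^ (2 ^ n) = 1 + 2 ^ (n + 2) * (2 * q + 1)"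
    using five_power_two_power by blast
  show ?case
  proof (cases "even s")
    case True
    then show ?thesis using s by (intro exI[of _ j]) auto
  next
    case False
    have "a - 5 ^ (j + 2 ^ n) = 2 ^ (n + 2) * (s - 5 ^ j * (2 * q + 1))"
      using s unfolding power_add q by (simp add: algebra_simps)
    moreover have "even (s - 5 ^ j * (2 * q + 1))"
      using False by simp
    moreover have "(2 :: int) ^ (Suc n + 2) = 2 ^ (n + 2) * 2"
      by simp
    ultimately show ?thesis
      by (metis mult_dvd_mono dvd_refl)
  qed
qed

lemma mod_two_power_Suc:
  "(a :: int) mod 2 ^ n = b mod 2 ^ n \<longleftrightarrow>
     a mod 2 ^ Suc n = b mod 2 ^ Suc n \<or> a mod 2 ^ Suc n = (b + 2 ^ n) mod 2 ^ Suc n"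
  unfolding mod_eq_dvd_iff
proof
  assume "2 ^ n dvd a - b"
  then obtain s where s: "a - b = 2 ^ n * s" by blast
  show "2 ^ Suc n dvd a - b \<or> 2 ^ Suc n dvd a - (b + 2 ^ n)"
  proof (cases "even s")
    case False
    then obtain r where "s = 2 * r + 1" by (rule oddE)
    then have "a - (b + 2 ^ n) = 2 ^ Suc n * r" using s by (simp add: algebra_simps)
    then show ?thesis by simp
  qed (use s in auto)
next
  assume "2 ^ Suc n dvd a - b \<or> 2 ^ Suc n dvd a - (b + 2 ^ n)"
  then show "2 ^ n dvd a - b"
  proof
    assume "2 ^ Suc n dvd a - (b + 2 ^ n)"
    then obtain k where "a - (b + 2 ^ n) = 2 ^ Suc n * k" ..
    then have "a - b = 2 ^ n * (2 * k + 1)" by (simp add: algebra_simps)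
    then show ?thesis by simp
  qed (auto elim: dvd_mult_right)
qed

lemma residue_eq_iff_dvd: "residue (of_int a) n = residue (of_int b) n \<longleftrightarrow> 2 ^ n dvd a - b"
  by (simp add: residue_of_int mod_eq_dvd_iff)

lemma residue_of_int_residue: "m \<le> n \<Longrightarrow> residue (of_int (residue x n)) m = residue x m"
  by (simp add: residue_of_int residue_mod)

lemma S1_generators:
  assumes "g \<in> carrier S1"
  obtains j where "residue g n = residue (5 ^ j) n" | j where "residue g n = residue (- (5 ^ j)) n"
proof -
  \<comment> \<open>Two extra digits, so that the residue modulo 4 is available to decide the
    sign.\<close>
  let ?a = "residue g (n + 2)"
  have "?a mod 2 = 1"
    using residue_mod[of 1 "n + 2" g] assms by (simp add: carrier_S1)
  then have "?a mod 4 = 1 \<or> (- ?a) mod 4 = 1" by presburger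
  then consider j where "2 ^ (n + 2) dvd ?a - 5 ^ j" | j where "2 ^ (n + 2) dvd - ?a - 5 ^ j"
    using cong_five_power by blast
  then show thesis
  proof cases
    case (1 j)
    then have "2 ^ n dvd ?a - 5 ^ j"
      by (rule dvd_trans[rotated]) (simp add: le_imp_power_dvd)
    then have "residue (of_int ?a) n = residue (of_int (5 ^ j)) n"
      by (simp only: residue_eq_iff_dvd)
    then show thesis
      by (intro that(1)[of j]) (simp add: residue_of_int_residue)
  next
    case (2 j)
    then have "2 ^ n dvd - (- ?a - 5 ^ j)"
      unfolding dvd_minus_iff by (rule dvd_trans[rotated]) (simp add: le_imp_power_dvd)
    then have "2 ^ n dvd ?a - (- (5 ^ j))" by (simp add: add.commute)
    then have "residue (of_int ?a) n = residue (of_int (- (5 ^ j))) n"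
      by (simp only: residue_eq_iff_dvd)
    then show thesis
      by (intro that(2)[of j]) (simp add: residue_of_int_residue)
  qed
qed

section \<open>The completed group algebra of the 2-adic units\<close>

definition \<sigma> :: "z2adic cga" where "\<sigma> = S1.single (-1) 1"
definition \<gamma> :: "z2adic cga" where "\<gamma> = S1.single 5 1"

definition sigma_minus :: "z2adic cga" where "sigma_minus = \<sigma> \<ominus>\<^bsub>\<Lambda>1\<^esub> \<one>\<^bsub>\<Lambda>1\<^esub>"
definition sigma_plus :: "z2adic cga" where "sigma_plus = \<sigma> \<oplus>\<^bsub>\<Lambda>1\<^esub> \<one>\<^bsub>\<Lambda>1\<^esub>"
definition gamma_minus :: "z2adic cga" where "gamma_minus = \<gamma> \<ominus>\<^bsub>\<Lambda>1\<^esub> \<one>\<^bsub>\<Lambda>1\<^esub>"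

lemma \<sigma>_closed [simp]: "\<sigma> \<in> carrier \<Lambda>1" and \<gamma>_closed [simp]: "\<gamma> \<in> carrier \<Lambda>1"
  by (simp_all add: \<sigma>_def \<gamma>_def S1.single_closed five_S1 minus_one_S1)

lemma sigma_minus_closed [simp]: "sigma_minus \<in> carrier \<Lambda>1"
  and sigma_plus_closed [simp]: "sigma_plus \<in> carrier \<Lambda>1"
  and gamma_minus_closed [simp]: "gamma_minus \<in> carrier \<Lambda>1"
  by (simp_all add: sigma_minus_def sigma_plus_def gamma_minus_def)

lemma \<sigma>_\<sigma>: "\<sigma> \<otimes>\<^bsub>\<Lambda>1\<^esub> \<sigma> = \<one>\<^bsub>\<Lambda>1\<^esub>"
  by (simp add: \<sigma>_def S1_single_mult minus_one_S1 S1_one_eq_single)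

lemma minus_one_mult:
  "a \<in> carrier \<Lambda>1 \<Longrightarrow> x \<in> carrier \<Lambda>1 \<Longrightarrow> (a \<ominus>\<^bsub>\<Lambda>1\<^esub> \<one>\<^bsub>\<Lambda>1\<^esub>) \<otimes>\<^bsub>\<Lambda>1\<^esub> x = a \<otimes>\<^bsub>\<Lambda>1\<^esub> x \<ominus>\<^bsub>\<Lambda>1\<^esub> x"
  by (simp add: S1.R.minus_eq S1.R.l_distr S1.R.l_minus)

lemma sigma_plus_minus: "sigma_plus \<otimes>\<^bsub>\<Lambda>1\<^esub> sigma_minus = \<zero>\<^bsub>\<Lambda>1\<^esub>"
  by (simp add: sigma_plus_def sigma_minus_def S1.R.minus_eq S1.R.l_distr S1.R.r_distr \<sigma>_\<sigma> S1.R.r_minus S1.R.a_ac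
      S1.R.r_neg S1.R.r_neg1 S1.R.r_neg2)

lemma sigma_minus_plus: "sigma_minus \<otimes>\<^bsub>\<Lambda>1\<^esub> sigma_plus = \<zero>\<^bsub>\<Lambda>1\<^esub>"
  using sigma_plus_minus by (simp add: S1.R.m_comm)

lemma S1_component_eqI:
  assumes "x \<in> carrier \<Lambda>1" "y \<in> carrier \<Lambda>1"
    and "\<And>g. g \<in> carrier S1 \<Longrightarrow> x (U1 n) (U1 n #>\<^bsub>S1\<^esub> g) = y (U1 n) (U1 n #>\<^bsub>S1\<^esub> g)"
  shows "x (U1 n) = y (U1 n)"
  using assms
  by (intro extensionalityI[of _ "carrier (S1 Mod U1 n)"] S1.component_closed U1_open_normal)
    (auto simp: S1.carrier_Mod)

text \<open>Levels below 2 are left out because modulo 2 negation fixes the only class of units; the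
  remaining levels are still cofinal.\<close>

lemma S1_solve:
  assumes "compact_space W" "continuous_map W (ring_top \<Lambda>1) f" "x \<in> carrier \<Lambda>1"
    and "\<And>n. n \<ge> 2 \<Longrightarrow> \<exists>w\<in>topspace W. f w (U1 n) = x (U1 n)"
  shows "\<exists>w\<in>topspace W. f w = x"
  using assms
proof (intro S1.solve_by_compactness[where V = "\<lambda>n. U1 (n + 2)"] U1_open_normal U1_mono)
  show "\<exists>n. U1 (n + 2) \<subseteq> U" if "U \<in> open_normal_subgroups S1 S1_top" for U
    using U1_cofinal[OF that] U1_mono by (meson le_add1 subset_trans)
qed auto

lemma add_component:
  "g \<in> carrier S1 \<Longrightarrow> (x \<oplus>\<^bsub>\<Lambda>1\<^esub> y) (U1 n) (U1 n #>\<^bsub>S1\<^esub> g) = x (U1 n) (U1 n #>\<^bsub>S1\<^esub> g) + y (U1 n) (U1 n #>\<^bsub>S1\<^esub> g)"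
  by (simp add: S1.\<Lambda>_simps U1_open_normal S1.coset_in_Mod)

lemma zero_component: "g \<in> carrier S1 \<Longrightarrow> \<zero>\<^bsub>\<Lambda>1\<^esub> (U1 n) (U1 n #>\<^bsub>S1\<^esub> g) = 0"
  by (simp add: S1.\<Lambda>_simps U1_open_normal S1.coset_in_Mod)

lemma minus_component:
  assumes "x \<in> carrier \<Lambda>1" "g \<in> carrier S1"
  shows "(\<ominus>\<^bsub>\<Lambda>1\<^esub> x) (U1 n) (U1 n #>\<^bsub>S1\<^esub> g) = - x (U1 n) (U1 n #>\<^bsub>S1\<^esub> g)"
proof -
  have "(\<ominus>\<^bsub>\<Lambda>1\<^esub> x) (U1 n) (U1 n #>\<^bsub>S1\<^esub> g) + x (U1 n) (U1 n #>\<^bsub>S1\<^esub> g) = 0"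
    using assms by (simp add: S1.R.l_neg zero_component flip: add_component)
  then show ?thesis by (simp add: eq_neg_iff_add_eq_0)
qed

section \<open>Annihilators of \<open>\<sigma> - 1\<close>, \<open>\<sigma> + 1\<close> and
  \<open>\<gamma> - 1\<close>\<close>

lemma sigma_component:
  "g \<in> carrier S1 \<Longrightarrow> (\<sigma> \<otimes>\<^bsub>\<Lambda>1\<^esub> x) (U1 n) (U1 n #>\<^bsub>S1\<^esub> g) = x (U1 n) (U1 n #>\<^bsub>S1\<^esub> (- g))"
  using S1_single_mult_component[OF minus_one_S1 _ U1_open_normal, of g 1 x n]
  by (simp add: \<sigma>_def inv_minus_one_S1)

lemma minus_S1: "g \<in> carrier S1 \<Longrightarrow> - g \<in> carrier S1"
  using S1_m_closed[OF minus_one_S1, of g] by simp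

text \<open>A unit is 1 or 3 modulo 4, and negation exchanges the two classes. So the class of 1 is
  a fundamental domain for the action of -1.\<close>

lemma residue_minus_2:
  assumes "g \<in> carrier S1"
  shows "residue (- g) 2 = 1 \<longleftrightarrow> residue g 2 \<noteq> 1"
proof -
  have "residue g 2 mod 2 = 1"
    using residue_mod[of 1 2 g] assms by (simp add: carrier_S1)
  moreover have "0 \<le> residue g 2" "residue g 2 < 4"
    using residue_nonneg[of g 2] residue_less[of g 2] by simp_all
  ultimately have "residue g 2 = 1 \<or> residue g 2 = 3" by presburger
  then show ?thesis by (auto simp: uminus_z2adic.rep_eq)
qed

text \<open>Cuts a function on cosets down to the fundamental domain. From level 2 on the residue
  modulo 4 depends only on the coset, so the cut makes sense there.\<close>

lemma restrict_component:
  assumes "n \<ge> 2"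
  obtains y where "y \<in> carrier \<Lambda>1"
    "\<And>g. g \<in> carrier S1 \<Longrightarrow> y (U1 n) (U1 n #>\<^bsub>S1\<^esub> g) = (if residue g 2 = 1 then F (U1 n #>\<^bsub>S1\<^esub> g) else 0)"
proof -
  obtain y where y: "y \<in> carrier \<Lambda>1"
    "\<And>c. c \<in> carrier (S1 Mod U1 n) \<Longrightarrow> y (U1 n) c = (if residue (S1.rep c) 2 = 1 then F c else 0)"
    using S1.component_surj[OF U1_open_normal[of n], where F = "\<lambda>c. if residue (S1.rep c) 2 = 1 then F c else 0"] by blast
  have "residue (S1.rep (U1 n #>\<^bsub>S1\<^esub> g)) 2 = residue g 2" if "g \<in> carrier S1" for g
    using S1.rep(2)[OF U1_open_normal S1.coset_in_Mod[OF that]] that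
      residue_mod[OF assms, of g] residue_mod[OF assms, of "S1.rep (U1 n #>\<^bsub>S1\<^esub> g)"]
    by (simp add: coset_U1)
  with that y show thesis
    by (simp add: S1.coset_in_Mod)
qed

lemma continuous_map_left_mult:
  "a \<in> carrier \<Lambda>1 \<Longrightarrow> continuous_map (ring_top \<Lambda>1) (ring_top \<Lambda>1) (\<lambda>y. a \<otimes>\<^bsub>\<Lambda>1\<^esub> y)"
  by (intro S1.continuous_map_\<Lambda>_mult) (simp_all add: S1.topspace_ring_top)

text \<open>Such an \<open>x\<close> is invariant under -1. Its restriction to the units that are 1
  modulo 4, spread by \<open>\<sigma> + 1\<close>, is \<open>x\<close> again.\<close>

lemma kernel_sigma_minus:
  assumes x: "x \<in> carrier \<Lambda>1" "sigma_minus \<otimes>\<^bsub>\<Lambda>1\<^esub> x = \<zero>\<^bsub>\<Lambda>1\<^esub>"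
  shows "\<exists>y\<in>carrier \<Lambda>1. x = sigma_plus \<otimes>\<^bsub>\<Lambda>1\<^esub> y"
proof -
  have inv: "x (U1 n) (U1 n #>\<^bsub>S1\<^esub> (- g)) = x (U1 n) (U1 n #>\<^bsub>S1\<^esub> g)" if g: "g \<in> carrier S1" for n g
  proof -
    have "\<sigma> \<otimes>\<^bsub>\<Lambda>1\<^esub> x = x"
      using x by (simp add: sigma_minus_def minus_one_mult)
    then show ?thesis using sigma_component[OF g, of x n] by simp
  qed
  have "\<exists>y\<in>topspace (ring_top \<Lambda>1). sigma_plus \<otimes>\<^bsub>\<Lambda>1\<^esub> y = x"
  proof (rule S1_solve)
    fix n :: nat assume n: "n \<ge> 2"
    obtain y where y: "y \<in> carrier \<Lambda>1" "\<And>g. g \<in> carrier S1 \<Longrightarrow>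
        y (U1 n) (U1 n #>\<^bsub>S1\<^esub> g) = (if residue g 2 = 1 then x (U1 n) (U1 n #>\<^bsub>S1\<^esub> g) else 0)"
      using restrict_component[OF n] by blast
    have "(sigma_plus \<otimes>\<^bsub>\<Lambda>1\<^esub> y) (U1 n) = x (U1 n)"
      by (rule S1_component_eqI)
        (use x y in \<open>auto simp: sigma_plus_def S1.R.l_distr add_component sigma_component minus_S1 residue_minus_2 inv\<close>)
    then show "\<exists>y\<in>topspace (ring_top \<Lambda>1). (sigma_plus \<otimes>\<^bsub>\<Lambda>1\<^esub> y) (U1 n) = x (U1 n)"
      using y(1) by (auto simp: S1.topspace_ring_top)
  qed (use S1.profinite_space_\<Lambda> x continuous_map_left_mult in \<open>auto simp: profinite_space_def\<close>)
  then show ?thesis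
    by (auto simp: S1.topspace_ring_top)
qed

text \<open>Such an \<open>x\<close> changes sign under -1. The restriction to the units that are 1
  modulo 4 is taken with a minus sign: there \<open>\<sigma> - 1\<close> contributes
  \<open>- y\<close>, and on the other class it contributes \<open>y\<close> moved by -1.\<close>

lemma kernel_sigma_plus:
  assumes x: "x \<in> carrier \<Lambda>1" "sigma_plus \<otimes>\<^bsub>\<Lambda>1\<^esub> x = \<zero>\<^bsub>\<Lambda>1\<^esub>"
  shows "\<exists>y\<in>carrier \<Lambda>1. x = sigma_minus \<otimes>\<^bsub>\<Lambda>1\<^esub> y"
proof -
  have inv: "x (U1 n) (U1 n #>\<^bsub>S1\<^esub> (- g)) = - x (U1 n) (U1 n #>\<^bsub>S1\<^esub> g)" if g: "g \<in> carrier S1" for n g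
  proof -
    have "(\<sigma> \<otimes>\<^bsub>\<Lambda>1\<^esub> x \<oplus>\<^bsub>\<Lambda>1\<^esub> x) (U1 n) (U1 n #>\<^bsub>S1\<^esub> g) = 0"
      using x g by (simp add: sigma_plus_def S1.R.l_distr zero_component)
    then show ?thesis using g by (simp add: add_component sigma_component eq_neg_iff_add_eq_0)
  qed
  have "\<exists>y\<in>topspace (ring_top \<Lambda>1). sigma_minus \<otimes>\<^bsub>\<Lambda>1\<^esub> y = x"
  proof (rule S1_solve)
    fix n :: nat assume n: "n \<ge> 2"
    obtain y where y: "y \<in> carrier \<Lambda>1" "\<And>g. g \<in> carrier S1 \<Longrightarrow>
        y (U1 n) (U1 n #>\<^bsub>S1\<^esub> g) = (if residue g 2 = 1 then - x (U1 n) (U1 n #>\<^bsub>S1\<^esub> g) else 0)"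
      using restrict_component[OF n, of "\<lambda>c. - x (U1 n) c"] by blast
    have "(sigma_minus \<otimes>\<^bsub>\<Lambda>1\<^esub> y) (U1 n) = x (U1 n)"
      by (rule S1_component_eqI)
        (use x y in \<open>auto simp: sigma_minus_def S1.R.minus_eq S1.R.l_distr S1.R.l_minus add_component minus_component
          sigma_component minus_S1 residue_minus_2 inv\<close>)
    then show "\<exists>y\<in>topspace (ring_top \<Lambda>1). (sigma_minus \<otimes>\<^bsub>\<Lambda>1\<^esub> y) (U1 n) = x (U1 n)"
      using y(1) by (auto simp: S1.topspace_ring_top)
  qed (use S1.profinite_space_\<Lambda> x continuous_map_left_mult in \<open>auto simp: profinite_space_def\<close>)
  then show ?thesis
    by (auto simp: S1.topspace_ring_top)
qed

text \<open>A coset of \<open>U1 n\<close> is the union of two cosets of \<open>U1 (n + 1)\<close>, which are exchanged by a power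
  of 5. So the mass of a measure invariant under 5 doubles at each level, and is divisible by all
  powers of 2.\<close>

lemma gamma_minus_injective:
  assumes x: "x \<in> carrier \<Lambda>1" "gamma_minus \<otimes>\<^bsub>\<Lambda>1\<^esub> x = \<zero>\<^bsub>\<Lambda>1\<^esub>"
  shows "x = \<zero>\<^bsub>\<Lambda>1\<^esub>"
proof -
  let ?c = "\<lambda>n g. U1 n #>\<^bsub>S1\<^esub> g"
  have "\<gamma> \<otimes>\<^bsub>\<Lambda>1\<^esub> x = x"
    using x by (simp add: gamma_minus_def minus_one_mult)
  then have inv1: "x (U1 n) (?c n (inv\<^bsub>S1\<^esub> 5 * g)) = x (U1 n) (?c n g)" if g: "g \<in> carrier S1" for n g
    using S1_single_mult_component[OF five_S1 g U1_open_normal, of 1 x n] by (simp add: \<gamma>_def)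
  have inv5: "x (U1 n) (?c n (5 ^ j * g)) = x (U1 n) (?c n g)" if g: "g \<in> carrier S1" for n g j
  proof (induction j)
    case (Suc j)
    have "5 * (5 ^ j * g) \<in> carrier S1"
      by (intro S1_m_closed five_S1 power_S1 g)
    from inv1[OF this, of n] Suc show ?case
      using five_S1 by (simp add: mult.assoc S1_l_inv flip: mult.assoc[of "inv\<^bsub>S1\<^esub> 5" 5])
  qed simp
  have double: "x (U1 n) (?c n h) = 2 * x (U1 (Suc n)) (?c (Suc n) h)" if h: "h \<in> carrier S1" and n: "n \<ge> 2" for n h
  proof -
    \<comment> \<open>\<open>5 ^ (2 ^ (n - 2))\<close> is 1 plus an odd multiple of
      \<open>2 ^ n\<close>, so \<open>?h'\<close> agrees with the unit \<open>h\<close> modulo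
      \<open>2 ^ n\<close> but not modulo \<open>2 ^ (n + 1)\<close>: it names the other coset
      inside that of \<open>h\<close>.\<close>
    let ?h' = "5 ^ (2 ^ (n - 2)) * h"
    obtain q :: int where "5 ^ (2 ^ (n - 2)) = 1 + 2 ^ (n - 2 + 2) * (2 * q + 1)"
      using five_power_two_power by blast
    then have q: "5 ^ (2 ^ (n - 2)) = 1 + 2 ^ n * (2 * q + 1)"
      using n by (simp only: le_add_diff_inverse2)
    have h': "?h' \<in> carrier S1"
      by (intro S1_m_closed five_S1 power_S1 h)
    let ?b = "residue h (Suc n)"
    have "odd ?b"
      using residue_mod[of 1 "Suc n" h] h by (simp add: carrier_S1 odd_iff_mod_2_eq_one)
    then have "odd ((2 * q + 1) * ?b)" by simp
    then obtain k where "(2 * q + 1) * ?b = 2 * k + 1" by (rule oddE)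
    then have "5 ^ (2 ^ (n - 2)) * ?b = ?b + 2 ^ n * (2 * k + 1)"
      by (simp only: q distrib_right mult_1_left mult.assoc)
    then have "5 ^ (2 ^ (n - 2)) * ?b = (?b + 2 ^ n) + 2 ^ Suc n * k"
      by (simp add: algebra_simps)
    moreover have "residue (of_int (5 ^ (2 ^ (n - 2))) * h) (Suc n) = 5 ^ (2 ^ (n - 2)) * ?b mod 2 ^ Suc n"
      unfolding times_z2adic.rep_eq residue_of_int by (rule mod_mult_left_eq)
    ultimately have h'_res: "residue ?h' (Suc n) = (?b + 2 ^ n) mod 2 ^ Suc n"
      by simp
    have res: "residue g n = residue h n \<longleftrightarrow> residue g (Suc n) = ?b \<or> residue g (Suc n) = residue ?h' (Suc n)" for g
      using mod_two_power_Suc[of "residue g (Suc n)" n ?b] residue_mod[of n "Suc n"] residue_mod[of "Suc n" "Suc n"]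
      by (simp only: h'_res)
    have ne: "residue ?h' (Suc n) \<noteq> ?b"
    proof
      assume "residue ?h' (Suc n) = ?b"
      then have "(?b + 2 ^ n) mod 2 ^ Suc n = ?b mod 2 ^ Suc n"
        using residue_mod[of "Suc n" "Suc n" h] by (simp only: h'_res)
      then have "(2 :: int) ^ Suc n dvd 2 ^ n" by (simp only: mod_eq_dvd_iff add_diff_cancel_left')
      then show False by (simp add: zdvd_not_zless)
    qed
    have "x (U1 n) (?c n h) = (\<Sum>e | e \<in> carrier (S1 Mod U1 (Suc n)) \<and> U1 n #>\<^bsub>S1\<^esub> S1.rep e = ?c n h. x (U1 (Suc n)) e)"
      by (intro S1.compatible[OF x(1)] U1_open_normal U1_mono S1.coset_in_Mod h) simp
    also have "{e \<in> carrier (S1 Mod U1 (Suc n)). U1 n #>\<^bsub>S1\<^esub> S1.rep e = ?c n h} = {?c (Suc n) h, ?c (Suc n) ?h'}"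
    proof (intro equalityI subsetI)
      fix e assume e: "e \<in> {e \<in> carrier (S1 Mod U1 (Suc n)). U1 n #>\<^bsub>S1\<^esub> S1.rep e = ?c n h}"
      then have r: "S1.rep e \<in> carrier S1" "?c (Suc n) (S1.rep e) = e"
        using S1.rep[OF U1_open_normal] by blast+
      then have "residue (S1.rep e) n = residue h n"
        using e h by (simp add: coset_U1_eq_iff)
      then have "e = ?c (Suc n) h \<or> e = ?c (Suc n) ?h'"
        unfolding res using r h h' by (metis coset_U1_eq_iff)
      then show "e \<in> {?c (Suc n) h, ?c (Suc n) ?h'}" by blast
    next
      fix e assume "e \<in> {?c (Suc n) h, ?c (Suc n) ?h'}"
      then obtain g where g: "g \<in> carrier S1" "e = ?c (Suc n) g" "residue g n = residue h n"
        using h h' res by blast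
      have e: "e \<in> carrier (S1 Mod U1 (Suc n))"
        using g by (simp add: S1.coset_in_Mod)
      note r = S1.rep[OF U1_open_normal e]
      have "residue (S1.rep e) (Suc n) = residue g (Suc n)"
        using r g by (simp add: coset_U1_eq_iff)
      then have "residue (S1.rep e) n = residue h n"
        using residue_mod[of n "Suc n" "S1.rep e"] residue_mod[of n "Suc n" g] g(3) by simp
      then show "e \<in> {e \<in> carrier (S1 Mod U1 (Suc n)). U1 n #>\<^bsub>S1\<^esub> S1.rep e = ?c n h}"
        using e r h by (simp add: coset_U1_eq_iff)
    qed
    also have "(\<Sum>e\<in>{?c (Suc n) h, ?c (Suc n) ?h'}. x (U1 (Suc n)) e) =
        x (U1 (Suc n)) (?c (Suc n) h) + x (U1 (Suc n)) (?c (Suc n) ?h')"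
      using ne h h' by (subst sum.insert) (auto simp: coset_U1_eq_iff)
    finally show ?thesis
      using inv5[OF h, of "Suc n" "2 ^ (n - 2)"] by simp
  qed
  have dvd: "2 ^ m dvd x (U1 n) (?c n h)" if h: "h \<in> carrier S1" and "n \<ge> 2" for n h m
    using that(2)
  proof (induction m arbitrary: n)
    case (Suc m)
    have "2 ^ m dvd x (U1 (Suc n)) (?c (Suc n) h)"
      by (rule Suc.IH) (use Suc.prems in simp)
    then show ?case
      unfolding double[OF h Suc.prems] power_Suc by (rule mult_dvd_mono[OF dvd_refl])
  qed simp
  then have zero: "x (U1 n) (?c n h) = 0" if "h \<in> carrier S1" "n \<ge> 2" for n h
    using that z2adic_eq_0 by blast
  show ?thesis
  proof (rule S1.\<Lambda>_eqI[OF x(1) S1.R.zero_closed])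
    fix V assume V: "V \<in> open_normal_subgroups S1 S1_top"
    obtain n where n: "U1 n \<subseteq> V" using U1_cofinal[OF V] by blast
    have "x (U1 (n + 2)) = \<zero>\<^bsub>\<Lambda>1\<^esub> (U1 (n + 2))"
      using x(1) by (intro S1_component_eqI) (auto simp: zero zero_component)
    then show "x V = \<zero>\<^bsub>\<Lambda>1\<^esub> V"
      using S1.component_mono[OF x(1) S1.R.zero_closed V U1_open_normal] n U1_mono[of n "n + 2"] by (meson le_add1 subset_trans)
  qed
qed

section \<open>The augmentation ideal\<close>

interpretation character: continuous_character S1 S1_top "\<lambda>g. g [^]\<^bsub>S1\<^esub> (k :: int)" for k
  by (rule character_int_pow)

text \<open>The trivial character integrates the constant 1, and push-forward preserves total mass.
  So this evaluation is the augmentation, visible at every level.\<close>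

lemma eval_0_eq_total_mass:
  assumes x: "x \<in> carrier \<Lambda>1" and U: "U \<in> open_normal_subgroups S1 S1_top"
  shows "character.eval 0 x = sum (x U) (carrier (S1 Mod U))"
proof (rule z2adic_eqI)
  fix n
  let ?V = "U \<inter> character.level 0 n"
  have V: "?V \<in> open_normal_subgroups S1 S1_top"
    by (intro S1.open_subgroups_Int U character.level)
  have "sum (x U) (carrier (S1 Mod U)) =
      (\<Sum>c\<in>carrier (S1 Mod U). (\<Sum>e | e \<in> carrier (S1 Mod ?V) \<and> U #>\<^bsub>S1\<^esub> S1.rep e = c. x ?V e) * 1)"
    using S1.compatible[OF x U V] by (intro sum.cong) simp_all
  also have "\<dots> = (\<Sum>e\<in>carrier (S1 Mod ?V). x ?V e * 1)"
    using S1.finite_index U V by (intro sum_fibres) (auto simp: S1.coset_in_Mod S1.rep)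
  also have "\<dots> = S1.integral ?V x (\<lambda>g. g [^]\<^bsub>S1\<^esub> (0 :: int))"
    by (simp add: S1.integral_def)
  finally show "residue (character.eval 0 x) n = residue (sum (x U) (carrier (S1 Mod U))) n"
    using character.residue_eval[OF x V, of 0 n] by simp
qed

text \<open>At level \<open>n\<close> the powers of 5 and their negatives represent all cosets, and
  their point masses are 1 modulo the ideal of \<open>sigma_minus\<close> and
  \<open>gamma_minus\<close>. An element of total mass 0 therefore agrees at that level with an
  element of the ideal, and compactness of the space of coefficient pairs finishes.\<close>

lemma kernel_augmentation:
  assumes x: "x \<in> carrier \<Lambda>1" "character.eval 0 x = 0"
  shows "\<exists>y\<in>carrier \<Lambda>1. \<exists>z\<in>carrier \<Lambda>1. x = sigma_minus \<otimes>\<^bsub>\<Lambda>1\<^esub> y \<oplus>\<^bsub>\<Lambda>1\<^esub> gamma_minus \<otimes>\<^bsub>\<Lambda>1\<^esub> z"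
proof -
  let ?W = "prod_topology (ring_top \<Lambda>1) (ring_top \<Lambda>1)"
  define f where "f w = sigma_minus \<otimes>\<^bsub>\<Lambda>1\<^esub> fst w \<oplus>\<^bsub>\<Lambda>1\<^esub> gamma_minus \<otimes>\<^bsub>\<Lambda>1\<^esub> snd w" for w
  define I where "I = f ` (carrier \<Lambda>1 \<times> carrier \<Lambda>1)"
  have I_add: "a \<oplus>\<^bsub>\<Lambda>1\<^esub> b \<in> I" if "a \<in> I" "b \<in> I" for a b
  proof -
    obtain y z y' z' where "y \<in> carrier \<Lambda>1" "z \<in> carrier \<Lambda>1" "y' \<in> carrier \<Lambda>1" "z' \<in> carrier \<Lambda>1"
      "a = f (y, z)" "b = f (y', z')"
      using \<open>a \<in> I\<close> \<open>b \<in> I\<close> by (auto simp: I_def)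
    then show ?thesis
      unfolding I_def by (intro image_eqI[of _ _ "(y \<oplus>\<^bsub>\<Lambda>1\<^esub> y', z \<oplus>\<^bsub>\<Lambda>1\<^esub> z')"]) (simp_all add: f_def S1.R.r_distr S1.R.a_ac)
  qed
  have I_mult: "r \<otimes>\<^bsub>\<Lambda>1\<^esub> a \<in> I" if r: "r \<in> carrier \<Lambda>1" and "a \<in> I" for r a
  proof -
    obtain y z where "y \<in> carrier \<Lambda>1" "z \<in> carrier \<Lambda>1" "a = f (y, z)"
      using \<open>a \<in> I\<close> by (auto simp: I_def)
    then show ?thesis
      using r unfolding I_def by (intro image_eqI[of _ _ "(r \<otimes>\<^bsub>\<Lambda>1\<^esub> y, r \<otimes>\<^bsub>\<Lambda>1\<^esub> z)"]) (simp_all add: f_def S1.R.r_distr S1.R.m_lcomm)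
  qed
  have I_closed: "I \<subseteq> carrier \<Lambda>1" by (auto simp: I_def f_def)
  have I_zero: "\<zero>\<^bsub>\<Lambda>1\<^esub> \<in> I"
    unfolding I_def by (rule image_eqI[of _ _ "(\<zero>\<^bsub>\<Lambda>1\<^esub>, \<zero>\<^bsub>\<Lambda>1\<^esub>)"]) (simp_all add: f_def)
  \<comment> \<open>The group elements that are 1 modulo the ideal;
    \<open>g h - 1 = g (h - 1) + (g - 1)\<close> makes them closed under products.\<close>
  define J where "J = {g \<in> carrier S1. S1.single g 1 \<ominus>\<^bsub>\<Lambda>1\<^esub> \<one>\<^bsub>\<Lambda>1\<^esub> \<in> I}"
  have J_mult: "g * h \<in> J" if "g \<in> J" "h \<in> J" for g h
  proof -
    have gh: "g \<in> carrier S1" "h \<in> carrier S1" using that by (simp_all add: J_def)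
    then have c: "S1.single g 1 \<in> carrier \<Lambda>1" "S1.single h 1 \<in> carrier \<Lambda>1" by (simp_all add: S1.single_closed)
    have "S1.single (g * h) 1 \<ominus>\<^bsub>\<Lambda>1\<^esub> \<one>\<^bsub>\<Lambda>1\<^esub> = S1.single g 1 \<otimes>\<^bsub>\<Lambda>1\<^esub> (S1.single h 1 \<ominus>\<^bsub>\<Lambda>1\<^esub> \<one>\<^bsub>\<Lambda>1\<^esub>)
        \<oplus>\<^bsub>\<Lambda>1\<^esub> (S1.single g 1 \<ominus>\<^bsub>\<Lambda>1\<^esub> \<one>\<^bsub>\<Lambda>1\<^esub>)"
      using gh c S1_single_mult[of g h 1 1] S1.single_closed[OF S1_m_closed[OF gh], of 1]
      by (simp add: S1.R.minus_eq S1.R.r_distr S1.R.r_minus S1.R.a_assoc S1.R.r_neg1 S1.R.r_neg2)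
    then show ?thesis
      using that c S1_m_closed gh by (auto simp: J_def intro: I_add I_mult)
  qed
  have "5 \<in> J"
  proof -
    have "gamma_minus \<in> I"
      unfolding I_def by (rule image_eqI[of _ _ "(\<zero>\<^bsub>\<Lambda>1\<^esub>, \<one>\<^bsub>\<Lambda>1\<^esub>)"]) (simp_all add: f_def)
    then show ?thesis
      using five_S1 by (simp add: J_def gamma_minus_def \<gamma>_def)
  qed
  have "1 \<in> J"
    using I_zero by (simp add: J_def S1.R.minus_eq S1.R.r_neg flip: S1_one_eq_single)
  have "-1 \<in> J"
  proof -
    have "sigma_minus \<in> I"
      unfolding I_def by (rule image_eqI[of _ _ "(\<one>\<^bsub>\<Lambda>1\<^esub>, \<zero>\<^bsub>\<Lambda>1\<^esub>)"]) (simp_all add: f_def)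
    then show ?thesis
      using minus_one_S1 by (simp add: J_def sigma_minus_def \<sigma>_def)
  qed
  have power: "5 ^ j \<in> J" for j
    by (induction j) (use \<open>1 \<in> J\<close> \<open>5 \<in> J\<close> J_mult in auto)
  have neg_power: "- (5 ^ j) \<in> J" for j
    using J_mult[OF \<open>-1 \<in> J\<close> power[of j]] by simp
  have "\<exists>w\<in>topspace ?W. f w = x"
  proof (rule S1_solve)
    show "compact_space ?W"
      using profinite_space_prod_topology[OF S1.profinite_space_\<Lambda> S1.profinite_space_\<Lambda>] by (simp add: profinite_space_def)
    show "continuous_map ?W (ring_top \<Lambda>1) f"
      unfolding f_def
      by (intro S1.continuous_map_\<Lambda>_add S1.continuous_map_\<Lambda>_mult continuous_map_fst continuous_map_snd)
        (simp_all add: S1.topspace_ring_top)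
    fix n
    have "\<exists>y\<in>carrier \<Lambda>1. (\<forall>c\<in>carrier (S1 Mod U1 n). y (U1 n) c = x (U1 n) c) \<and>
        y \<ominus>\<^bsub>\<Lambda>1\<^esub> S1.single \<one>\<^bsub>S1\<^esub> (sum (x (U1 n)) (carrier (S1 Mod U1 n))) \<in> I"
    proof (rule S1.approximate_modulo_ideal[OF U1_open_normal I_closed I_zero I_add I_mult])
      fix c assume "c \<in> carrier (S1 Mod U1 n)"
      then obtain g where g: "g \<in> carrier S1" "c = U1 n #>\<^bsub>S1\<^esub> g" by (auto simp: S1.carrier_Mod)
      obtain h where "h \<in> J" "residue g n = residue h n"
        using S1_generators[OF g(1), of n] power neg_power by metis
      then show "\<exists>h\<in>carrier S1. U1 n #>\<^bsub>S1\<^esub> h = c \<and> S1.single h 1 \<ominus>\<^bsub>\<Lambda>1\<^esub> \<one>\<^bsub>\<Lambda>1\<^esub> \<in> I"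
        using g by (intro bexI[of _ h]) (auto simp: J_def coset_U1_eq_iff)
    qed
    then obtain y where y: "y \<in> carrier \<Lambda>1" "\<And>c. c \<in> carrier (S1 Mod U1 n) \<Longrightarrow> y (U1 n) c = x (U1 n) c"
      "y \<ominus>\<^bsub>\<Lambda>1\<^esub> S1.single \<one>\<^bsub>S1\<^esub> 0 \<in> I"
      using eval_0_eq_total_mass[OF x(1) U1_open_normal, of n] x(2) by auto
    have "y \<in> I"
      using y(3) y(1) by (simp add: S1.R.minus_eq flip: S1_zero_eq_single)
    then obtain w where "w \<in> carrier \<Lambda>1 \<times> carrier \<Lambda>1" "y = f w" unfolding I_def by blast
    moreover have "y (U1 n) = x (U1 n)"
      using y x by (intro S1_component_eqI) (auto simp: S1.coset_in_Mod)
    ultimately show "\<exists>w\<in>topspace ?W. f w (U1 n) = x (U1 n)"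
      by (auto simp: S1.topspace_ring_top)
  qed (fact x(1))
  then show ?thesis
    by (auto simp: f_def S1.topspace_ring_top)
qed

section \<open>A projective resolution of the trivial module\<close>

text \<open>The constant hides the character, whose value \<open>g [^] 0\<close> the simplifier would rewrite to 1.\<close>

definition chi :: "int \<Rightarrow> z2adic cga \<Rightarrow> z2adic" where
  "chi k = continuous_character.eval S1 S1_top (\<lambda>g. g [^]\<^bsub>S1\<^esub> k)"

lemmas chi_add = character.eval_add[folded chi_def]
  and chi_mult = character.eval_mult[folded chi_def]
  and chi_one = character.eval_one[folded chi_def]
  and chi_single = character.eval_single[folded chi_def]

text \<open>Free of rank 2, or of rank 1 for \<open>n = 0\<close>, where the second summand is
  reduced to zero. Pairs in every degree keep one element type for the whole resolution.\<close>

definition free_module :: "nat \<Rightarrow> (z2adic cga, z2adic cga \<times> z2adic cga) top_module" where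
  "free_module n = (let C = carrier \<Lambda>1 \<times> (if n = 0 then {\<zero>\<^bsub>\<Lambda>1\<^esub>} else carrier \<Lambda>1) in
     \<lparr>carrier = C, monoid.mult = (\<lambda>x y. x), one = (\<zero>\<^bsub>\<Lambda>1\<^esub>, \<zero>\<^bsub>\<Lambda>1\<^esub>), ring.zero = (\<zero>\<^bsub>\<Lambda>1\<^esub>, \<zero>\<^bsub>\<Lambda>1\<^esub>),
      add = (\<lambda>p q. (fst p \<oplus>\<^bsub>\<Lambda>1\<^esub> fst q, snd p \<oplus>\<^bsub>\<Lambda>1\<^esub> snd q)),
      smult = (\<lambda>r p. (r \<otimes>\<^bsub>\<Lambda>1\<^esub> fst p, r \<otimes>\<^bsub>\<Lambda>1\<^esub> snd p)),
      mod_top = subtopology (prod_topology (ring_top \<Lambda>1) (ring_top \<Lambda>1)) C\<rparr>)"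

lemma free_module_simps [simp]:
  "carrier (free_module n) = carrier \<Lambda>1 \<times> (if n = 0 then {\<zero>\<^bsub>\<Lambda>1\<^esub>} else carrier \<Lambda>1)"
  "p \<oplus>\<^bsub>free_module n\<^esub> q = (fst p \<oplus>\<^bsub>\<Lambda>1\<^esub> fst q, snd p \<oplus>\<^bsub>\<Lambda>1\<^esub> snd q)"
  "r \<odot>\<^bsub>free_module n\<^esub> p = (r \<otimes>\<^bsub>\<Lambda>1\<^esub> fst p, r \<otimes>\<^bsub>\<Lambda>1\<^esub> snd p)"
  "\<zero>\<^bsub>free_module n\<^esub> = (\<zero>\<^bsub>\<Lambda>1\<^esub>, \<zero>\<^bsub>\<Lambda>1\<^esub>)"
  "mod_top (free_module n) =
     subtopology (prod_topology (ring_top \<Lambda>1) (ring_top \<Lambda>1)) (carrier \<Lambda>1 \<times> (if n = 0 then {\<zero>\<^bsub>\<Lambda>1\<^esub>} else carrier \<Lambda>1))"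
  by (simp_all add: free_module_def Let_def)

lemma free_module_carrier_subset: "carrier (free_module n) \<subseteq> carrier \<Lambda>1 \<times> carrier \<Lambda>1"
  by auto

lemma free_module_topspace: "topspace (mod_top (free_module n)) = carrier (free_module n)"
  by (auto simp: S1.topspace_ring_top split: if_splits)

lemma continuous_map_free_module_fst: "continuous_map (mod_top (free_module n)) (ring_top \<Lambda>1) fst"
  and continuous_map_free_module_snd: "continuous_map (mod_top (free_module n)) (ring_top \<Lambda>1) snd"
  by (auto intro: continuous_map_from_subtopology continuous_map_fst continuous_map_snd)

lemma continuous_map_into_free_module:
  assumes "continuous_map W (ring_top \<Lambda>1) f" "continuous_map W (ring_top \<Lambda>1) g"
    and "\<And>w. w \<in> topspace W \<Longrightarrow> (f w, g w) \<in> carrier (free_module n)"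
  shows "continuous_map W (mod_top (free_module n)) (\<lambda>w. (f w, g w))"
  using assms(3) unfolding free_module_simps
  by (intro continuous_map_into_subtopology continuous_map_pairedI assms(1,2)) auto

lemma abelian_group_free_module: "abelian_group (free_module n)"
proof (rule abelian_groupI)
  show "\<exists>q\<in>carrier (free_module n). q \<oplus>\<^bsub>free_module n\<^esub> p = \<zero>\<^bsub>free_module n\<^esub>"
    if "p \<in> carrier (free_module n)" for p
    using that by (intro bexI[of _ "(\<ominus>\<^bsub>\<Lambda>1\<^esub> fst p, \<ominus>\<^bsub>\<Lambda>1\<^esub> snd p)"]) (auto simp: S1.R.l_neg split: if_splits)
qed (auto simp: S1.R.a_ac split: if_splits)

lemma module_free_module: "module \<Lambda>1 (free_module n)"
  by (rule moduleI[OF S1.cring_\<Lambda> abelian_group_free_module])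
    (auto simp: S1.R.l_distr S1.R.r_distr S1.R.m_assoc split: if_splits)

lemma a_inv_free_module:
  assumes "p \<in> carrier (free_module n)"
  shows "\<ominus>\<^bsub>free_module n\<^esub> p = (\<ominus>\<^bsub>\<Lambda>1\<^esub> fst p, \<ominus>\<^bsub>\<Lambda>1\<^esub> snd p)"
proof -
  interpret F: abelian_group "free_module n" by (rule abelian_group_free_module)
  show ?thesis
    using assms by (intro F.minus_equality) (auto simp: S1.R.l_neg split: if_splits)
qed

lemma profinite_free_module: "profinite_module \<Lambda>1 (free_module n)"
  unfolding profinite_module_def
proof (intro conjI module_free_module free_module_topspace)
  interpret F: module \<Lambda>1 "free_module n" by (rule module_free_module)
  let ?T = "mod_top (free_module n)"
  note top = free_module_topspace S1.topspace_ring_top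
  have "closedin (ring_top \<Lambda>1) {\<zero>\<^bsub>\<Lambda>1\<^esub>}"
    using S1.profinite_space_\<Lambda> by (intro closedin_Hausdorff_singleton) (auto simp: profinite_space_def S1.topspace_ring_top)
  moreover have "closedin (ring_top \<Lambda>1) (carrier \<Lambda>1)"
    using closedin_topspace[of "ring_top \<Lambda>1"] by (simp add: S1.topspace_ring_top)
  ultimately show "profinite_space ?T"
    unfolding free_module_simps
    by (intro profinite_space_subtopology profinite_space_prod_topology S1.profinite_space_\<Lambda>)
      (simp add: closedin_prod_Times_iff)
  note fst1 = continuous_map_compose[OF continuous_map_fst continuous_map_free_module_fst, unfolded o_def]
  note snd1 = continuous_map_compose[OF continuous_map_fst continuous_map_free_module_snd, unfolded o_def]
  note fst2 = continuous_map_compose[OF continuous_map_snd continuous_map_free_module_fst, unfolded o_def]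
  note snd2 = continuous_map_compose[OF continuous_map_snd continuous_map_free_module_snd, unfolded o_def]
  have "continuous_map (prod_topology ?T ?T) ?T
      (\<lambda>z. (fst (fst z) \<oplus>\<^bsub>\<Lambda>1\<^esub> fst (snd z), snd (fst z) \<oplus>\<^bsub>\<Lambda>1\<^esub> snd (snd z)))"
    by (intro continuous_map_into_free_module S1.continuous_map_\<Lambda>_add fst1 snd1 fst2 snd2)
      (auto simp: top simp del: free_module_simps(5) split: if_splits)
  then show "continuous_map (prod_topology ?T ?T) ?T (\<lambda>(p, q). p \<oplus>\<^bsub>free_module n\<^esub> q)"
    by (simp add: case_prod_unfold del: free_module_simps(5))
  have "continuous_map (prod_topology (ring_top \<Lambda>1) ?T) ?T
      (\<lambda>z. (fst z \<otimes>\<^bsub>\<Lambda>1\<^esub> fst (snd z), fst z \<otimes>\<^bsub>\<Lambda>1\<^esub> snd (snd z)))"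
    by (intro continuous_map_into_free_module S1.continuous_map_\<Lambda>_mult continuous_map_fst fst2 snd2)
      (auto simp: top simp del: free_module_simps(5) split: if_splits)
  then show "continuous_map (prod_topology (ring_top \<Lambda>1) ?T) ?T (\<lambda>(r, p). r \<odot>\<^bsub>free_module n\<^esub> p)"
    by (simp add: case_prod_unfold del: free_module_simps(5))
  have "continuous_map ?T ?T (\<lambda>p. (\<ominus>\<^bsub>\<Lambda>1\<^esub> fst p, \<ominus>\<^bsub>\<Lambda>1\<^esub> snd p))"
    by (intro continuous_map_into_free_module S1.continuous_map_\<Lambda>_minus continuous_map_free_module_fst
        continuous_map_free_module_snd) (auto simp: top simp del: free_module_simps(5) split: if_splits)
  then show "continuous_map ?T ?T (\<lambda>p. \<ominus>\<^bsub>free_module n\<^esub> p)"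
    by (rule continuous_map_eq) (simp only: top a_inv_free_module)
qed

text \<open>Set to 0 for \<open>n = 0\<close>, so that \<open>free_module_hom_eq\<close> reads the
  same in all degrees.\<close>

definition second_generator :: "nat \<Rightarrow> z2adic cga \<times> z2adic cga" where
  "second_generator n = (\<zero>\<^bsub>\<Lambda>1\<^esub>, if n = 0 then \<zero>\<^bsub>\<Lambda>1\<^esub> else \<one>\<^bsub>\<Lambda>1\<^esub>)"

lemma generators_closed:
  "(\<one>\<^bsub>\<Lambda>1\<^esub>, \<zero>\<^bsub>\<Lambda>1\<^esub>) \<in> carrier (free_module n)" "second_generator n \<in> carrier (free_module n)"
  by (auto simp: second_generator_def)

lemma free_module_hom:
  assumes N: "profinite_module \<Lambda>1 N" and m: "m1 \<in> carrier N" "m2 \<in> carrier N"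
  shows "(\<lambda>p\<in>carrier (free_module n). fst p \<odot>\<^bsub>N\<^esub> m1 \<oplus>\<^bsub>N\<^esub> snd p \<odot>\<^bsub>N\<^esub> m2) \<in> continuous_hom \<Lambda>1 (free_module n) N"
proof -
  interpret N: module \<Lambda>1 N using N by (rule profinite_module_module)
  show ?thesis
  proof (intro continuous_homI free_module_topspace module_free_module)
    fix p q assume "p \<in> carrier (free_module n)" "q \<in> carrier (free_module n)"
    then have "fst p \<in> carrier \<Lambda>1" "snd p \<in> carrier \<Lambda>1" "fst q \<in> carrier \<Lambda>1" "snd q \<in> carrier \<Lambda>1"
      using free_module_carrier_subset by (auto split: if_splits)
    then show "fst (p \<oplus>\<^bsub>free_module n\<^esub> q) \<odot>\<^bsub>N\<^esub> m1 \<oplus>\<^bsub>N\<^esub> snd (p \<oplus>\<^bsub>free_module n\<^esub> q) \<odot>\<^bsub>N\<^esub> m2 =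
        fst p \<odot>\<^bsub>N\<^esub> m1 \<oplus>\<^bsub>N\<^esub> snd p \<odot>\<^bsub>N\<^esub> m2 \<oplus>\<^bsub>N\<^esub> (fst q \<odot>\<^bsub>N\<^esub> m1 \<oplus>\<^bsub>N\<^esub> snd q \<odot>\<^bsub>N\<^esub> m2)"
      using m by (simp add: N.smult_l_distr N.a_ac)
  next
    fix r p assume r: "r \<in> carrier \<Lambda>1" and "p \<in> carrier (free_module n)"
    then have "fst p \<in> carrier \<Lambda>1" "snd p \<in> carrier \<Lambda>1"
      using free_module_carrier_subset by (auto split: if_splits)
    with r show "fst (r \<odot>\<^bsub>free_module n\<^esub> p) \<odot>\<^bsub>N\<^esub> m1 \<oplus>\<^bsub>N\<^esub> snd (r \<odot>\<^bsub>free_module n\<^esub> p) \<odot>\<^bsub>N\<^esub> m2 =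
        r \<odot>\<^bsub>N\<^esub> (fst p \<odot>\<^bsub>N\<^esub> m1 \<oplus>\<^bsub>N\<^esub> snd p \<odot>\<^bsub>N\<^esub> m2)"
      using m by (simp add: N.smult_r_distr N.smult_assoc1)
  next
    show "continuous_map (mod_top (free_module n)) (mod_top N) (\<lambda>p. fst p \<odot>\<^bsub>N\<^esub> m1 \<oplus>\<^bsub>N\<^esub> snd p \<odot>\<^bsub>N\<^esub> m2)"
      using m by (intro profinite_module_continuous_add[OF N] profinite_module_continuous_smult[OF N]
          continuous_map_free_module_fst continuous_map_free_module_snd) (simp_all add: profinite_module_topspace[OF N])
  qed (use m in \<open>auto split: if_splits\<close>)
qed

lemma free_module_hom_eq:
  assumes N: "profinite_module \<Lambda>1 N" and w: "w \<in> continuous_hom \<Lambda>1 (free_module n) N" and p: "p \<in> carrier (free_module n)"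
  shows "w p = fst p \<odot>\<^bsub>N\<^esub> w (\<one>\<^bsub>\<Lambda>1\<^esub>, \<zero>\<^bsub>\<Lambda>1\<^esub>) \<oplus>\<^bsub>N\<^esub> snd p \<odot>\<^bsub>N\<^esub> w (second_generator n)"
proof -
  have c: "fst p \<in> carrier \<Lambda>1" "snd p \<in> carrier \<Lambda>1"
    using p by (auto split: if_splits)
  interpret F: module \<Lambda>1 "free_module n" by (rule module_free_module)
  have "p = fst p \<odot>\<^bsub>free_module n\<^esub> (\<one>\<^bsub>\<Lambda>1\<^esub>, \<zero>\<^bsub>\<Lambda>1\<^esub>) \<oplus>\<^bsub>free_module n\<^esub> snd p \<odot>\<^bsub>free_module n\<^esub> second_generator n"
    using c p by (auto simp: second_generator_def split: if_splits)
  then have "w p = w (fst p \<odot>\<^bsub>free_module n\<^esub> (\<one>\<^bsub>\<Lambda>1\<^esub>, \<zero>\<^bsub>\<Lambda>1\<^esub>) \<oplus>\<^bsub>free_module n\<^esub> snd p \<odot>\<^bsub>free_module n\<^esub> second_generator n)"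
    by simp
  also have "\<dots> = fst p \<odot>\<^bsub>N\<^esub> w (\<one>\<^bsub>\<Lambda>1\<^esub>, \<zero>\<^bsub>\<Lambda>1\<^esub>) \<oplus>\<^bsub>N\<^esub> snd p \<odot>\<^bsub>N\<^esub> w (second_generator n)"
    using continuous_homD(3,4)[OF w] c generators_closed F.smult_closed by metis
  finally show ?thesis .
qed

text \<open>The differentials are those of the total complex of the tensor product of the periodic
  resolution for the subgroup generated by -1, with differentials \<open>diff_coeff n\<close>, and the Koszul
  complex of \<open>\<gamma> - 1\<close>. At \<open>n = 0\<close> the coefficient is 0, matching the missing second summand.\<close>

definition diff_coeff :: "nat \<Rightarrow> z2adic cga" where
  "diff_coeff n = (if n = 0 then \<zero>\<^bsub>\<Lambda>1\<^esub> else if odd n then sigma_minus else sigma_plus)"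

text \<open>The alternating sign is that of a total complex: it makes the two mixed terms of the
  squared differential cancel.\<close>

definition koszul_coeff :: "nat \<Rightarrow> z2adic cga" where
  "koszul_coeff n = (if even n then gamma_minus else \<ominus>\<^bsub>\<Lambda>1\<^esub> gamma_minus)"

text \<open>In degree \<open>n + 1\<close> the first coordinate has degree \<open>n + 1\<close> in
  the periodic complex and 0 in the Koszul complex; the second has degrees \<open>n\<close> and
  1.\<close>

definition differential :: "nat \<Rightarrow> z2adic cga \<times> z2adic cga \<Rightarrow> z2adic cga \<times> z2adic cga" where
  "differential n = (\<lambda>p\<in>carrier (free_module (Suc n)).
     (diff_coeff (Suc n) \<otimes>\<^bsub>\<Lambda>1\<^esub> fst p \<oplus>\<^bsub>\<Lambda>1\<^esub> koszul_coeff n \<otimes>\<^bsub>\<Lambda>1\<^esub> snd p, diff_coeff n \<otimes>\<^bsub>\<Lambda>1\<^esub> snd p))"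

lemma coeff_closed [simp]: "diff_coeff n \<in> carrier \<Lambda>1" "koszul_coeff n \<in> carrier \<Lambda>1"
  by (simp_all add: diff_coeff_def koszul_coeff_def)

lemma diff_coeff_mult: "diff_coeff n \<otimes>\<^bsub>\<Lambda>1\<^esub> diff_coeff (Suc n) = \<zero>\<^bsub>\<Lambda>1\<^esub>"
  by (simp add: diff_coeff_def sigma_plus_minus sigma_minus_plus)

lemma koszul_coeff_Suc: "koszul_coeff (Suc n) = \<ominus>\<^bsub>\<Lambda>1\<^esub> koszul_coeff n"
  by (simp add: koszul_coeff_def)

lemma kernel_diff_coeff:
  assumes "x \<in> carrier \<Lambda>1" "diff_coeff (Suc n) \<otimes>\<^bsub>\<Lambda>1\<^esub> x = \<zero>\<^bsub>\<Lambda>1\<^esub>"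
  obtains y where "y \<in> carrier \<Lambda>1" "x = diff_coeff (Suc (Suc n)) \<otimes>\<^bsub>\<Lambda>1\<^esub> y"
  using assms kernel_sigma_minus kernel_sigma_plus by (cases "even n") (auto simp: diff_coeff_def)

lemma kernel_koszul_coeff:
  assumes "x \<in> carrier \<Lambda>1" "koszul_coeff n \<otimes>\<^bsub>\<Lambda>1\<^esub> x = \<zero>\<^bsub>\<Lambda>1\<^esub>"
  shows "x = \<zero>\<^bsub>\<Lambda>1\<^esub>"
proof (rule gamma_minus_injective[OF assms(1)])
  show "gamma_minus \<otimes>\<^bsub>\<Lambda>1\<^esub> x = \<zero>\<^bsub>\<Lambda>1\<^esub>"
    using assms by (auto simp: koszul_coeff_def S1.R.l_minus S1.R.add.inv_eq_1_iff split: if_splits)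
qed

lemma differential_closed: "p \<in> carrier (free_module (Suc n)) \<Longrightarrow> differential n p \<in> carrier (free_module n)"
  by (auto simp: differential_def diff_coeff_def)

lemma differential_hom: "differential n \<in> continuous_hom \<Lambda>1 (free_module (Suc n)) (free_module n)"
  unfolding differential_def
proof (intro continuous_homI free_module_topspace module_free_module)
  show "(diff_coeff (Suc n) \<otimes>\<^bsub>\<Lambda>1\<^esub> fst p \<oplus>\<^bsub>\<Lambda>1\<^esub> koszul_coeff n \<otimes>\<^bsub>\<Lambda>1\<^esub> snd p, diff_coeff n \<otimes>\<^bsub>\<Lambda>1\<^esub> snd p) \<in> carrier (free_module n)"
    if "p \<in> carrier (free_module (Suc n))" for p
    using differential_closed[OF that] that by (simp add: differential_def)
  then show "continuous_map (mod_top (free_module (Suc n))) (mod_top (free_module n))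
      (\<lambda>p. (diff_coeff (Suc n) \<otimes>\<^bsub>\<Lambda>1\<^esub> fst p \<oplus>\<^bsub>\<Lambda>1\<^esub> koszul_coeff n \<otimes>\<^bsub>\<Lambda>1\<^esub> snd p, diff_coeff n \<otimes>\<^bsub>\<Lambda>1\<^esub> snd p))"
    by (intro continuous_map_into_free_module S1.continuous_map_\<Lambda>_add S1.continuous_map_\<Lambda>_mult
        continuous_map_free_module_fst continuous_map_free_module_snd)
      (simp_all only: free_module_topspace, simp_all add: S1.topspace_ring_top)
qed (auto simp: S1.R.r_distr S1.R.a_ac S1.R.m_lcomm)

lemma differential_differential:
  assumes "p \<in> carrier (free_module (Suc (Suc n)))"
  shows "differential n (differential (Suc n) p) = \<zero>\<^bsub>free_module n\<^esub>"
proof -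
  obtain x y where p: "p = (x, y)" "x \<in> carrier \<Lambda>1" "y \<in> carrier \<Lambda>1"
    using assms by auto
  have D: "diff_coeff k \<otimes>\<^bsub>\<Lambda>1\<^esub> (diff_coeff (Suc k) \<otimes>\<^bsub>\<Lambda>1\<^esub> z) = \<zero>\<^bsub>\<Lambda>1\<^esub>" if "z \<in> carrier \<Lambda>1" for k z
    using that by (simp add: diff_coeff_mult flip: S1.R.m_assoc)
  have "diff_coeff (Suc n) \<otimes>\<^bsub>\<Lambda>1\<^esub> (koszul_coeff (Suc n) \<otimes>\<^bsub>\<Lambda>1\<^esub> y) \<oplus>\<^bsub>\<Lambda>1\<^esub> koszul_coeff n \<otimes>\<^bsub>\<Lambda>1\<^esub> (diff_coeff (Suc n) \<otimes>\<^bsub>\<Lambda>1\<^esub> y) = \<zero>\<^bsub>\<Lambda>1\<^esub>"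
    using p by (simp add: koszul_coeff_Suc S1.R.l_minus S1.R.r_minus S1.R.m_lcomm S1.R.l_neg)
  then show ?thesis
    using p by (simp add: differential_def D S1.R.r_distr)
qed

text \<open>The second coordinate is lifted through the periodic complex first. The correction by
  \<open>koszul_coeff n\<close> then makes the first coordinate a cycle there, which is lifted in
  turn, and the sign in \<open>koszul_coeff_Suc\<close> makes the two lifts fit together.\<close>

lemma differential_exact:
  assumes p: "p \<in> carrier (free_module (Suc n))" and 0: "differential n p = \<zero>\<^bsub>free_module n\<^esub>"
  shows "\<exists>q\<in>carrier (free_module (Suc (Suc n))). differential (Suc n) q = p"
proof -
  obtain x y where xy: "p = (x, y)" "x \<in> carrier \<Lambda>1" "y \<in> carrier \<Lambda>1"
    using p by auto
  have d: "diff_coeff (Suc n) \<otimes>\<^bsub>\<Lambda>1\<^esub> x \<oplus>\<^bsub>\<Lambda>1\<^esub> koszul_coeff n \<otimes>\<^bsub>\<Lambda>1\<^esub> y = \<zero>\<^bsub>\<Lambda>1\<^esub>" "diff_coeff n \<otimes>\<^bsub>\<Lambda>1\<^esub> y = \<zero>\<^bsub>\<Lambda>1\<^esub>"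
    using p 0 xy by (auto simp: differential_def)
  obtain y' where y': "y' \<in> carrier \<Lambda>1" "y = diff_coeff (Suc n) \<otimes>\<^bsub>\<Lambda>1\<^esub> y'"
  proof (cases n)
    case 0
    \<comment> \<open>Here \<open>diff_coeff 0 = 0\<close> says nothing about \<open>y\<close>.
      Multiplying the other equation by \<open>\<sigma> + 1\<close> removes \<open>x\<close>, and
      injectivity of \<open>\<gamma> - 1\<close> gives \<open>(\<sigma> + 1) y = 0\<close>.\<close>
    have "\<zero>\<^bsub>\<Lambda>1\<^esub> = diff_coeff 2 \<otimes>\<^bsub>\<Lambda>1\<^esub> (diff_coeff 1 \<otimes>\<^bsub>\<Lambda>1\<^esub> x \<oplus>\<^bsub>\<Lambda>1\<^esub> koszul_coeff 0 \<otimes>\<^bsub>\<Lambda>1\<^esub> y)"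
      using d(1) xy by (simp add: 0)
    also have "\<dots> = (diff_coeff 2 \<otimes>\<^bsub>\<Lambda>1\<^esub> diff_coeff 1) \<otimes>\<^bsub>\<Lambda>1\<^esub> x \<oplus>\<^bsub>\<Lambda>1\<^esub> koszul_coeff 0 \<otimes>\<^bsub>\<Lambda>1\<^esub> (diff_coeff 2 \<otimes>\<^bsub>\<Lambda>1\<^esub> y)"
      using xy by (simp add: S1.R.r_distr S1.R.m_ac)
    also have "diff_coeff 2 \<otimes>\<^bsub>\<Lambda>1\<^esub> diff_coeff 1 = \<zero>\<^bsub>\<Lambda>1\<^esub>"
      by (simp add: diff_coeff_def sigma_plus_minus)
    finally have "koszul_coeff 0 \<otimes>\<^bsub>\<Lambda>1\<^esub> (diff_coeff 2 \<otimes>\<^bsub>\<Lambda>1\<^esub> y) = \<zero>\<^bsub>\<Lambda>1\<^esub>"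
      using xy by simp
    then have "sigma_plus \<otimes>\<^bsub>\<Lambda>1\<^esub> y = \<zero>\<^bsub>\<Lambda>1\<^esub>"
      using kernel_koszul_coeff[of "diff_coeff 2 \<otimes>\<^bsub>\<Lambda>1\<^esub> y" 0] xy by (simp add: diff_coeff_def)
    then show thesis
      using kernel_sigma_plus[OF xy(3)] that by (auto simp: 0 diff_coeff_def)
  next
    case (Suc k)
    then show thesis
      using kernel_diff_coeff[OF xy(3)] d(2) that by metis
  qed
  have "diff_coeff (Suc n) \<otimes>\<^bsub>\<Lambda>1\<^esub> (x \<oplus>\<^bsub>\<Lambda>1\<^esub> koszul_coeff n \<otimes>\<^bsub>\<Lambda>1\<^esub> y') = \<zero>\<^bsub>\<Lambda>1\<^esub>"
    using d(1) xy y' by (simp add: S1.R.r_distr S1.R.m_lcomm)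
  then obtain x' where x': "x' \<in> carrier \<Lambda>1" "x \<oplus>\<^bsub>\<Lambda>1\<^esub> koszul_coeff n \<otimes>\<^bsub>\<Lambda>1\<^esub> y' = diff_coeff (Suc (Suc n)) \<otimes>\<^bsub>\<Lambda>1\<^esub> x'"
    by (rule kernel_diff_coeff[rotated]) (use xy y' in auto)
  have "differential (Suc n) (x', y') = p"
    using xy x'(1) y' by (simp add: differential_def koszul_coeff_Suc S1.R.l_minus S1.R.a_assoc S1.R.r_neg flip: x'(2))
  then show ?thesis
    using x' y' by (intro bexI[of _ "(x', y')"]) auto
qed

section \<open>The augmentation onto the trivial module\<close>

lemma profinite_Z2_module: "profinite_module Z2_top_ring Z2_module"
proof -
  have simps: "carrier Z2_module = UNIV" "a \<oplus>\<^bsub>Z2_module\<^esub> b = a + b" "\<zero>\<^bsub>Z2_module\<^esub> = 0" "a \<odot>\<^bsub>Z2_module\<^esub> b = a * b"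
    "mod_top Z2_module = euclidean" for a b
    by (simp_all add: Z2_module_def)
  have group: "abelian_group Z2_module"
  proof (rule abelian_groupI)
    show "\<exists>y\<in>carrier Z2_module. y \<oplus>\<^bsub>Z2_module\<^esub> x = \<zero>\<^bsub>Z2_module\<^esub>" for x
      by (rule bexI[of _ "- x"]) (auto simp: simps)
  qed (auto simp: simps algebra_simps)
  interpret abelian_group Z2_module by fact
  have "a_inv Z2_module = uminus"
    by (rule ext, rule minus_equality) (auto simp: simps)
  moreover have "module Z2_top_ring Z2_module"
    by (rule moduleI[OF cring_Z2_top_ring group]) (auto simp: simps algebra_simps)
  ultimately show ?thesis
    unfolding profinite_module_def simps
    using continuous_map_z2adic_add[OF continuous_map_fst continuous_map_snd]
      continuous_map_z2adic_mult[OF continuous_map_fst continuous_map_snd]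
      continuous_map_z2adic_minus[of euclidean "\<lambda>x. x"]
    by (simp add: profinite_space_z2adic case_prod_unfold del: euclidean_product_topology continuous_map_iff_continuous2)
qed

abbreviation trivial_module :: "(z2adic cga, z2adic) top_module" where
  "trivial_module \<equiv> cga_module S1 S1_top Z2_module (\<lambda>_ m. m)"

text \<open>The trivial action is the character with exponent 0, so the trivial module falls under
  the general treatment of characters.\<close>

lemma trivial_action: "m = (g [^]\<^bsub>S1\<^esub> (0 :: int)) \<odot>\<^bsub>Z2_module\<^esub> m"
  by (simp add: Z2_module_def)

lemma profinite_trivial_module: "profinite_module \<Lambda>1 trivial_module"
  by (rule character.profinite_cga_module[where k = 0, OF profinite_Z2_module trivial_action])

lemma smult_trivial_module: "x \<in> carrier \<Lambda>1 \<Longrightarrow> x \<odot>\<^bsub>trivial_module\<^esub> m = chi 0 x * m"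
  using character.smult_cga_module[where k = 0, OF profinite_Z2_module trivial_action, of x m, folded chi_def]
  by (simp add: Z2_module_def)

lemma trivial_module_simps [simp]:
  "carrier trivial_module = UNIV" "a \<oplus>\<^bsub>trivial_module\<^esub> b = a + b" "\<zero>\<^bsub>trivial_module\<^esub> = 0"
  by (simp_all add: cga_module_def Z2_module_def)

text \<open>The second summand is 0; in this shape the map is an instance of
  \<open>free_module_hom\<close>, which gives linearity and continuity.\<close>

definition augmentation :: "z2adic cga \<times> z2adic cga \<Rightarrow> z2adic" where
  "augmentation = (\<lambda>p\<in>carrier (free_module 0). fst p \<odot>\<^bsub>trivial_module\<^esub> 1 \<oplus>\<^bsub>trivial_module\<^esub> snd p \<odot>\<^bsub>trivial_module\<^esub> 0)"

lemma augmentation_hom: "augmentation \<in> continuous_hom \<Lambda>1 (free_module 0) trivial_module"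
  unfolding augmentation_def by (rule free_module_hom[OF profinite_trivial_module]) simp_all

lemma augmentation_eq: "p \<in> carrier (free_module 0) \<Longrightarrow> augmentation p = chi 0 (fst p)"
  by (auto simp: augmentation_def smult_trivial_module)

lemma augmentation_surj: "augmentation ` carrier (free_module 0) = UNIV"
proof -
  have "a \<in> augmentation ` carrier (free_module 0)" for a
  proof (rule image_eqI)
    show p: "(S1.single 1 a, \<zero>\<^bsub>\<Lambda>1\<^esub>) \<in> carrier (free_module 0)"
      by (simp add: S1.single_closed)
    show "a = augmentation (S1.single 1 a, \<zero>\<^bsub>\<Lambda>1\<^esub>)"
      unfolding augmentation_eq[OF p] using chi_single[of 1 0 a] by simp
  qed
  then show ?thesis by blast
qed

lemma eval_sigma: "chi k \<sigma> = (-1) [^]\<^bsub>S1\<^esub> k" and eval_gamma: "chi k \<gamma> = 5 [^]\<^bsub>S1\<^esub> k"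
  by (simp_all add: \<sigma>_def \<gamma>_def chi_single five_S1 minus_one_S1)

lemma eval_zero: "chi k \<zero>\<^bsub>\<Lambda>1\<^esub> = 0"
  by (simp add: S1_zero_eq_single chi_single)

lemma eval_minus:
  assumes "x \<in> carrier \<Lambda>1"
  shows "chi k (\<ominus>\<^bsub>\<Lambda>1\<^esub> x) = - chi k x"
proof -
  have "chi k (\<ominus>\<^bsub>\<Lambda>1\<^esub> x) + chi k x = 0"
    using assms chi_add[of "\<ominus>\<^bsub>\<Lambda>1\<^esub> x" x k] by (simp add: S1.R.l_neg eval_zero)
  then show ?thesis by (simp add: eq_neg_iff_add_eq_0)
qed

lemma eval_sigma_minus: "chi k sigma_minus = (-1) [^]\<^bsub>S1\<^esub> k - 1"
  and eval_sigma_plus: "chi k sigma_plus = (-1) [^]\<^bsub>S1\<^esub> k + 1"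
  and eval_gamma_minus: "chi k gamma_minus = 5 [^]\<^bsub>S1\<^esub> k - 1"
  by (simp_all add: sigma_minus_def sigma_plus_def gamma_minus_def S1.R.minus_eq chi_add eval_minus
      eval_sigma eval_gamma chi_one)

lemma augmentation_differential:
  assumes "p \<in> carrier (free_module (Suc 0))"
  shows "augmentation (differential 0 p) = 0"
proof -
  obtain x y where p: "p = (x, y)" "x \<in> carrier \<Lambda>1" "y \<in> carrier \<Lambda>1"
    using assms by auto
  have "fst (differential 0 p) = sigma_minus \<otimes>\<^bsub>\<Lambda>1\<^esub> x \<oplus>\<^bsub>\<Lambda>1\<^esub> gamma_minus \<otimes>\<^bsub>\<Lambda>1\<^esub> y"
    using p by (simp add: differential_def diff_coeff_def koszul_coeff_def)
  moreover have "chi 0 (sigma_minus \<otimes>\<^bsub>\<Lambda>1\<^esub> x \<oplus>\<^bsub>\<Lambda>1\<^esub> gamma_minus \<otimes>\<^bsub>\<Lambda>1\<^esub> y) = 0"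
    using p
    by (simp add: chi_add chi_mult eval_sigma_minus eval_gamma_minus)
  ultimately show ?thesis
    by (simp add: augmentation_eq[OF differential_closed[OF assms]])
qed

lemma augmentation_exact:
  assumes p: "p \<in> carrier (free_module 0)" and 0: "augmentation p = 0"
  shows "\<exists>q\<in>carrier (free_module (Suc 0)). differential 0 q = p"
proof -
  obtain x where x: "p = (x, \<zero>\<^bsub>\<Lambda>1\<^esub>)" "x \<in> carrier \<Lambda>1"
    using p by auto
  then have "chi 0 x = 0"
    using augmentation_eq[OF p] 0 by simp
  then obtain y z where "y \<in> carrier \<Lambda>1" "z \<in> carrier \<Lambda>1" "x = sigma_minus \<otimes>\<^bsub>\<Lambda>1\<^esub> y \<oplus>\<^bsub>\<Lambda>1\<^esub> gamma_minus \<otimes>\<^bsub>\<Lambda>1\<^esub> z"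
    using kernel_augmentation[folded chi_def, OF x(2)] by blast
  then show ?thesis
    using x by (intro bexI[of _ "(y, z)"]) (auto simp: differential_def diff_coeff_def koszul_coeff_def)
qed

section \<open>The resolution inside the universe\<close>

text \<open>An element is determined by its values at the levels \<open>U1 n\<close>, each coset
  there is that of an integer, and a 2-adic value is determined by its residues. That is a countable
  amount of integer data, hence a sequence of bits, hence one 2-adic integer.\<close>

lemma exists_injection_\<Lambda>_pairs:
  "\<exists>c :: z2adic cga \<times> z2adic cga \<Rightarrow> z2adic. inj_on c (carrier \<Lambda>1 \<times> carrier \<Lambda>1)"
proof -
  let ?x = "\<lambda>b n a p. (if b then fst p else snd p) (U1 n) (U1 n #>\<^bsub>S1\<^esub> of_int a) :: z2adic"
  \<comment> \<open>The bits encode a graph: the bit at the code of \<open>(b, n, a, m, v)\<close>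
    tells whether the residue modulo \<open>2 ^ m\<close> of the value in question is
    \<open>v\<close>.\<close>
  define B :: "z2adic cga \<times> z2adic cga \<Rightarrow> nat \<Rightarrow> bool" where
    "B p i = (case from_nat i :: bool \<times> nat \<times> int \<times> nat \<times> int of (b, n, a, m, v) \<Rightarrow> residue (?x b n a p) m = v)" for p i
  have "inj_on (\<lambda>p. of_bits (B p)) (carrier \<Lambda>1 \<times> carrier \<Lambda>1)"
  proof (rule inj_onI)
    fix p q assume pq: "p \<in> carrier \<Lambda>1 \<times> carrier \<Lambda>1" "q \<in> carrier \<Lambda>1 \<times> carrier \<Lambda>1" "of_bits (B p) = of_bits (B q)"
    have "B p = B q"
      using pq(3) injD[OF inj_of_bits] by blast
    then have "B p (to_nat (b, n, a, m, residue (?x b n a p) m)) = B q (to_nat (b, n, a, m, residue (?x b n a p) m))" for b n a m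
      by simp
    then have "residue (?x b n a p) m = residue (?x b n a q) m" for b n a m
      by (simp add: B_def)
    then have eq: "?x b n a p = ?x b n a q" for b n a
      by (rule z2adic_eqI)
    have "x = y" if x: "x \<in> carrier \<Lambda>1" and y: "y \<in> carrier \<Lambda>1"
      and xy: "\<And>n a. x (U1 n) (U1 n #>\<^bsub>S1\<^esub> of_int a) = y (U1 n) (U1 n #>\<^bsub>S1\<^esub> of_int a)" for x y
    proof (rule S1.\<Lambda>_eqI[OF x y])
      fix V assume V: "V \<in> open_normal_subgroups S1 S1_top"
      obtain n where n: "U1 n \<subseteq> V" using U1_cofinal[OF V] by blast
      have "x (U1 (Suc n)) = y (U1 (Suc n))"
      proof (rule S1_component_eqI[OF x y])
        fix g assume g: "g \<in> carrier S1"
        have "residue (of_int (residue g (Suc n))) (Suc n) = residue g (Suc n)"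
          by (rule residue_of_int_residue) simp
        moreover have "of_int (residue g (Suc n)) \<in> carrier S1"
          using g residue_of_int_residue[of 1 "Suc n" g] by (simp add: carrier_S1)
        ultimately have "U1 (Suc n) #>\<^bsub>S1\<^esub> g = U1 (Suc n) #>\<^bsub>S1\<^esub> of_int (residue g (Suc n))"
          using g by (simp add: coset_U1_eq_iff)
        then show "x (U1 (Suc n)) (U1 (Suc n) #>\<^bsub>S1\<^esub> g) = y (U1 (Suc n)) (U1 (Suc n) #>\<^bsub>S1\<^esub> g)"
          using xy by simp
      qed
      then show "x V = y V"
        using S1.component_mono[OF x y V U1_open_normal] n U1_mono[of n "Suc n"] by (meson le_SucI order_refl subset_trans)
    qed
    from this[of "fst p" "fst q"] this[of "snd p" "snd q"] show "p = q"
      using pq(1,2) eq[of True] eq[of False] by (auto simp: prod_eq_iff)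
  qed
  then show ?thesis by blast
qed

locale universe_embedding =
  fixes j :: "z2adic cga \<times> z2adic cga \<Rightarrow> 'u"
  assumes inj_j: "inj_on j (carrier \<Lambda>1 \<times> carrier \<Lambda>1)"
begin

definition Q :: "nat \<Rightarrow> (z2adic cga, 'u) top_module" where
  "Q n = transport_module j (free_module n)"

definition i :: "nat \<Rightarrow> 'u \<Rightarrow> z2adic cga \<times> z2adic cga" where
  "i n = inv_into (carrier (free_module n)) j"

definition dQ :: "nat \<Rightarrow> 'u \<Rightarrow> 'u" where
  "dQ n = (\<lambda>u\<in>carrier (Q (Suc n)). j (differential n (i (Suc n) u)))"

definition aQ :: "'u \<Rightarrow> z2adic" where
  "aQ = (\<lambda>u\<in>carrier (Q 0). augmentation (i 0 u))"

lemma inj_j_free: "inj_on j (carrier (free_module n))"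
  using inj_j free_module_carrier_subset by (rule inj_on_subset)

lemma carrier_Q: "carrier (Q n) = j ` carrier (free_module n)"
  by (simp add: Q_def transport_module_def Let_def)

lemma zero_Q: "\<zero>\<^bsub>Q n\<^esub> = j (\<zero>\<^bsub>\<Lambda>1\<^esub>, \<zero>\<^bsub>\<Lambda>1\<^esub>)"
  by (simp add: Q_def transport_module_def Let_def)

lemma i_j: "p \<in> carrier (free_module n) \<Longrightarrow> i n (j p) = p"
  unfolding i_def by (rule inv_into_f_f[OF inj_j_free])

lemma profinite_Q: "profinite_module \<Lambda>1 (Q n)"
  unfolding Q_def by (rule profinite_transport_module[OF profinite_free_module inj_j_free])

lemma j_hom: "restrict j (carrier (free_module n)) \<in> continuous_hom \<Lambda>1 (free_module n) (Q n)"
  unfolding Q_def by (rule transport_module_hom[OF profinite_free_module inj_j_free])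

lemma i_hom: "restrict (i n) (carrier (Q n)) \<in> continuous_hom \<Lambda>1 (Q n) (free_module n)"
  unfolding carrier_Q unfolding Q_def i_def by (rule transport_module_hom_inv[OF profinite_free_module inj_j_free])

lemma dQ_j: "p \<in> carrier (free_module (Suc n)) \<Longrightarrow> dQ n (j p) = j (differential n p)"
  by (simp add: dQ_def carrier_Q i_j)

lemma aQ_j: "p \<in> carrier (free_module 0) \<Longrightarrow> aQ (j p) = augmentation p"
  by (simp add: aQ_def carrier_Q i_j)

lemma dQ_hom: "dQ n \<in> continuous_hom \<Lambda>1 (Q (Suc n)) (Q n)"
proof -
  have "compose (carrier (Q (Suc n)))
      (compose (carrier (free_module (Suc n))) (restrict j (carrier (free_module n))) (differential n))
      (restrict (i (Suc n)) (carrier (Q (Suc n)))) \<in> continuous_hom \<Lambda>1 (Q (Suc n)) (Q n)"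
    by (intro continuous_hom_compose[OF i_hom _ profinite_Q] continuous_hom_compose[OF differential_hom j_hom profinite_free_module])
  also have "compose (carrier (Q (Suc n)))
      (compose (carrier (free_module (Suc n))) (restrict j (carrier (free_module n))) (differential n))
      (restrict (i (Suc n)) (carrier (Q (Suc n)))) = dQ n"
    using differential_closed by (force simp: fun_eq_iff compose_def dQ_def carrier_Q i_j simp del: free_module_simps)
  finally show ?thesis .
qed

lemma aQ_hom: "aQ \<in> continuous_hom \<Lambda>1 (Q 0) trivial_module"
proof -
  have "compose (carrier (Q 0)) augmentation (restrict (i 0) (carrier (Q 0))) \<in> continuous_hom \<Lambda>1 (Q 0) trivial_module"
    by (intro continuous_hom_compose[OF i_hom augmentation_hom profinite_Q])
  also have "compose (carrier (Q 0)) augmentation (restrict (i 0) (carrier (Q 0))) = aQ"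
    by (auto simp: fun_eq_iff compose_def aQ_def)
  finally show ?thesis .
qed

definition cochain :: "(z2adic cga, 'n) top_module \<Rightarrow> nat \<Rightarrow> 'n \<Rightarrow> 'n \<Rightarrow> 'u \<Rightarrow> 'n" where
  "cochain N n m1 m2 = (\<lambda>u\<in>carrier (Q n). fst (i n u) \<odot>\<^bsub>N\<^esub> m1 \<oplus>\<^bsub>N\<^esub> snd (i n u) \<odot>\<^bsub>N\<^esub> m2)"

lemma cochain_j:
  "p \<in> carrier (free_module n) \<Longrightarrow> cochain N n m1 m2 (j p) = fst p \<odot>\<^bsub>N\<^esub> m1 \<oplus>\<^bsub>N\<^esub> snd p \<odot>\<^bsub>N\<^esub> m2"
  by (simp add: cochain_def carrier_Q i_j)

lemma cochain_hom:
  assumes "profinite_module \<Lambda>1 N" "m1 \<in> carrier N" "m2 \<in> carrier N"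
  shows "cochain N n m1 m2 \<in> continuous_hom \<Lambda>1 (Q n) N"
proof -
  let ?w = "\<lambda>p\<in>carrier (free_module n). fst p \<odot>\<^bsub>N\<^esub> m1 \<oplus>\<^bsub>N\<^esub> snd p \<odot>\<^bsub>N\<^esub> m2"
  have "compose (carrier (Q n)) ?w (restrict (i n) (carrier (Q n))) \<in> continuous_hom \<Lambda>1 (Q n) N"
    by (intro continuous_hom_compose[OF i_hom _ profinite_Q] free_module_hom assms)
  also have "compose (carrier (Q n)) ?w (restrict (i n) (carrier (Q n))) = cochain N n m1 m2"
    by (auto simp: fun_eq_iff compose_def cochain_def carrier_Q i_j simp del: free_module_simps)
  finally show ?thesis .
qed

abbreviation "fst_coord z \<equiv> z (j (\<one>\<^bsub>\<Lambda>1\<^esub>, \<zero>\<^bsub>\<Lambda>1\<^esub>))"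
abbreviation "snd_coord n z \<equiv> z (j (second_generator n))"

lemma coords_closed:
  assumes "z \<in> continuous_hom \<Lambda>1 (Q n) N"
  shows "fst_coord z \<in> carrier N" "snd_coord n z \<in> carrier N"
  using continuous_homD(2)[OF assms] generators_closed[of n] by (simp_all add: carrier_Q del: free_module_simps)

lemma hom_eq:
  assumes N: "profinite_module \<Lambda>1 N" and z: "z \<in> continuous_hom \<Lambda>1 (Q n) N" and p: "p \<in> carrier (free_module n)"
  shows "z (j p) = fst p \<odot>\<^bsub>N\<^esub> fst_coord z \<oplus>\<^bsub>N\<^esub> snd p \<odot>\<^bsub>N\<^esub> snd_coord n z"
proof -
  have "compose (carrier (free_module n)) z (restrict j (carrier (free_module n))) \<in> continuous_hom \<Lambda>1 (free_module n) N"
    by (rule continuous_hom_compose[OF j_hom z profinite_free_module])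
  from free_module_hom_eq[OF N this p] show ?thesis
    using p generators_closed[of n] by (simp add: compose_def del: free_module_simps)
qed

lemma hom_eqI:
  assumes N: "profinite_module \<Lambda>1 N" and z: "z \<in> continuous_hom \<Lambda>1 (Q n) N" "w \<in> continuous_hom \<Lambda>1 (Q n) N"
    and "fst_coord z = fst_coord w" "snd_coord n z = snd_coord n w"
  shows "z = w"
  using assms hom_eq[OF N z(1)] hom_eq[OF N z(2)]
  by (intro extensionalityI[OF continuous_homD(1)[OF z(1)] continuous_homD(1)[OF z(2)]])
    (auto simp: carrier_Q simp del: free_module_simps)

text \<open>Preimages of the values at the two generators define a lift, and its continuity comes
  from that of the module operations.\<close>

lemma projective_Q: "projective_module \<Lambda>1 (Q n)"
  unfolding projective_module_def
proof (intro conjI allI impI profinite_Q)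
  fix M N :: "(z2adic cga, 'u) top_module" and f g
  assume *: "profinite_module \<Lambda>1 M \<and> profinite_module \<Lambda>1 N \<and> f \<in> continuous_hom \<Lambda>1 M N \<and>
    f ` carrier M = carrier N \<and> g \<in> continuous_hom \<Lambda>1 (Q n) N"
  then have M: "profinite_module \<Lambda>1 M" and N: "profinite_module \<Lambda>1 N" and f: "f \<in> continuous_hom \<Lambda>1 M N"
    and surj: "f ` carrier M = carrier N" and g: "g \<in> continuous_hom \<Lambda>1 (Q n) N" by blast+
  interpret M: module \<Lambda>1 M using M by (rule profinite_module_module)
  interpret N: module \<Lambda>1 N using N by (rule profinite_module_module)
  obtain m1 where m1: "m1 \<in> carrier M" "fst_coord g = f m1"
    using coords_closed(1)[OF g, folded surj] by (rule imageE)
  obtain m2 where m2: "m2 \<in> carrier M" "snd_coord n g = f m2"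
    using coords_closed(2)[OF g, folded surj] by (rule imageE)
  have "f (cochain M n m1 m2 u) = g u" if u: "u \<in> carrier (Q n)" for u
  proof -
    obtain p where p: "p \<in> carrier (free_module n)" "u = j p"
      using u unfolding carrier_Q by blast
    then have "fst p \<in> carrier \<Lambda>1" "snd p \<in> carrier \<Lambda>1"
      using free_module_carrier_subset by fastforce+
    then show ?thesis
      using p m1 m2 continuous_homD[OF f] by (simp add: cochain_j hom_eq[OF N g] del: free_module_simps)
  qed
  then show "\<exists>h\<in>continuous_hom \<Lambda>1 (Q n) M. \<forall>x\<in>carrier (Q n). f (h x) = g x"
    using cochain_hom[OF M m1(1) m2(1)] by blast
qed

lemma projective_resolution_Q: "projective_resolution \<Lambda>1 trivial_module Q dQ aQ"
  unfolding projective_resolution_def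
proof (intro conjI allI projective_Q dQ_hom aQ_hom)
  have "aQ ` j ` carrier (free_module 0) = augmentation ` carrier (free_module 0)"
    unfolding image_image by (intro image_cong refl aQ_j)
  then show "aQ ` carrier (Q 0) = carrier trivial_module"
    by (simp add: carrier_Q augmentation_surj del: free_module_simps)
  have j_zero: "j p = \<zero>\<^bsub>Q n\<^esub> \<longleftrightarrow> p = \<zero>\<^bsub>free_module n\<^esub>" if "p \<in> carrier (free_module n)" for p n
    using inj_onD[OF inj_j_free[of n], of p "\<zero>\<^bsub>free_module n\<^esub>"] that by (auto simp: zero_Q)
  show "dQ 0 ` carrier (Q (Suc 0)) = {x \<in> carrier (Q 0). aQ x = \<zero>\<^bsub>trivial_module\<^esub>}"
  proof (intro equalityI subsetI)
    fix u assume "u \<in> dQ 0 ` carrier (Q (Suc 0))"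
    then obtain p where p: "p \<in> carrier (free_module (Suc 0))" "u = dQ 0 (j p)"
      unfolding carrier_Q by blast
    then have u: "u = j (differential 0 p)" using dQ_j by blast
    show "u \<in> {x \<in> carrier (Q 0). aQ x = \<zero>\<^bsub>trivial_module\<^esub>}"
      unfolding u using differential_closed[OF p(1)] augmentation_differential[OF p(1)]
      by (simp add: carrier_Q aQ_j del: free_module_simps)
  next
    fix u assume "u \<in> {x \<in> carrier (Q 0). aQ x = \<zero>\<^bsub>trivial_module\<^esub>}"
    then obtain p where p: "p \<in> carrier (free_module 0)" "u = j p" "aQ u = 0"
      unfolding carrier_Q by auto
    then obtain q where q: "q \<in> carrier (free_module (Suc 0))" "differential 0 q = p"
      using augmentation_exact[of p] aQ_j by auto
    then show "u \<in> dQ 0 ` carrier (Q (Suc 0))"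
      unfolding p(2) carrier_Q by (metis dQ_j imageI)
  qed
  show "dQ (Suc n) ` carrier (Q (Suc (Suc n))) = {x \<in> carrier (Q (Suc n)). dQ n x = \<zero>\<^bsub>Q n\<^esub>}" for n
  proof (intro equalityI subsetI)
    fix u assume "u \<in> dQ (Suc n) ` carrier (Q (Suc (Suc n)))"
    then obtain p where p: "p \<in> carrier (free_module (Suc (Suc n)))" "u = dQ (Suc n) (j p)"
      unfolding carrier_Q by blast
    then have u: "u = j (differential (Suc n) p)" using dQ_j by blast
    show "u \<in> {x \<in> carrier (Q (Suc n)). dQ n x = \<zero>\<^bsub>Q n\<^esub>}"
      unfolding u using differential_closed[OF p(1)] differential_differential[OF p(1)]
      by (simp add: carrier_Q dQ_j zero_Q del: free_module_simps(1))
  next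
    fix u assume "u \<in> {x \<in> carrier (Q (Suc n)). dQ n x = \<zero>\<^bsub>Q n\<^esub>}"
    then obtain p where p: "p \<in> carrier (free_module (Suc n))" "u = j p" "dQ n u = \<zero>\<^bsub>Q n\<^esub>"
      unfolding carrier_Q by auto
    then have "j (differential n p) = \<zero>\<^bsub>Q n\<^esub>"
      using dQ_j by simp
    then have "differential n p = \<zero>\<^bsub>free_module n\<^esub>"
      using j_zero[OF differential_closed[OF p(1)]] by blast
    then obtain q where q: "q \<in> carrier (free_module (Suc (Suc n)))" "differential (Suc n) q = p"
      using differential_exact[OF p(1)] by blast
    then show "u \<in> dQ (Suc n) ` carrier (Q (Suc (Suc n)))"
      unfolding p(2) carrier_Q by (metis dQ_j imageI)
  qed
qed

lemma resolution_Q: "resolution \<Lambda>1 trivial_module Q dQ aQ"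
  by (intro resolution.intro projective_resolution_Q profinite_trivial_module) (simp add: S1.topspace_ring_top)

text \<open>The dual differential: commutativity of the algebra moves the coefficients past the
  coordinates of \<open>p\<close> onto the values at the generators. A cochain thus becomes a pair,
  and the cochain complex a complex of pairs.\<close>

lemma differential_coords:
  assumes N: "profinite_module \<Lambda>1 N" and m: "m1 \<in> carrier N" "m2 \<in> carrier N"
    and p: "p \<in> carrier (free_module (Suc n))"
  shows "fst (differential n p) \<odot>\<^bsub>N\<^esub> m1 \<oplus>\<^bsub>N\<^esub> snd (differential n p) \<odot>\<^bsub>N\<^esub> m2 =
    fst p \<odot>\<^bsub>N\<^esub> (diff_coeff (Suc n) \<odot>\<^bsub>N\<^esub> m1) \<oplus>\<^bsub>N\<^esub> snd p \<odot>\<^bsub>N\<^esub> (koszul_coeff n \<odot>\<^bsub>N\<^esub> m1 \<oplus>\<^bsub>N\<^esub> diff_coeff n \<odot>\<^bsub>N\<^esub> m2)"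
proof -
  interpret N: module \<Lambda>1 N using N by (rule profinite_module_module)
  obtain x y where xy: "p = (x, y)" "x \<in> carrier \<Lambda>1" "y \<in> carrier \<Lambda>1" using p by auto
  show ?thesis
    using xy m S1.R.m_comm[of "diff_coeff (Suc n)" x] S1.R.m_comm[of "koszul_coeff n" y] S1.R.m_comm[of "diff_coeff n" y]
    by (simp add: differential_def N.smult_l_distr N.smult_r_distr N.a_assoc N.smult_assoc1)
qed

lemma cocycle_coords_iff:
  assumes N: "profinite_module \<Lambda>1 N" and z: "z \<in> continuous_hom \<Lambda>1 (Q n) N"
  shows "z \<in> cocycles \<Lambda>1 Q dQ N n \<longleftrightarrow> diff_coeff (Suc n) \<odot>\<^bsub>N\<^esub> fst_coord z = \<zero>\<^bsub>N\<^esub> \<and>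
    koszul_coeff n \<odot>\<^bsub>N\<^esub> fst_coord z \<oplus>\<^bsub>N\<^esub> diff_coeff n \<odot>\<^bsub>N\<^esub> snd_coord n z = \<zero>\<^bsub>N\<^esub>"
    (is "_ \<longleftrightarrow> ?A = _ \<and> ?B = _")
proof -
  interpret N: module \<Lambda>1 N using N by (rule profinite_module_module)
  note c = coords_closed[OF z]
  have zd: "z (dQ n (j p)) = fst p \<odot>\<^bsub>N\<^esub> ?A \<oplus>\<^bsub>N\<^esub> snd p \<odot>\<^bsub>N\<^esub> ?B" if "p \<in> carrier (free_module (Suc n))" for p
    unfolding dQ_j[OF that] hom_eq[OF N z differential_closed[OF that]] by (rule differential_coords[OF N c that])
  have "(\<forall>u\<in>carrier (Q (Suc n)). z (dQ n u) = \<zero>\<^bsub>N\<^esub>) \<longleftrightarrow> ?A = \<zero>\<^bsub>N\<^esub> \<and> ?B = \<zero>\<^bsub>N\<^esub>"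
  proof
    assume a: "\<forall>u\<in>carrier (Q (Suc n)). z (dQ n u) = \<zero>\<^bsub>N\<^esub>"
    have "z (dQ n (j p)) = \<zero>\<^bsub>N\<^esub>" if "p \<in> carrier (free_module (Suc n))" for p
      using a that unfolding carrier_Q by blast
    from this[OF generators_closed(1)] this[OF generators_closed(2)] show "?A = \<zero>\<^bsub>N\<^esub> \<and> ?B = \<zero>\<^bsub>N\<^esub>"
      unfolding zd[OF generators_closed(1)] zd[OF generators_closed(2)]
      using c by (simp add: second_generator_def N.smult_l_null)
  next
    assume "?A = \<zero>\<^bsub>N\<^esub> \<and> ?B = \<zero>\<^bsub>N\<^esub>"
    then have "z (dQ n (j p)) = \<zero>\<^bsub>N\<^esub>" if p: "p \<in> carrier (free_module (Suc n))" for p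
      unfolding zd[OF p] using subsetD[OF free_module_carrier_subset p] by (auto simp: N.smult_r_null)
    then show "\<forall>u\<in>carrier (Q (Suc n)). z (dQ n u) = \<zero>\<^bsub>N\<^esub>"
      unfolding carrier_Q by blast
  qed
  then show ?thesis
    using z by (simp add: cocycles_iff)
qed

lemma coboundary_coords_iff:
  assumes N: "profinite_module \<Lambda>1 N" and z: "z \<in> continuous_hom \<Lambda>1 (Q (Suc n)) N"
  shows "z \<in> coboundaries \<Lambda>1 Q dQ N (Suc n) \<longleftrightarrow> (\<exists>m1\<in>carrier N. \<exists>m2\<in>carrier N.
    fst_coord z = diff_coeff (Suc n) \<odot>\<^bsub>N\<^esub> m1 \<and>
    snd_coord (Suc n) z = koszul_coeff n \<odot>\<^bsub>N\<^esub> m1 \<oplus>\<^bsub>N\<^esub> diff_coeff n \<odot>\<^bsub>N\<^esub> m2)"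
proof -
  interpret N: module \<Lambda>1 N using N by (rule profinite_module_module)
  have gen: "fst_coord w = a" "snd_coord (Suc n) w = b"
    if "\<And>p. p \<in> carrier (free_module (Suc n)) \<Longrightarrow> w (j p) = fst p \<odot>\<^bsub>N\<^esub> a \<oplus>\<^bsub>N\<^esub> snd p \<odot>\<^bsub>N\<^esub> b"
      and "a \<in> carrier N" "b \<in> carrier N" for w a b
    unfolding that(1)[OF generators_closed(1)] that(1)[OF generators_closed(2)]
    using that(2,3) by (simp_all add: second_generator_def N.smult_l_null)
  show ?thesis
  proof
    assume "z \<in> coboundaries \<Lambda>1 Q dQ N (Suc n)"
    then obtain w where w: "w \<in> continuous_hom \<Lambda>1 (Q n) N" "\<forall>u\<in>carrier (Q (Suc n)). z u = w (dQ n u)"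
      unfolding coboundaries_Suc_iff by blast
    note c = coords_closed[OF w(1)]
    have "z (j p) = fst p \<odot>\<^bsub>N\<^esub> (diff_coeff (Suc n) \<odot>\<^bsub>N\<^esub> fst_coord w) \<oplus>\<^bsub>N\<^esub>
        snd p \<odot>\<^bsub>N\<^esub> (koszul_coeff n \<odot>\<^bsub>N\<^esub> fst_coord w \<oplus>\<^bsub>N\<^esub> diff_coeff n \<odot>\<^bsub>N\<^esub> snd_coord n w)"
      if p: "p \<in> carrier (free_module (Suc n))" for p
    proof -
      have "z (j p) = w (j (differential n p))"
        using w(2) p dQ_j[OF p] unfolding carrier_Q by force
      then show ?thesis
        unfolding hom_eq[OF N w(1) differential_closed[OF p]] differential_coords[OF N c p] .
    qed
    from gen[OF this] c show "\<exists>m1\<in>carrier N. \<exists>m2\<in>carrier N.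
      fst_coord z = diff_coeff (Suc n) \<odot>\<^bsub>N\<^esub> m1 \<and>
      snd_coord (Suc n) z = koszul_coeff n \<odot>\<^bsub>N\<^esub> m1 \<oplus>\<^bsub>N\<^esub> diff_coeff n \<odot>\<^bsub>N\<^esub> m2"
      by (intro bexI[OF _ c(1)] bexI[OF _ c(2)]) simp
  next
    assume "\<exists>m1\<in>carrier N. \<exists>m2\<in>carrier N.
      fst_coord z = diff_coeff (Suc n) \<odot>\<^bsub>N\<^esub> m1 \<and>
      snd_coord (Suc n) z = koszul_coeff n \<odot>\<^bsub>N\<^esub> m1 \<oplus>\<^bsub>N\<^esub> diff_coeff n \<odot>\<^bsub>N\<^esub> m2"
    then obtain m1 m2 where m: "m1 \<in> carrier N" "m2 \<in> carrier N" and eq: "fst_coord z = diff_coeff (Suc n) \<odot>\<^bsub>N\<^esub> m1"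
      "snd_coord (Suc n) z = koszul_coeff n \<odot>\<^bsub>N\<^esub> m1 \<oplus>\<^bsub>N\<^esub> diff_coeff n \<odot>\<^bsub>N\<^esub> m2" by blast
    have "z u = cochain N n m1 m2 (dQ n u)" if u: "u \<in> carrier (Q (Suc n))" for u
    proof -
      obtain p where p: "p \<in> carrier (free_module (Suc n))" "u = j p"
        using u unfolding carrier_Q by blast
      show ?thesis
        unfolding p(2) dQ_j[OF p(1)] cochain_j[OF differential_closed[OF p(1)]] hom_eq[OF N z p(1)] eq
          differential_coords[OF N m p(1)] ..
    qed
    then show "z \<in> coboundaries \<Lambda>1 Q dQ N (Suc n)"
      unfolding coboundaries_Suc_iff using continuous_homD(1)[OF z] cochain_hom[OF N m] by blast
  qed
qed

end

section \<open>Cohomology with coefficients of rank one\<close>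

text \<open>Pairs of values at the two generators, with the algebra acting through
  \<open>chi k\<close>. In degree 0 the second generator is 0, which forces
  \<open>b = 0\<close>.\<close>

definition cocycle_pair :: "int \<Rightarrow> nat \<Rightarrow> z2adic \<Rightarrow> z2adic \<Rightarrow> bool" where
  "cocycle_pair k n a b \<longleftrightarrow> chi k (diff_coeff (Suc n)) * a = 0 \<and>
     chi k (koszul_coeff n) * a + chi k (diff_coeff n) * b = 0 \<and> (n = 0 \<longrightarrow> b = 0)"

text \<open>For \<open>m = 0\<close> the term with \<open>b'\<close> vanishes because
  \<open>diff_coeff 0\<close> is 0; this is what sets degree 1 apart.\<close>

definition coboundary_pair :: "int \<Rightarrow> nat \<Rightarrow> z2adic \<Rightarrow> z2adic \<Rightarrow> bool" where
  "coboundary_pair k n a b \<longleftrightarrow> (case n of 0 \<Rightarrow> a = 0 \<and> b = 0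
     | Suc m \<Rightarrow> \<exists>a' b'. a = chi k (diff_coeff (Suc m)) * a' \<and> b = chi k (koszul_coeff m) * a' + chi k (diff_coeff m) * b')"

text \<open>Joins the comparison of resolutions with the coordinates: a cohomology group is known
  once an additive map \<open>\<Psi>\<close> on pairs is surjective on cocycles and has the
  coboundaries as its kernel there. The resolution \<open>P\<close> is arbitrary and stands for the
  one chosen by \<open>Ext\<close>.\<close>

lemma (in universe_embedding) cohomology_rank_one:
  fixes N :: "(z2adic cga, 'n) top_module" and \<iota> :: "z2adic \<Rightarrow> 'n" and P :: "nat \<Rightarrow> (z2adic cga, 'u) top_module"
    and T :: "('t, 'z) monoid_scheme"
  assumes N: "profinite_module \<Lambda>1 N" and bij: "bij_betw \<iota> UNIV (carrier N)"
    and add: "\<And>a b. \<iota> (a + b) = \<iota> a \<oplus>\<^bsub>N\<^esub> \<iota> b"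
    and smult: "\<And>r a. r \<in> carrier \<Lambda>1 \<Longrightarrow> r \<odot>\<^bsub>N\<^esub> \<iota> a = \<iota> (chi k r * a)"
    and P: "resolution \<Lambda>1 trivial_module P d \<epsilon>"
    and T: "group T"
    and closed: "\<And>a b. \<Psi> a b \<in> carrier T"
    and hom: "\<And>a b a' b'. \<Psi> (a + a') (b + b') = \<Psi> a b \<otimes>\<^bsub>T\<^esub> \<Psi> a' b'"
    and surj: "\<And>t. t \<in> carrier T \<Longrightarrow> \<exists>a b. cocycle_pair k n a b \<and> \<Psi> a b = t"
    and ker: "\<And>a b. cocycle_pair k n a b \<Longrightarrow> \<Psi> a b = \<one>\<^bsub>T\<^esub> \<longleftrightarrow> coboundary_pair k n a b"
  shows "Hom_cohomology \<Lambda>1 P d N n \<cong> T" and "group (Hom_cohomology \<Lambda>1 P d N n)"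
proof -
  interpret N: module \<Lambda>1 N using N by (rule profinite_module_module)
  interpret pair: resolution_pair \<Lambda>1 trivial_module P d \<epsilon> Q dQ aQ
    by (intro resolution_pair.intro P resolution_Q)
  define \<kappa> where "\<kappa> = inv_into UNIV \<iota>"
  have \<iota>N: "\<iota> a \<in> carrier N" for a
    using bij by (auto simp: bij_betw_def)
  have \<iota>_inj: "\<iota> a = \<iota> b \<longleftrightarrow> a = b" for a b
    using bij by (auto simp: bij_betw_def inj_eq)
  have \<iota>\<kappa>: "\<iota> (\<kappa> m) = m" if "m \<in> carrier N" for m
    using bij that unfolding \<kappa>_def bij_betw_def by (simp add: f_inv_into_f)
  have \<kappa>\<iota>: "\<kappa> (\<iota> a) = a" for a
    using bij unfolding \<kappa>_def bij_betw_def by simp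
  have \<iota>0: "\<iota> 0 = \<zero>\<^bsub>N\<^esub>"
    using add[of 0 0] \<iota>N[of 0] by (simp add: N.add.l_cancel_one')
  have \<kappa>_add: "\<kappa> (m \<oplus>\<^bsub>N\<^esub> m') = \<kappa> m + \<kappa> m'" if "m \<in> carrier N" "m' \<in> carrier N" for m m'
    using that by (metis add \<iota>\<kappa> \<kappa>\<iota>)
  define a where "a z = \<kappa> (fst_coord z)" for z :: "'u \<Rightarrow> 'n"
  define b where "b z = \<kappa> (snd_coord n z)" for z :: "'u \<Rightarrow> 'n"
  have coords: "fst_coord z = \<iota> (a z)" "snd_coord n z = \<iota> (b z)" if "z \<in> continuous_hom \<Lambda>1 (Q n) N" for z
    using coords_closed[OF that] by (simp_all add: a_def b_def \<iota>\<kappa>)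
  have b0: "b z = 0" if "z \<in> continuous_hom \<Lambda>1 (Q n) N" "n = 0" for z
  proof -
    have "snd_coord n z = \<zero>\<^bsub>N\<^esub>"
      using continuous_hom_zero[OF that(1) profinite_module_abelian_group[OF profinite_Q] N.abelian_group_axioms] that(2)
      by (simp add: second_generator_def zero_Q)
    then show ?thesis
      using coords(2)[OF that(1)] by (simp add: \<iota>_inj flip: \<iota>0)
  qed
  have coc: "z \<in> cocycles \<Lambda>1 Q dQ N n \<longleftrightarrow> cocycle_pair k n (a z) (b z)"
    if z: "z \<in> continuous_hom \<Lambda>1 (Q n) N" for z
    using b0[OF z] unfolding cocycle_coords_iff[OF N z] coords[OF z] cocycle_pair_def
    by (auto simp: smult \<iota>_inj simp flip: add \<iota>0)
  have cob: "z \<in> coboundaries \<Lambda>1 Q dQ N n \<longleftrightarrow> coboundary_pair k n (a z) (b z)"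
    if z: "z \<in> continuous_hom \<Lambda>1 (Q n) N" for z
  proof (cases n)
    case 0
    let ?z = "\<lambda>u\<in>carrier (Q n). \<zero>\<^bsub>N\<^esub>"
    have zh: "?z \<in> continuous_hom \<Lambda>1 (Q n) N"
      by (rule continuous_hom_const_zero[OF profinite_Q N])
    have "z = ?z \<longleftrightarrow> fst_coord z = \<zero>\<^bsub>N\<^esub> \<and> snd_coord n z = \<zero>\<^bsub>N\<^esub>"
    proof
      assume "fst_coord z = \<zero>\<^bsub>N\<^esub> \<and> snd_coord n z = \<zero>\<^bsub>N\<^esub>"
      then show "z = ?z"
        using generators_closed[of n] by (intro hom_eqI[OF N z zh]) (simp_all add: carrier_Q del: free_module_simps)
    qed (use generators_closed[of n] in \<open>simp add: carrier_Q del: free_module_simps\<close>)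
    then show ?thesis
      using coords[OF z] unfolding 0 coboundaries_0_iff by (simp add: coboundary_pair_def \<iota>_inj flip: \<iota>0)
  next
    case (Suc m)
    have "(\<exists>m1\<in>carrier N. \<exists>m2\<in>carrier N. \<iota> (a z) = diff_coeff (Suc m) \<odot>\<^bsub>N\<^esub> m1 \<and>
        \<iota> (b z) = koszul_coeff m \<odot>\<^bsub>N\<^esub> m1 \<oplus>\<^bsub>N\<^esub> diff_coeff m \<odot>\<^bsub>N\<^esub> m2) \<longleftrightarrow>
      (\<exists>a' b'. \<iota> (a z) = diff_coeff (Suc m) \<odot>\<^bsub>N\<^esub> \<iota> a' \<and>
        \<iota> (b z) = koszul_coeff m \<odot>\<^bsub>N\<^esub> \<iota> a' \<oplus>\<^bsub>N\<^esub> diff_coeff m \<odot>\<^bsub>N\<^esub> \<iota> b')"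
      using \<iota>N \<iota>\<kappa> by metis
    then show ?thesis
      using coboundary_coords_iff[OF N z[unfolded Suc]] coords[OF z]
      unfolding Suc coboundary_pair_def by (simp add: smult \<iota>_inj flip: add)
  qed
  have ch: "z \<in> continuous_hom \<Lambda>1 (Q n) N" if "z \<in> cocycles \<Lambda>1 Q dQ N n" for z
    using that by (simp add: cocycles_iff)
  define \<psi> where "\<psi> z = \<Psi> (a z) (b z)" for z
  have \<psi>: "\<psi> \<in> hom ((hom_group \<Lambda>1 (Q n) N)\<lparr>carrier := cocycles \<Lambda>1 Q dQ N n\<rparr>) T"
  proof (rule homI)
    fix z w assume z: "z \<in> carrier ((hom_group \<Lambda>1 (Q n) N)\<lparr>carrier := cocycles \<Lambda>1 Q dQ N n\<rparr>)"
      and w: "w \<in> carrier ((hom_group \<Lambda>1 (Q n) N)\<lparr>carrier := cocycles \<Lambda>1 Q dQ N n\<rparr>)"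
    then have zw: "z \<in> continuous_hom \<Lambda>1 (Q n) N" "w \<in> continuous_hom \<Lambda>1 (Q n) N"
      using ch by simp_all
    have "j (\<one>\<^bsub>\<Lambda>1\<^esub>, \<zero>\<^bsub>\<Lambda>1\<^esub>) \<in> carrier (Q n)" "j (second_generator n) \<in> carrier (Q n)"
      using generators_closed[of n] by (simp_all add: carrier_Q del: free_module_simps)
    then show "\<psi> (z \<otimes>\<^bsub>(hom_group \<Lambda>1 (Q n) N)\<lparr>carrier := cocycles \<Lambda>1 Q dQ N n\<rparr>\<^esub> w) = \<psi> z \<otimes>\<^bsub>T\<^esub> \<psi> w"
      using coords_closed[OF zw(1)] coords_closed[OF zw(2)]
      by (simp add: \<psi>_def hom_group_def a_def b_def \<kappa>_add hom)
  qed (simp add: \<psi>_def closed)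
  have s: "\<exists>z\<in>cocycles \<Lambda>1 Q dQ N n. \<psi> z = t" if t: "t \<in> carrier T" for t
  proof -
    obtain x y where xy: "cocycle_pair k n x y" "\<Psi> x y = t"
      using surj[OF t] by blast
    let ?z = "cochain N n (\<iota> x) (\<iota> y)"
    have zh: "?z \<in> continuous_hom \<Lambda>1 (Q n) N"
      by (intro cochain_hom N \<iota>N)
    have "fst_coord ?z = \<iota> x"
      unfolding cochain_j[OF generators_closed(1)] using \<iota>N by (simp add: N.smult_l_null)
    moreover have "snd_coord n ?z = \<iota> y"
      unfolding cochain_j[OF generators_closed(2)] using \<iota>N xy(1)
      by (auto simp: N.smult_l_null second_generator_def cocycle_pair_def \<iota>0)
    ultimately have "a ?z = x" "b ?z = y"
      by (simp_all add: a_def b_def \<kappa>\<iota>)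
    then show ?thesis
      using coc[OF zh] xy by (intro bexI[of _ ?z]) (simp_all add: \<psi>_def)
  qed
  have kr: "\<psi> z = \<one>\<^bsub>T\<^esub> \<longleftrightarrow> z \<in> coboundaries \<Lambda>1 Q dQ N n" if "z \<in> cocycles \<Lambda>1 Q dQ N n" for z
    using ker coc[OF ch[OF that]] cob[OF ch[OF that]] that by (simp add: \<psi>_def)
  show "Hom_cohomology \<Lambda>1 P d N n \<cong> T" "group (Hom_cohomology \<Lambda>1 P d N n)"
    by (rule pair.Hom_cohomology_iso[OF N T \<psi> s kr]; assumption)+
qed

section \<open>The values of the characters\<close>

lemma nat_pow_S1: "g [^]\<^bsub>S1\<^esub> (n :: nat) = g ^ n"
  by (induction n) (simp_all add: mult.commute)

lemma int_pow_S1_nonneg: "g [^]\<^bsub>S1\<^esub> int n = g ^ n"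
  by (simp add: int_pow_int nat_pow_S1)

lemma int_pow_S1_neg: "g \<in> carrier S1 \<Longrightarrow> g [^]\<^bsub>S1\<^esub> (- int n) = inv\<^bsub>S1\<^esub> (g ^ n)"
  by (simp only: S1.int_pow_neg int_pow_S1_nonneg)

lemma minus_one_int_pow: "(-1) [^]\<^bsub>S1\<^esub> (k :: int) = (if even k then 1 else -1)"
proof (cases k rule: int_cases2)
  case (nonneg n)
  then show ?thesis by (simp add: int_pow_S1_nonneg)
next
  case (nonpos n)
  have "inv\<^bsub>S1\<^esub> ((-1) ^ n) = (-1) ^ n"
    by (cases "even n") (simp_all add: inv_minus_one_S1)
  then show ?thesis
    using nonpos int_pow_S1_neg[OF minus_one_S1, of n] by simp
qed

lemma odd_power_sum: "odd (a :: int) \<Longrightarrow> odd (\<Sum>i<n. a ^ i) \<longleftrightarrow> odd n"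
  by (induction n) auto

text \<open>With \<open>n = 2 ^ v * w\<close> and \<open>w\<close> odd, \<open>5 ^ n - 1\<close> is
  \<open>5 ^ (2 ^ v) - 1\<close> times a geometric sum of \<open>w\<close> odd terms, which is odd.
  The first factor has valuation exactly \<open>v + 2\<close>.\<close>

lemma five_power_minus_one:
  assumes "n > 0"
  shows "\<exists>u. odd u \<and> (5 :: int) ^ n - 1 = 2 ^ (multiplicity 2 (int n) + 2) * u"
proof -
  obtain w where w: "int n = 2 ^ multiplicity 2 (int n) * w" "odd w"
    using multiplicity_decompose'[of "int n" 2] assms by auto
  define v where "v = multiplicity 2 (int n)"
  have "w > 0"
    using w(1) assms by (metis of_nat_0_less_iff zero_less_mult_pos zero_less_numeral zero_less_power)
  have "int n = 2 ^ v * w"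
    unfolding v_def by (rule w(1))
  then have "int n = int (2 ^ v * nat w)"
    using \<open>w > 0\<close> by simp
  then have n: "n = 2 ^ v * nat w"
    by (rule of_nat_eq_iff[THEN iffD1])
  obtain q :: int where q: "5 ^ (2 ^ v) = 1 + 2 ^ (v + 2) * (2 * q + 1)"
    using five_power_two_power by blast
  have "(5 :: int) ^ n - 1 = (5 ^ (2 ^ v)) ^ nat w - 1"
    by (simp add: n power_mult)
  also have "\<dots> = (5 ^ (2 ^ v) - 1) * (\<Sum>i<nat w. (5 ^ (2 ^ v)) ^ i)"
    by (rule power_diff_1_eq)
  also have "\<dots> = 2 ^ (v + 2) * ((2 * q + 1) * (\<Sum>i<nat w. (5 ^ (2 ^ v)) ^ i))"
    unfolding q by (simp only: add_diff_cancel_left' mult.assoc)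
  finally have "(5 :: int) ^ n - 1 = 2 ^ (v + 2) * ((2 * q + 1) * (\<Sum>i<nat w. (5 ^ (2 ^ v)) ^ i))" .
  moreover have "odd (\<Sum>i<nat w. ((5 :: int) ^ (2 ^ v)) ^ i)"
    using w(2) \<open>w > 0\<close> by (subst odd_power_sum) (auto simp: even_nat_iff)
  ultimately show ?thesis
    unfolding v_def by (intro exI conjI) auto
qed

text \<open>Negative exponents follow from \<open>5 ^ (-n) - 1 = - 5 ^ (-n) * (5 ^ n - 1)\<close>,
  which differs from \<open>5 ^ n - 1\<close> by a unit.\<close>

lemma five_int_pow_minus_one:
  fixes k :: int
  assumes "k \<noteq> 0"
  obtains u where "u \<in> carrier S1" "5 [^]\<^bsub>S1\<^esub> k - 1 = 2 ^ (multiplicity 2 k + 2) * u"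
proof -
  have pos: "\<exists>u\<in>carrier S1. (5 :: z2adic) ^ n - 1 = 2 ^ (multiplicity 2 (int n) + 2) * u" if n: "n > 0" for n
  proof -
    obtain u where u: "odd u" "(5 :: int) ^ n - 1 = 2 ^ (multiplicity 2 (int n) + 2) * u"
      using five_power_minus_one[OF n] by blast
    from u(2) have "of_int ((5 :: int) ^ n - 1) = (of_int (2 ^ (multiplicity 2 (int n) + 2) * u) :: z2adic)"
      by (rule arg_cong)
    then have "(5 :: z2adic) ^ n - 1 = 2 ^ (multiplicity 2 (int n) + 2) * of_int u"
      by (simp only: of_int_diff of_int_power of_int_mult of_int_numeral of_int_1)
    moreover have "of_int u \<in> carrier S1"
      using u(1) by (simp add: carrier_S1 residue_of_int odd_iff_mod_2_eq_one)
    ultimately show ?thesis by blast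
  qed
  show thesis
  proof (cases k rule: int_cases2)
    case (nonneg n)
    then show thesis
      using pos[of n] assms that by (auto simp: int_pow_S1_nonneg)
  next
    case (nonpos n)
    then have "n > 0" using assms by simp
    then obtain u where u: "u \<in> carrier S1" "(5 :: z2adic) ^ n - 1 = 2 ^ (multiplicity 2 (int n) + 2) * u"
      using pos by blast
    let ?v = "inv\<^bsub>S1\<^esub> ((5 :: z2adic) ^ n)"
    have v: "?v \<in> carrier S1" "?v * 5 ^ n = 1"
      using power_S1[OF five_S1, of n] S1_l_inv by simp_all
    have "5 [^]\<^bsub>S1\<^esub> k - 1 = - (?v * (5 ^ n - 1))"
      using v nonpos int_pow_S1_neg[OF five_S1, of n] by (simp add: right_diff_distrib)
    also have "\<dots> = 2 ^ (multiplicity 2 k + 2) * (- (?v * u))"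
      unfolding u(2) nonpos by (simp add: mult_ac)
    finally show thesis
      using that minus_S1[OF S1_m_closed[OF v(1) u(1)]] by blast
  qed
qed

lemma two_dvd_five_int_pow: "2 dvd (5 [^]\<^bsub>S1\<^esub> (k :: int) - 1 :: z2adic)"
proof -
  have "5 [^]\<^bsub>S1\<^esub> k \<in> carrier S1"
    using five_S1 by simp
  then have "residue (5 [^]\<^bsub>S1\<^esub> k - 1) 1 = 0"
    by (simp add: carrier_S1 residue_diff one_z2adic.rep_eq)
  then show ?thesis
    using two_power_dvd_iff[of 1] by simp
qed

lemma unit_S1: "u \<in> carrier S1 \<Longrightarrow> u dvd 1"
  by (simp add: z2adic_unit_iff carrier_S1)

text \<open>As \<open>\<sigma>\<close> goes to \<open>(-1) ^ k\<close>, the periodic differentials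
  become 0 or \<open>\<plusminus> 2\<close>; for \<open>n > 0\<close> they are nonzero exactly when
  \<open>n\<close> and \<open>k\<close> have the same parity. This governs the case distinction for
  the cohomology.\<close>

lemma chi_diff_coeff:
  "chi k (diff_coeff n) =
     (if n = 0 then 0 else if even k then (if even n then 2 else 0) else (if even n then 0 else -2))"
  by (simp add: diff_coeff_def eval_zero eval_sigma_minus eval_sigma_plus minus_one_int_pow)

lemma chi_koszul_coeff: "chi k (koszul_coeff n) = (if even n then 5 [^]\<^bsub>S1\<^esub> k - 1 else - (5 [^]\<^bsub>S1\<^esub> k - 1))"
  by (simp add: koszul_coeff_def eval_minus eval_gamma_minus)

lemma residue_in_integer_mod_group: "residue a m \<in> carrier (integer_mod_group (2 ^ m))"
  by (simp add: carrier_integer_mod_group residue_nonneg residue_less)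

lemma residue_add_integer_mod_group: "residue (a + b) m = residue a m \<otimes>\<^bsub>integer_mod_group (2 ^ m)\<^esub> residue b m"
  by (simp add: plus_z2adic.rep_eq)

lemma residue_of_int_integer_mod_group: "t \<in> carrier (integer_mod_group (2 ^ m)) \<Longrightarrow> residue (of_int t) m = t"
  by (simp add: carrier_integer_mod_group residue_of_int)

lemma add_monoid_Z2: "group (add_monoid Z2)" "carrier (add_monoid Z2) = UNIV" "a \<otimes>\<^bsub>add_monoid Z2\<^esub> b = a + b"
  "\<one>\<^bsub>add_monoid Z2\<^esub> = 0"
proof -
  interpret ring "Z2 :: z2adic ring" by (rule ring_from_type_algebra)
  show "group (add_monoid Z2)" by (rule add.is_group)
qed (simp_all add: ring_of_type_algebra_def)

lemma sign_times_two_eq_0: "s = 2 \<or> s = -2 \<Longrightarrow> s * x = 0 \<Longrightarrow> x = 0" for x :: z2adic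
  using two_times_eq_0[of x] by auto

section \<open>Cohomology degree by degree\<close>

context universe_embedding
begin

context
  fixes N :: "(z2adic cga, 'n) top_module" and \<iota> :: "z2adic \<Rightarrow> 'n" and k :: int
    and P :: "nat \<Rightarrow> (z2adic cga, 'u) top_module" and d \<epsilon>
  assumes N: "profinite_module \<Lambda>1 N" and bij: "bij_betw \<iota> UNIV (carrier N)"
    and add: "\<And>a b. \<iota> (a + b) = \<iota> a \<oplus>\<^bsub>N\<^esub> \<iota> b"
    and smult: "\<And>r a. r \<in> carrier \<Lambda>1 \<Longrightarrow> r \<odot>\<^bsub>N\<^esub> \<iota> a = \<iota> (chi k r * a)"
    and P: "resolution \<Lambda>1 trivial_module P d \<epsilon>"
begin

lemmas rank_one = cohomology_rank_one[OF N bij add smult P]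

text \<open>On first coordinates the differential into degree \<open>n\<close> is \<open>s\<close>,
  that is 2 or -2, and the one out of it is 0. Since 2 is not a zero divisor,
  \<open>s * b = K * a\<close> determines \<open>b\<close> from \<open>a\<close>. The coboundaries
  are the cocycles with \<open>a\<close> divisible by \<open>s\<close>, so the class is
  \<open>a\<close> modulo 2.\<close>

lemma cohomology_same_parity:
  assumes n: "n > 0" "even n \<longleftrightarrow> even k"
  shows "Hom_cohomology \<Lambda>1 P d N n \<cong> integer_mod_group 2"
proof -
  obtain m where m: "n = Suc m" using n(1) by (cases n) auto
  obtain s :: z2adic where s: "s = 2 \<or> s = -2" "chi k (diff_coeff n) = s"
    using n by (auto simp: chi_diff_coeff)
  have D: "chi k (diff_coeff (Suc n)) = 0" "chi k (diff_coeff m) = 0"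
    using n by (auto simp: chi_diff_coeff m)
  define K where "K = chi k (koszul_coeff m)"
  have K: "chi k (koszul_coeff n) = - K"
    by (simp add: K_def m chi_koszul_coeff)
  have "2 dvd K"
    unfolding K_def chi_koszul_coeff using two_dvd_five_int_pow[of k] dvd_minus_iff by (simp only: split: if_split) blast
  then have "s dvd K"
    using s(1) by (auto simp: minus_dvd_iff)
  have cocycle: "cocycle_pair k n a b \<longleftrightarrow> s * b = K * a" for a b
    using n by (auto simp: cocycle_pair_def D s(2) K)
  have coboundary: "coboundary_pair k n a b \<longleftrightarrow> (\<exists>a'. a = s * a' \<and> b = K * a')" for a b
    using s(2) by (simp add: coboundary_pair_def m D K_def)
  have "Hom_cohomology \<Lambda>1 P d N n \<cong> integer_mod_group (2 ^ 1)"
  proof (rule rank_one(1)[where \<Psi> = "\<lambda>a b. residue a 1"])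
    fix t assume t: "t \<in> carrier (integer_mod_group (2 ^ 1))"
    \<comment> \<open>\<open>5 ^ k - 1\<close> is even, so every \<open>a\<close> extends to a
      cocycle.\<close>
    obtain b where "K * of_int t = s * b"
      using \<open>s dvd K\<close> by (metis dvdE dvd_mult2)
    then show "\<exists>a b. cocycle_pair k n a b \<and> residue a 1 = t"
      using t by (intro exI[of _ "of_int t"] exI[of _ b]) (simp add: cocycle residue_of_int_integer_mod_group[of t 1, simplified])
  next
    fix a b assume ab: "cocycle_pair k n a b"
    have "b = K * a'" if "a = s * a'" for a'
    proof -
      have "s * (b - K * a') = 0"
        using ab that by (simp add: cocycle right_diff_distrib mult_ac)
      then have "b - K * a' = 0"
        by (rule sign_times_two_eq_0[OF s(1)])
      then show ?thesis by simp
    qed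
    then have "coboundary_pair k n a b \<longleftrightarrow> s dvd a"
      unfolding coboundary by (auto simp: dvd_def)
    also have "\<dots> \<longleftrightarrow> 2 ^ 1 dvd a"
      using s(1) by (auto simp: minus_dvd_iff)
    finally show "residue a 1 = \<one>\<^bsub>integer_mod_group (2 ^ 1)\<^esub> \<longleftrightarrow> coboundary_pair k n a b"
      unfolding two_power_dvd_iff by simp
  qed (simp_all only: residue_in_integer_mod_group residue_add_integer_mod_group group_integer_mod_group)
  then show ?thesis by simp
qed

text \<open>Here the outgoing differential is injective on \<open>a\<close>, so
  \<open>a = 0\<close>, and \<open>b\<close> is free. The coboundaries
  \<open>K * a' + s * b'\<close> are exactly the multiples of 2, because \<open>K\<close> is even
  and \<open>s\<close> is 2 or -2; the condition \<open>n > 1\<close> makes the term with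
  \<open>b'\<close> available.\<close>

lemma cohomology_other_parity:
  assumes n: "n > 1" "odd n \<longleftrightarrow> even k"
  shows "Hom_cohomology \<Lambda>1 P d N n \<cong> integer_mod_group 2"
proof -
  obtain m where m: "n = Suc m" "m > 0" using n(1) by (cases n) auto
  obtain s :: z2adic where s: "s = 2 \<or> s = -2" "chi k (diff_coeff (Suc n)) = s" "chi k (diff_coeff m) = s"
    using n m by (auto simp: chi_diff_coeff)
  have D: "chi k (diff_coeff n) = 0"
    using n by (auto simp: chi_diff_coeff)
  define K where "K = chi k (koszul_coeff m)"
  have "2 dvd K"
    unfolding K_def chi_koszul_coeff using two_dvd_five_int_pow[of k] dvd_minus_iff by (simp only: split: if_split) blast
  have cocycle: "cocycle_pair k n a b \<longleftrightarrow> a = 0" for a b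
    using n sign_times_two_eq_0[OF s(1)] by (auto simp: cocycle_pair_def D s(2))
  have coboundary: "coboundary_pair k n 0 b \<longleftrightarrow> 2 ^ 1 dvd b" for b
  proof
    assume "coboundary_pair k n 0 b"
    then obtain a' b' where "b = K * a' + s * b'"
      using D by (auto simp: coboundary_pair_def m s(3) K_def)
    then show "2 ^ 1 dvd b"
      using \<open>2 dvd K\<close> s(1) by auto
  next
    assume "2 ^ 1 dvd b"
    then have "s dvd b"
      using s(1) by (auto simp: minus_dvd_iff)
    then obtain b' where b': "b = s * b'" ..
    show "coboundary_pair k n 0 b"
      unfolding coboundary_pair_def m nat.case s(3) by (rule exI[of _ 0], rule exI[of _ b']) (simp add: b')
  qed
  have "Hom_cohomology \<Lambda>1 P d N n \<cong> integer_mod_group (2 ^ 1)"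
  proof (rule rank_one(1)[where \<Psi> = "\<lambda>a b. residue b 1"])
    fix t assume "t \<in> carrier (integer_mod_group (2 ^ 1))"
    then show "\<exists>a b. cocycle_pair k n a b \<and> residue b 1 = t"
      by (intro exI[of _ 0] exI[of _ "of_int t"] conjI residue_of_int_integer_mod_group) (simp_all only: cocycle)
  next
    fix a b assume "cocycle_pair k n a b"
    then show "residue b 1 = \<one>\<^bsub>integer_mod_group (2 ^ 1)\<^esub> \<longleftrightarrow> coboundary_pair k n a b"
      by (simp only: cocycle coboundary two_power_dvd_iff one_integer_mod_group)
  qed (simp_all only: residue_in_integer_mod_group residue_add_integer_mod_group group_integer_mod_group)
  then show ?thesis by simp
qed

text \<open>In degree 1 only \<open>a'\<close> contributes to the coboundaries, so
  \<open>5 ^ k - 1\<close> takes the place of 2.\<close>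

lemma even_cocycle_1:
  assumes "even k"
  shows "cocycle_pair k 1 a b \<longleftrightarrow> a = 0"
    and "coboundary_pair k 1 a b \<longleftrightarrow> a = 0 \<and> (5 [^]\<^bsub>S1\<^esub> k - 1) dvd b"
  using assms two_times_eq_0[of a]
  by (auto simp: cocycle_pair_def coboundary_pair_def chi_diff_coeff chi_koszul_coeff)

lemma cohomology_1_even:
  assumes k: "even k" "k \<noteq> 0"
  shows "Hom_cohomology \<Lambda>1 P d N 1 \<cong> integer_mod_group (2 ^ (multiplicity 2 k + 2))"
proof -
  let ?m = "multiplicity 2 k + 2"
  obtain u where u: "u \<in> carrier S1" "5 [^]\<^bsub>S1\<^esub> k - 1 = 2 ^ ?m * u"
    using five_int_pow_minus_one[OF k(2)] by blast
  \<comment> \<open>The two divisors differ by the unit \<open>u\<close>.\<close>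
  have dvd: "(5 [^]\<^bsub>S1\<^esub> k - 1) dvd b \<longleftrightarrow> 2 ^ ?m dvd b" for b
  proof
    assume "2 ^ ?m dvd b"
    then obtain b' where "b = 2 ^ ?m * b'" ..
    moreover obtain v where "1 = u * v" using unit_S1[OF u(1)] ..
    ultimately have "b = (2 ^ ?m * u) * (v * b')"
      by (simp add: mult.assoc) (simp flip: mult.assoc[of u])
    then show "(5 [^]\<^bsub>S1\<^esub> k - 1) dvd b" unfolding u(2) by (rule dvdI)
  qed (simp only: u(2) dvd_mult_left)
  show ?thesis
  proof (rule rank_one(1)[where \<Psi> = "\<lambda>a b. residue b ?m"])
    fix t assume "t \<in> carrier (integer_mod_group (2 ^ ?m))"
    then show "\<exists>a b. cocycle_pair k 1 a b \<and> residue b ?m = t"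
      by (intro exI[of _ 0] exI[of _ "of_int t"] conjI residue_of_int_integer_mod_group) (simp_all only: even_cocycle_1[OF k(1)])
  next
    fix a b assume "cocycle_pair k 1 a b"
    then show "residue b ?m = \<one>\<^bsub>integer_mod_group (2 ^ ?m)\<^esub> \<longleftrightarrow> coboundary_pair k 1 a b"
      unfolding even_cocycle_1[OF k(1)] dvd two_power_dvd_iff by simp
  qed (simp_all only: residue_in_integer_mod_group residue_add_integer_mod_group group_integer_mod_group)
qed

lemma cohomology_1_zero:
  assumes "k = 0"
  shows "Hom_cohomology \<Lambda>1 P d N 1 \<cong> add_monoid Z2"
  using assms even_cocycle_1 add_monoid_Z2 by (intro rank_one(1)[where \<Psi> = "\<lambda>a b. b"]) auto

lemma cohomology_0_zero:
  assumes "k = 0"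
  shows "Hom_cohomology \<Lambda>1 P d N 0 \<cong> add_monoid Z2"
  using assms add_monoid_Z2
  by (intro rank_one(1)[where \<Psi> = "\<lambda>a b. a"]) (auto simp: cocycle_pair_def coboundary_pair_def chi_diff_coeff chi_koszul_coeff)

text \<open>The second cocycle condition says \<open>(5 ^ k - 1) * a = 0\<close>, and
  \<open>5 ^ k - 1\<close> is a power of 2 times a unit, so \<open>a = 0\<close>.\<close>

lemma cohomology_0_nonzero:
  assumes "k \<noteq> 0"
  shows "trivial_group (Hom_cohomology \<Lambda>1 P d N 0)"
proof -
  obtain u where u: "u \<in> carrier S1" "5 [^]\<^bsub>S1\<^esub> k - 1 = 2 ^ (multiplicity 2 k + 2) * u"
    using five_int_pow_minus_one[OF assms] by blast
  have cocycle: "cocycle_pair k 0 a b \<longleftrightarrow> a = 0 \<and> b = 0" for a b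
  proof
    assume "cocycle_pair k 0 a b"
    then have "2 ^ (multiplicity 2 k + 2) * (u * a) = 0" "b = 0"
      unfolding cocycle_pair_def chi_koszul_coeff u(2) by (simp_all add: chi_diff_coeff mult.assoc)
    then show "a = 0 \<and> b = 0"
      using two_power_times_eq_0 unit_S1[OF u(1)] by (metis mult.assoc mult.commute mult.left_neutral mult_zero_right dvdE)
  qed (simp add: cocycle_pair_def)
  have "Hom_cohomology \<Lambda>1 P d N 0 \<cong> integer_mod_group 1 \<and> group (Hom_cohomology \<Lambda>1 P d N 0)"
    by (intro conjI; rule rank_one[where \<Psi> = "\<lambda>a b. 0" and T = "integer_mod_group 1"])
      (auto simp: carrier_integer_mod_group cocycle coboundary_pair_def)
  then show ?thesis
    using isomorphic_group_triviality[of "Hom_cohomology \<Lambda>1 P d N 0" "integer_mod_group 1"] trivial_integer_mod_group by auto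
qed

end

end

section \<open>The coefficients of the height one Morava E-theory\<close>

text \<open>As \<open>u\<close> has degree -2, an even \<open>t\<close> leaves the single exponent
  \<open>- (t div 2)\<close>. For odd \<open>t\<close> only 0 remains, which is the monomial with
  coefficient 0 for any exponent.\<close>

lemma E1_degree_part_eq: "E1_degree_part t = Poly_Mapping.single (- (t div 2)) ` (if even t then UNIV else {0})"
proof (intro equalityI subsetI)
  fix f assume f: "f \<in> E1_degree_part t"
  have deg: "- 2 * l = t" if "Poly_Mapping.lookup f l \<noteq> 0" for l
    using f that by (simp add: E1_degree_part_def in_keys_iff)
  show "f \<in> Poly_Mapping.single (- (t div 2)) ` (if even t then UNIV else {0})"
  proof (cases "even t")
    case True
    have "f = Poly_Mapping.single (- (t div 2)) (Poly_Mapping.lookup f (- (t div 2)))"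
    proof (rule poly_mapping_eqI)
      fix l
      have "Poly_Mapping.lookup f l = 0" if "l \<noteq> - (t div 2)"
        using deg[of l] that by fastforce
      then show "Poly_Mapping.lookup f l = Poly_Mapping.lookup (Poly_Mapping.single (- (t div 2)) (Poly_Mapping.lookup f (- (t div 2)))) l"
        by (simp add: lookup_single when_def)
    qed
    with True show ?thesis by auto
  next
    case False
    have "Poly_Mapping.lookup f l = 0" for l
      using deg[of l] False by fastforce
    then have "f = 0" by (intro poly_mapping_eqI) simp
    with False show ?thesis by simp
  qed
qed (auto simp: E1_degree_part_def in_keys_iff lookup_single when_def split: if_splits)

lemma E1_part_simps [simp]:
  "carrier (E1_part t) = E1_degree_part t" "f \<oplus>\<^bsub>E1_part t\<^esub> h = f + h" "\<zero>\<^bsub>E1_part t\<^esub> = 0"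
  "a \<odot>\<^bsub>E1_part t\<^esub> f = E1_const a * f"
  "mod_top (E1_part t) = pullback_topology (E1_degree_part t) Poly_Mapping.lookup (product_topology (\<lambda>_. euclidean) UNIV)"
  by (simp_all add: E1_part_def)

lemma E1_const_mult_single: "E1_const a * Poly_Mapping.single l b = Poly_Mapping.single l (a * b)"
  by (simp add: E1_const_def mult_single)

lemma E1_const_add: "E1_const (a + b) = E1_const a + E1_const b"
  and E1_const_mult: "E1_const (a * b) = E1_const a * E1_const b"
  and E1_const_one: "E1_const 1 = 1"
  by (simp_all add: E1_const_def single_add mult_single)

lemma E1_part_topspace: "topspace (mod_top (E1_part t)) = E1_degree_part t"
  by (auto simp: topspace_pullback_topology)

lemma continuous_map_into_E1_part:
  assumes "\<And>w. w \<in> topspace W \<Longrightarrow> f w \<in> E1_degree_part t"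
    and "\<And>l. continuous_map W euclidean (\<lambda>w. Poly_Mapping.lookup (f w) l)"
  shows "continuous_map W (mod_top (E1_part t)) f"
  unfolding E1_part_simps
  by (rule continuous_map_pullback') (use assms in \<open>auto simp: continuous_map_componentwise_UNIV o_def\<close>)

lemma continuous_map_lookup_E1_part:
  "continuous_map (mod_top (E1_part t)) euclidean (\<lambda>f. Poly_Mapping.lookup f l)"
  using continuous_map_pullback[of "product_topology (\<lambda>_. euclidean) UNIV" euclidean "\<lambda>x. x l" "E1_degree_part t"
      "Poly_Mapping.lookup :: E1 \<Rightarrow> int \<Rightarrow> z2adic"] continuous_map_product_projection[of l UNIV "\<lambda>_. euclidean :: z2adic topology"]
  by (simp add: o_def)

text \<open>The part is a continuous image of the 2-adic integers, or of 0, hence compact; its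
  coefficients embed it into a product of copies of the 2-adic integers.\<close>

lemma profinite_E1_part: "profinite_module Z2_top_ring (E1_part t)"
proof -
  let ?T = "mod_top (E1_part t)"
  have add: "f + h \<in> E1_degree_part t" and minus: "- f \<in> E1_degree_part t" and smult: "E1_const a * f \<in> E1_degree_part t"
    if "f \<in> E1_degree_part t" "h \<in> E1_degree_part t" for f h a
    using that unfolding E1_degree_part_eq
    by (auto simp: E1_const_mult_single image_iff simp flip: single_add single_uminus split: if_splits)
  have zero: "0 \<in> E1_degree_part t" by (simp add: E1_degree_part_def)
  have group: "abelian_group (E1_part t)"
  proof (rule abelian_groupI)
    show "\<exists>h\<in>carrier (E1_part t). h \<oplus>\<^bsub>E1_part t\<^esub> f = \<zero>\<^bsub>E1_part t\<^esub>" if "f \<in> carrier (E1_part t)" for f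
      using that minus by (intro bexI[of _ "- f"]) auto
  qed (auto simp: add zero algebra_simps)
  have mod: "module Z2_top_ring (E1_part t)"
    by (rule moduleI[OF cring_Z2_top_ring group])
      (auto simp: smult distrib_left distrib_right mult.assoc E1_const_add E1_const_mult E1_const_one)
  interpret abelian_group "E1_part t" by fact
  have a_inv: "\<ominus>\<^bsub>E1_part t\<^esub> f = - f" if "f \<in> E1_degree_part t" for f
    using that minus by (intro minus_equality) auto
  let ?D = "if even t then UNIV else {0 :: z2adic}"
  have "continuous_map (subtopology euclidean ?D) ?T (Poly_Mapping.single (- (t div 2)))"
  proof (rule continuous_map_into_E1_part)
    fix l
    have "continuous_map (subtopology euclidean ?D) euclidean (\<lambda>a :: z2adic. a)"
      by (rule continuous_map_from_subtopology) simp
    then show "continuous_map (subtopology euclidean ?D) euclidean (\<lambda>w. Poly_Mapping.lookup (Poly_Mapping.single (- (t div 2)) w :: E1) l)"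
      by (cases "l = - (t div 2)") (simp_all add: lookup_single when_def)
  qed (auto simp: E1_degree_part_eq)
  moreover have "compactin (subtopology euclidean ?D) ?D"
    using profinite_space_z2adic by (auto simp: profinite_space_def compact_space_def compactin_subtopology)
  ultimately have "compactin ?T (Poly_Mapping.single (- (t div 2)) ` ?D)"
    using image_compactin by blast
  then have "compact_space ?T"
    by (simp only: compact_space_def E1_part_topspace E1_degree_part_eq)
  moreover have "continuous_map ?T (product_topology (\<lambda>_. euclidean) UNIV) Poly_Mapping.lookup"
    using continuous_map_lookup_E1_part by (simp only: continuous_map_componentwise_UNIV) blast
  ultimately have "profinite_space ?T"
  proof (rule profinite_space_injective)
    show "inj_on (Poly_Mapping.lookup :: E1 \<Rightarrow> int \<Rightarrow> z2adic) (topspace ?T)"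
      by (intro inj_onI poly_mapping_eqI) simp
    show "profinite_space (product_topology (\<lambda>_ :: int. euclidean :: z2adic topology) UNIV)"
      by (rule profinite_space_product_topology[OF profinite_space_z2adic])
  qed
  moreover have "continuous_map (prod_topology ?T ?T) ?T (\<lambda>z. fst z + snd z)"
  proof (rule continuous_map_into_E1_part)
    show "continuous_map (prod_topology ?T ?T) euclidean (\<lambda>w. Poly_Mapping.lookup (fst w + snd w) l)" for l
      unfolding lookup_add
      using continuous_map_compose[OF continuous_map_fst continuous_map_lookup_E1_part]
        continuous_map_compose[OF continuous_map_snd continuous_map_lookup_E1_part]
      by (intro continuous_map_z2adic_add) (simp_all only: o_def)
  qed (auto simp: E1_part_topspace add simp del: E1_part_simps)
  moreover have "continuous_map (prod_topology euclidean ?T) ?T (\<lambda>z. E1_const (fst z) * snd z)"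
  proof (rule continuous_map_into_E1_part)
    fix l
    have "continuous_map (prod_topology euclidean ?T) euclidean (\<lambda>w. fst w * Poly_Mapping.lookup (snd w) l)"
      using continuous_map_compose[OF continuous_map_snd continuous_map_lookup_E1_part]
      by (intro continuous_map_z2adic_mult continuous_map_fst) (simp only: o_def)
    then show "continuous_map (prod_topology euclidean ?T) euclidean (\<lambda>w. Poly_Mapping.lookup (E1_const (fst w) * snd w) l)"
      by (rule continuous_map_eq)
        (auto simp: E1_part_topspace E1_degree_part_eq E1_const_mult_single lookup_single when_def simp del: E1_part_simps split: if_splits)
  qed (auto simp: E1_part_topspace smult simp del: E1_part_simps)
  moreover have "continuous_map ?T ?T uminus"
  proof (rule continuous_map_into_E1_part)
    show "continuous_map ?T euclidean (\<lambda>w. Poly_Mapping.lookup (- w) l)" for l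
      using continuous_map_z2adic_minus[OF continuous_map_lookup_E1_part] by simp
  qed (auto simp: E1_part_topspace minus simp del: E1_part_simps)
  then have "continuous_map ?T ?T (\<lambda>f. \<ominus>\<^bsub>E1_part t\<^esub> f)"
    by (rule continuous_map_eq) (simp only: E1_part_topspace a_inv)
  ultimately show ?thesis
    using mod by (simp add: profinite_module_def case_prod_unfold E1_part_topspace[simplified])
qed

section \<open>The parts of fixed degree over the completed group algebra\<close>

abbreviation "E1_module t \<equiv> cga_module S1 S1_top (E1_part t) E1_act"

text \<open>Only one exponent occurs in a given degree, so the group acts by scalars, through the
  character with exponent \<open>- (t div 2)\<close>.\<close>

lemma E1_act_eq_smult:
  assumes "f \<in> carrier (E1_part t)"
  shows "E1_act g f = (g [^]\<^bsub>S1\<^esub> (- (t div 2))) \<odot>\<^bsub>E1_part t\<^esub> f"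
proof -
  obtain a where "f = Poly_Mapping.single (- (t div 2)) a"
    using assms by (auto simp: E1_degree_part_eq)
  then show ?thesis
    by (simp only: E1_act_single E1_part_simps E1_const_mult_single)
qed

lemma profinite_E1_module: "profinite_module \<Lambda>1 (E1_module t)"
  by (rule character.profinite_cga_module[OF profinite_E1_part E1_act_eq_smult])

lemma E1_module_simps: "carrier (E1_module t) = E1_degree_part t" "f \<oplus>\<^bsub>E1_module t\<^esub> h = f + h" "\<zero>\<^bsub>E1_module t\<^esub> = 0"
  by (simp_all add: cga_module_def E1_part_def)

lemma smult_E1_module:
  assumes "even t" "r \<in> carrier \<Lambda>1"
  shows "r \<odot>\<^bsub>E1_module t\<^esub> Poly_Mapping.single (- (t div 2)) a =
    Poly_Mapping.single (- (t div 2)) (chi (- (t div 2)) r * a)"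
proof -
  have "Poly_Mapping.single (- (t div 2)) a \<in> carrier (E1_part t)"
    using assms(1) by (simp add: E1_degree_part_eq)
  from character.smult_cga_module[OF profinite_E1_part E1_act_eq_smult assms(2) this]
  show ?thesis
    by (simp only: chi_def E1_part_simps E1_const_mult_single)
qed

text \<open>All cochains vanish; this settles odd \<open>t\<close>.\<close>

lemma Hom_cohomology_zero_module:
  assumes P: "resolution R A P d \<epsilon>" and N: "profinite_module R N" and zero: "carrier N = {\<zero>\<^bsub>N\<^esub>}"
  shows "trivial_group (Hom_cohomology R P d N n)"
proof -
  interpret pair: resolution_pair R A P d \<epsilon> P d \<epsilon>
    by (intro resolution_pair.intro P)
  have eq: "z = (\<lambda>x\<in>carrier (P n). \<zero>\<^bsub>N\<^esub>)" if "z \<in> continuous_hom R (P n) N" for z n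
    using continuous_homD(1,2)[OF that] zero by (intro extensionalityI[of _ "carrier (P n)"]) auto
  have const: "(\<lambda>x\<in>carrier (P n). \<zero>\<^bsub>N\<^esub>) \<in> continuous_hom R (P n) N" for n
    by (rule continuous_hom_const_zero[OF pair.P.profinite N])
  have cob: "z \<in> coboundaries R P d N n" if "z \<in> cocycles R P d N n" for z
  proof (cases n)
    case 0
    then show ?thesis using that eq by (auto simp: cocycles_iff coboundaries_0_iff)
  next
    case (Suc m)
    have "z = (\<lambda>x\<in>carrier (P n). \<zero>\<^bsub>N\<^esub>)" using that eq by (auto simp: cocycles_iff)
    then show ?thesis
      unfolding Suc coboundaries_Suc_iff using pair.P.d_closed by (intro conjI bexI[OF _ const[of m]]) auto
  qed
  have cocycle: "(\<lambda>x\<in>carrier (P n). \<zero>\<^bsub>N\<^esub>) \<in> cocycles R P d N n"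
    using const pair.P.d_closed by (simp add: cocycles_iff)
  have hom: "(\<lambda>_. 0) \<in> hom ((hom_group R (P n) N)\<lparr>carrier := cocycles R P d N n\<rparr>) (integer_mod_group 1)"
    by (rule homI) (auto simp: carrier_integer_mod_group)
  have "Hom_cohomology R P d N n \<cong> integer_mod_group 1 \<and> group (Hom_cohomology R P d N n)"
    by (intro conjI; rule pair.Hom_cohomology_iso[OF N _ hom]) (use cob cocycle in \<open>auto simp: carrier_integer_mod_group\<close>)
  then show ?thesis
    using isomorphic_group_triviality[of "Hom_cohomology R P d N n" "integer_mod_group 1"] trivial_integer_mod_group by auto
qed

theorem theorem6p3:
  fixes s :: nat and t :: int and \<iota> :: "z2adic \<Rightarrow> 'u"
  assumes universe: "inj \<iota>"
  shows "let H = continuous_cohomology TYPE('u) S1 S1_top (E1_part t) E1_act s in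
     (t = 0 \<and> (s = 0 \<or> s = 1) \<longrightarrow> H \<cong> add_monoid Z2) \<and>
     (\<forall>t'. s = 1 \<and> t = 4 * t' \<and> t \<noteq> 0 \<longrightarrow> H \<cong> integer_mod_group (2 ^ (multiplicity 2 t' + 3))) \<and>
     (\<forall>t'. s = 1 \<and> t = 4 * t' + 2 \<longrightarrow> H \<cong> integer_mod_group 2) \<and>
     (s \<ge> 2 \<and> even t \<longrightarrow> H \<cong> integer_mod_group 2) \<and>
     (\<not> (t = 0 \<and> (s = 0 \<or> s = 1)) \<and>
      \<not> (\<exists>t'. s = 1 \<and> t = 4 * t' \<and> t \<noteq> 0) \<and>
      \<not> (\<exists>t'. s = 1 \<and> t = 4 * t' + 2) \<and>
      \<not> (s \<ge> 2 \<and> even t) \<longrightarrow> trivial_group H)"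
proof -
  obtain c :: "z2adic cga \<times> z2adic cga \<Rightarrow> z2adic" where c: "inj_on c (carrier \<Lambda>1 \<times> carrier \<Lambda>1)"
    using exists_injection_\<Lambda>_pairs by blast
  \<comment> \<open>Pairs over the algebra embed into the 2-adic integers, and these into the
    universe.\<close>
  interpret universe_embedding "\<iota> \<circ> c"
    by unfold_locales (use universe c in \<open>auto intro: comp_inj_on inj_on_subset\<close>)
  let ?res = "\<lambda>(P :: nat \<Rightarrow> (z2adic cga, 'u) top_module, d, \<epsilon>). projective_resolution \<Lambda>1 trivial_module P d \<epsilon>"
  obtain P d \<epsilon> where P: "(SOME x. ?res x) = (P, d, \<epsilon>)"
    by (metis prod_cases3)
  \<comment> \<open>The choice in \<open>Ext\<close> is a genuine resolution because one exists
    inside the universe.\<close>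
  have "?res (SOME x. ?res x)"
    by (rule someI[of ?res "(Q, dQ, aQ)"]) (simp add: projective_resolution_Q)
  then have res: "resolution \<Lambda>1 trivial_module P d \<epsilon>"
    unfolding P by (intro resolution.intro profinite_trivial_module) (simp_all add: S1.topspace_ring_top)
  define H where "H = Hom_cohomology \<Lambda>1 P d (E1_module t) s"
  have H: "continuous_cohomology TYPE('u) S1 S1_top (E1_part t) E1_act s = H"
    unfolding continuous_cohomology_def Ext_def P H_def by simp
  show ?thesis
  proof (cases "even t")
    case False
    then have "trivial_group H"
      unfolding H_def by (intro Hom_cohomology_zero_module[OF res profinite_E1_module]) (simp add: E1_module_simps E1_degree_part_eq)
    moreover have "t \<noteq> 4 * t'" "t \<noteq> 4 * t' + 2" "t \<noteq> 0" for t'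
      using False by auto
    ultimately show ?thesis
      unfolding H Let_def using False by simp
  next
    case True
    \<comment> \<open>The part of degree \<open>t\<close> is spanned by \<open>u ^ k\<close>, and
      \<open>u\<close> has degree -2.\<close>
    define k where "k = - (t div 2)"
    have t: "t = - 2 * k" using True by (simp add: k_def)
    have "inj (Poly_Mapping.single k :: z2adic \<Rightarrow> E1)"
      by (rule injI) (metis lookup_single_eq)
    then have bij: "bij_betw (Poly_Mapping.single k) UNIV (carrier (E1_module t))"
      using True unfolding E1_module_simps E1_degree_part_eq k_def
      by (simp add: bij_betw_def)
    note N = profinite_E1_module[of t] bij
      E1_module_simps(2)[of t "Poly_Mapping.single k _" "Poly_Mapping.single k _", folded single_add, symmetric]
      smult_E1_module[OF True, folded k_def] res
    have "H \<cong> add_monoid Z2" if "t = 0" "s = 0 \<or> s = 1"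
      using that cohomology_0_zero[OF N] cohomology_1_zero[OF N] t unfolding H_def by auto
    moreover have "H \<cong> integer_mod_group (2 ^ (multiplicity 2 t' + 3))" if "s = 1" "t = 4 * t'" "t \<noteq> 0" for t'
    proof -
      have k2: "k = 2 * (- t')" "k \<noteq> 0" using that t by auto
      then have k: "k = 2 * (- t')" "even k" "k \<noteq> 0" by (blast, simp, blast)
      \<comment> \<open>The factor 2 in \<open>k = -2 t'\<close> adds one to the valuation; with the
        2 from \<open>5 ^ k - 1\<close> this makes the 3.\<close>
      from k(1) have "multiplicity 2 k = multiplicity 2 t' + 1"
        using k2(2) multiplicity_cong[of 2 k "2 * t'"] multiplicity_times_same[where p = 2 and x = t'] by simp
      then show ?thesis
        using cohomology_1_even[OF N k(2,3)] that(1) unfolding H_def by (simp add: numeral_3_eq_3)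
    qed
    moreover have "H \<cong> integer_mod_group 2" if "s = 1" "t = 4 * t' + 2" for t'
    proof -
      \<comment> \<open>\<open>k\<close> is \<open>- (2 t' + 1)\<close>, so degree 1 has the parity
        of \<open>k\<close>.\<close>
      have "odd k" using that(2) t by presburger
      then show ?thesis
        using cohomology_same_parity[OF N, of 1] that(1) unfolding H_def by simp
    qed
    moreover have "H \<cong> integer_mod_group 2" if "s \<ge> 2"
      using cohomology_same_parity[OF N, of s] cohomology_other_parity[OF N, of s] that unfolding H_def by fastforce
    moreover have "trivial_group H" if "s = 0" "t \<noteq> 0"
      using cohomology_0_nonzero[OF N] that t unfolding H_def by auto
    moreover have "(\<exists>t'. t = 4 * t') \<or> (\<exists>t'. t = 4 * t' + 2)"
      using True by presburger
    ultimately show ?thesis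
      unfolding H Let_def using True
      by (smt (verit) One_nat_def less_2_cases not_less)
  qed
qed

end
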